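(* There is a randomized algorithm (Algorithm $k$-CMeans) which, given an instance $\mathcal{G}=\{G_1,\dots,G_n\}$ of $k$-CMeans in $\mathbb{R}^d$ with $k\ge 2$ and a small $\epsilon>0$, outputs with constant probability a $(1+\epsilon)$-approximation for $k$-CMeans on $\mathcal{G}$, in $O\big(2^{\mathrm{poly}(k/\epsilon)}\,n(\log n)^{k+1}d\big)$ time.
   Context: An instance of $k$-CMeans is a set $\mathcal{G}=\{G_1,\dots,G_n\}$ of $n$ point-sets, each $G_i=\{p^i_1,\dots,p^i_{k_i}\}$ consisting of $k_i\le k$ points in $\mathbb{R}^d$. A chromatic partition of $\mathcal{G}$ is a partition of the $\sum_i k_i$ points into $k$ sets $U_1,\dots,U_k$ such that each $U_j$ contains at most one point from each $G_i$. The $k$-CMeans problem is to find $m_1,\dots,m_k\in\mathbb{R}^d$ and a chromatic partition $U_1,\dots,U_k$ minimizing $\frac1n\sum_{j}\sum_{q\in U_j}\|q-m_j\|^2$. A $(1+\epsilon)$-approximation is a solution whose objective value is at most $(1+\epsilon)$ times the minimum. Here $k$ is a fixed number, $\mathrm{poly}(k/\epsilon)$ denotes some fixed polynomial in $k/\epsilon$, and "constant probability" means a positive constant independent of the input. *)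

theory Defs
  imports
    "HOL-Probability.Probability"
    "HOL-Computational_Algebra.Polynomial"
    "HOL-Library.More_List"
begin

section \<open>Chromatic k-means\<close>

text \<open>A point of \<open>\<real>\<^sup>d\<close> is a list of \<open>d\<close> reals, since \<open>d\<close> is part of the input of the algorithm.\<close>

type_synonym point = "real list"

type_synonym family = "point list list"

definition kcmeans_instance :: "nat \<Rightarrow> nat \<Rightarrow> family \<Rightarrow> bool" where
  "kcmeans_instance k d G \<longleftrightarrow> G \<noteq> [] \<and>
     (\<forall>g\<in>set G. length g \<le> k \<and> distinct g \<and> (\<forall>p\<in>set g. length p = d))"

text \<open>Different point-sets of the family may share points, so the points that are partitioned
  are represented by index pairs: \<open>(i, t)\<close> stands for the point \<open>G ! i ! t\<close>.\<close>

definition occurrences :: "family \<Rightarrow> (nat \<times> nat) set" where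
  "occurrences G = {(i, t). i < length G \<and> t < length (G ! i)}"

text \<open>The classes \<open>U 0, \<dots>, U (k - 1)\<close> may be empty.\<close>

definition chromatic_partition :: "nat \<Rightarrow> family \<Rightarrow> (nat \<Rightarrow> (nat \<times> nat) set) \<Rightarrow> bool" where
  "chromatic_partition k G U \<longleftrightarrow>
     (\<Union>j<k. U j) = occurrences G \<and> disjoint_family_on U {..<k} \<and>
     (\<forall>j<k. \<forall>i<length G. card {q \<in> U j. fst q = i} \<le> 1)"

definition euclid_dist :: "nat \<Rightarrow> point \<Rightarrow> point \<Rightarrow> real" where
  "euclid_dist d p q = L2_set (\<lambda>l. p ! l - q ! l) {..<d}"

definition objective ::
  "nat \<Rightarrow> nat \<Rightarrow> family \<Rightarrow> (nat \<Rightarrow> point) \<Rightarrow> (nat \<Rightarrow> (nat \<times> nat) set) \<Rightarrow> real" where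
  "objective k d G m U =
     1 / real (length G) * (\<Sum>j<k. \<Sum>(i, t)\<in>U j. (euclid_dist d (G ! i ! t) (m j))\<^sup>2)"

definition solution ::
  "nat \<Rightarrow> nat \<Rightarrow> family \<Rightarrow> (nat \<Rightarrow> point) \<Rightarrow> (nat \<Rightarrow> (nat \<times> nat) set) \<Rightarrow> bool" where
  "solution k d G m U \<longleftrightarrow> (\<forall>j<k. length (m j) = d) \<and> chromatic_partition k G U"

definition optimum :: "nat \<Rightarrow> nat \<Rightarrow> family \<Rightarrow> real" where
  "optimum k d G = Inf {objective k d G m U | m U. solution k d G m U}"

definition approx_solution ::
  "real \<Rightarrow> nat \<Rightarrow> nat \<Rightarrow> family \<Rightarrow> (nat \<Rightarrow> point) \<Rightarrow> (nat \<Rightarrow> (nat \<times> nat) set) \<Rightarrow> bool" where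
  "approx_solution \<epsilon> k d G m U \<longleftrightarrow>
     solution k d G m U \<and> objective k d G m U \<le> (1 + \<epsilon>) * optimum k d G"


section \<open>Randomized real RAM programs\<close>

text \<open>The memory consists of arrays of natural numbers and arrays of real numbers, both with
  indirect addressing. Natural numbers, which serve as indices, can only be added, subtracted
  (with truncation) and compared at unit cost; there is no multiplication, bit operation or
  rounding of reals, which would make unit cost unrealistic. Division of reals by zero gives zero.\<close>

record state =
  nmem :: "nat \<Rightarrow> nat \<Rightarrow> nat"
  rmem :: "nat \<Rightarrow> nat \<Rightarrow> real"

datatype nexp = NConst nat | NGet nat nexp | NAdd nexp nexp | NSub nexp nexp

datatype rexp = OfNat nexp | RGet nat nexp
  | RAdd rexp rexp | RSub rexp rexp | RMul rexp rexp | RDiv rexp rexp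

datatype bexp = NLess nexp nexp | RLess rexp rexp | Neg bexp | Conj bexp bexp

primrec nval :: "nexp \<Rightarrow> state \<Rightarrow> nat" where
  "nval (NConst c) s = c"
| "nval (NGet a i) s = nmem s a (nval i s)"
| "nval (NAdd e f) s = nval e s + nval f s"
| "nval (NSub e f) s = nval e s - nval f s"

primrec rval :: "rexp \<Rightarrow> state \<Rightarrow> real" where
  "rval (OfNat e) s = real (nval e s)"
| "rval (RGet a i) s = rmem s a (nval i s)"
| "rval (RAdd e f) s = rval e s + rval f s"
| "rval (RSub e f) s = rval e s - rval f s"
| "rval (RMul e f) s = rval e s * rval f s"
| "rval (RDiv e f) s = rval e s / rval f s"

primrec bval :: "bexp \<Rightarrow> state \<Rightarrow> bool" where
  "bval (NLess e f) s \<longleftrightarrow> nval e s < nval f s"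
| "bval (RLess e f) s \<longleftrightarrow> rval e s < rval f s"
| "bval (Neg b) s \<longleftrightarrow> \<not> bval b s"
| "bval (Conj b c) s \<longleftrightarrow> bval b s \<and> bval c s"

primrec ncost :: "nexp \<Rightarrow> nat" where
  "ncost (NConst c) = 1"
| "ncost (NGet a i) = 1 + ncost i"
| "ncost (NAdd e f) = 1 + ncost e + ncost f"
| "ncost (NSub e f) = 1 + ncost e + ncost f"

primrec rcost :: "rexp \<Rightarrow> nat" where
  "rcost (OfNat e) = 1 + ncost e"
| "rcost (RGet a i) = 1 + ncost i"
| "rcost (RAdd e f) = 1 + rcost e + rcost f"
| "rcost (RSub e f) = 1 + rcost e + rcost f"
| "rcost (RMul e f) = 1 + rcost e + rcost f"
| "rcost (RDiv e f) = 1 + rcost e + rcost f"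

primrec bcost :: "bexp \<Rightarrow> nat" where
  "bcost (NLess e f) = 1 + ncost e + ncost f"
| "bcost (RLess e f) = 1 + rcost e + rcost f"
| "bcost (Neg b) = 1 + bcost b"
| "bcost (Conj b c) = 1 + bcost b + bcost c"

text \<open>\<open>NSet a i e\<close> and \<open>RSet a i e\<close> store the value of \<open>e\<close> in cell \<open>i\<close> of array \<open>a\<close>;
  \<open>Sample a i e\<close> stores a uniformly random element of \<open>{..<e}\<close> there.\<close>

datatype com = Skip
  | NSet nat nexp nexp
  | RSet nat nexp rexp
  | Sample nat nexp nexp
  | Seq com com
  | If bexp com com
  | While bexp com

definition nput :: "nat \<Rightarrow> nat \<Rightarrow> nat \<Rightarrow> state \<Rightarrow> state" where
  "nput a i v s = s\<lparr>nmem := (nmem s)(a := (nmem s a)(i := v))\<rparr>"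

definition rput :: "nat \<Rightarrow> nat \<Rightarrow> real \<Rightarrow> state \<Rightarrow> state" where
  "rput a i v s = s\<lparr>rmem := (rmem s)(a := (rmem s a)(i := v))\<rparr>"

definition delay :: "nat \<Rightarrow> (state \<times> nat) pmf \<Rightarrow> (state \<times> nat) pmf" where
  "delay t D = map_pmf (\<lambda>(s, t'). (s, t + t')) D"

text \<open>\<open>exec c s D\<close>: started in \<open>s\<close>, the program \<open>c\<close> terminates for all outcomes of the random
  choices, and \<open>D\<close> is the joint distribution of the final state and the running time. Sampling
  from an empty range gets stuck.\<close>

inductive exec :: "com \<Rightarrow> state \<Rightarrow> (state \<times> nat) pmf \<Rightarrow> bool" where
  exec_Skip: "exec Skip s (return_pmf (s, 1))"
| exec_NSet: "exec (NSet a i e) s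
    (return_pmf (nput a (nval i s) (nval e s) s, 1 + ncost i + ncost e))"
| exec_RSet: "exec (RSet a i e) s
    (return_pmf (rput a (nval i s) (rval e s) s, 1 + ncost i + rcost e))"
| exec_Sample: "nval e s > 0 \<Longrightarrow> exec (Sample a i e) s
    (map_pmf (\<lambda>v. (nput a (nval i s) v s, 1 + ncost i + ncost e)) (pmf_of_set {..<nval e s}))"
| exec_Seq: "exec c\<^sub>1 s D \<Longrightarrow> (\<And>s' t. (s', t) \<in> set_pmf D \<Longrightarrow> exec c\<^sub>2 s' (E s')) \<Longrightarrow>
    exec (Seq c\<^sub>1 c\<^sub>2) s (bind_pmf D (\<lambda>(s', t). delay t (E s')))"
| exec_If: "exec (if bval b s then c\<^sub>1 else c\<^sub>2) s D \<Longrightarrow>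
    exec (If b c\<^sub>1 c\<^sub>2) s (delay (1 + bcost b) D)"
| exec_While: "exec (If b (Seq c (While b c)) Skip) s D \<Longrightarrow> exec (While b c) s D"

lemma exec_deterministic: "exec c s D \<Longrightarrow> exec c s D' \<Longrightarrow> D = D'"
proof (induction arbitrary: D' rule: exec.induct)
  case (exec_Seq c\<^sub>1 s D c\<^sub>2 E)
  from exec_Seq.prems obtain D1 E1 where
    D1: "exec c\<^sub>1 s D1" and E1: "\<And>s' t. (s', t) \<in> set_pmf D1 \<Longrightarrow> exec c\<^sub>2 s' (E1 s')"
    and D': "D' = bind_pmf D1 (\<lambda>(s', t). delay t (E1 s'))"
    by (cases rule: exec.cases) auto
  have "D = D1" using exec_Seq.IH(1) D1 .
  moreover have "E s' = E1 s'" if "(s', t) \<in> set_pmf D" for s' t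
    using exec_Seq.IH(2)[OF that] E1 that \<open>D = D1\<close> by blast
  ultimately show ?case unfolding D' by (auto intro!: bind_pmf_cong)
next
  case (exec_If b s c\<^sub>1 c\<^sub>2 D)
  from exec_If.prems show ?case
    by (cases rule: exec.cases) (use exec_If.IH in auto)
next
  case (exec_While b c s D)
  from exec_While.prems show ?case
    by (cases rule: exec.cases) (use exec_While.IH in auto)
qed (auto elim: exec.cases)


section \<open>Input and output conventions\<close>

text \<open>Input: array 0 of the naturals holds \<open>n, d, k\<close>, array 1 the sizes of the point-sets; array 0
  of the reals holds \<open>\<epsilon>\<close>, array 1 the coordinates of all points in order. All other cells are 0.\<close>

definition input_state :: "nat \<Rightarrow> nat \<Rightarrow> real \<Rightarrow> family \<Rightarrow> state" where
  "input_state k d \<epsilon> G =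
     \<lparr>nmem = (\<lambda>a. nth_default 0
        (if a = 0 then [length G, d, k] else if a = 1 then map length G else [])),
      rmem = (\<lambda>a. nth_default 0
        (if a = 0 then [\<epsilon>] else if a = 1 then concat (concat G) else []))\<rparr>"

text \<open>Output: array 2 of the reals holds the coordinates of the centers in order, array 2 of the
  naturals the index of the class of each point, the points being in the same order as in
  the input.\<close>

definition output_centers :: "nat \<Rightarrow> state \<Rightarrow> nat \<Rightarrow> point" where
  "output_centers d s j = map (\<lambda>l. rmem s 2 (j * d + l)) [0..<d]"

definition output_partition :: "family \<Rightarrow> state \<Rightarrow> nat \<Rightarrow> (nat \<times> nat) set" where
  "output_partition G s j =
     {(i, t) \<in> occurrences G. nmem s 2 (length (concat (take i G)) + t) = j}"

end

theory Submission
  imports Defs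
begin

text \<open>The program opens one center after the other. The candidates for the next center are the means of
  \<open>O(1/\<epsilon>)\<close> random vectors, each of them with equal probability one of the earlier centers, the origin,
  or an input point drawn with probability proportional to its squared distance to these. If some
  cluster of an optimal partition without a center still has a considerable share of the total
  squared distance, then every one of its points that is not close to an earlier center is drawn with
  probability \<open>poly(\<epsilon>/k) / size\<close>, while the close ones are represented by their nearest center; hence the
  mean of the samples is close to the mean of the cluster with probability \<open>2 ^ - poly(k/\<epsilon>)\<close>. If no
  such cluster is left, then a mean of earlier centers serves for each remaining cluster. The
  centers are completed by an optimal chromatic assignment, found for each point-set by exhaustive
  search, and the best of \<open>2 ^ poly(k/\<epsilon>)\<close> independent trials is returned. The running time is linear
  in \<open>n\<close>.\<close>


section \<open>Reasoning about randomized programs\<close>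

text \<open>The sampling is analysed for an arbitrary fixed partition, which the program never sees.
  The chromatic constraint enters only with the final assignment, where it splits into one small
  problem per point-set; an optimal partition with relabelled classes is again chromatic, so it
  competes there. Independence of random choices is never invoked. A lower bound for an expectation
  is carried backwards through the program, and every random loop has its own submartingale:
  \<open>\<gamma> ^ r * \<Psi> r S\<close> over the samples of one center, a power of the success
  probability of one center over the centers, and the probability that some remaining trial succeeds
  over the trials. The machine draws only uniform integers, so squared distance sampling has a
  resolution \<open>1 / M\<close>. To lose at most half of the probability that the argument needs,
  \<open>M\<close> grows linearly with the number of points; it is counted up once, in the setup.
  Sample size and number of trials depend on \<open>k\<close> and \<epsilon> alone, which keeps the
  time linear in \<open>n\<close>.\<close>

primrec nwrites :: "com \<Rightarrow> nat set" where
  "nwrites Skip = {}"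
| "nwrites (NSet a i e) = {a}"
| "nwrites (RSet a i e) = {}"
| "nwrites (Sample a i e) = {a}"
| "nwrites (Seq c1 c2) = nwrites c1 \<union> nwrites c2"
| "nwrites (If b c1 c2) = nwrites c1 \<union> nwrites c2"
| "nwrites (While b c) = nwrites c"

primrec rwrites :: "com \<Rightarrow> nat set" where
  "rwrites Skip = {}"
| "rwrites (NSet a i e) = {}"
| "rwrites (RSet a i e) = {a}"
| "rwrites (Sample a i e) = {}"
| "rwrites (Seq c1 c2) = rwrites c1 \<union> rwrites c2"
| "rwrites (If b c1 c2) = rwrites c1 \<union> rwrites c2"
| "rwrites (While b c) = rwrites c"

text \<open>The arrays that a program may write are read off its syntax. Specifications therefore
  state only what changes; the rules supply that all other arrays keep their contents.\<close>

definition frame :: "com \<Rightarrow> state \<Rightarrow> state \<Rightarrow> bool" where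
  "frame c s s' \<longleftrightarrow> (\<forall>a. a \<notin> nwrites c \<longrightarrow> nmem s' a = nmem s a) \<and>
     (\<forall>a. a \<notin> rwrites c \<longrightarrow> rmem s' a = rmem s a)"

lemma nmem_nput [simp]: "nmem (nput a i v s) = (nmem s)(a := (nmem s a)(i := v))"
  by (simp add: nput_def)

lemma rmem_nput [simp]: "rmem (nput a i v s) = rmem s"
  by (simp add: nput_def)

lemma rmem_rput [simp]: "rmem (rput a i v s) = (rmem s)(a := (rmem s a)(i := v))"
  by (simp add: rput_def)

lemma nmem_rput [simp]: "nmem (rput a i v s) = nmem s"
  by (simp add: rput_def)

lemma frame_refl: "frame c s s"
  by (simp add: frame_def)

lemma frame_trans: "frame c s s' \<Longrightarrow> frame c s' s'' \<Longrightarrow> frame c s s''"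
  by (simp add: frame_def)

lemma frame_mono:
  "frame c s s' \<Longrightarrow> nwrites c \<subseteq> nwrites c' \<Longrightarrow> rwrites c \<subseteq> rwrites c' \<Longrightarrow> frame c' s s'"
  unfolding frame_def by blast

lemma exec_frame: "exec c s D \<Longrightarrow> (s', t) \<in> set_pmf D \<Longrightarrow> frame c s s'"
proof (induction arbitrary: s' t rule: exec.induct)
  case (exec_Seq c1 s D c2 E)
  from exec_Seq.prems obtain s1 t1 t2 where "(s1, t1) \<in> set_pmf D" "(s', t2) \<in> set_pmf (E s1)"
    by (auto simp: delay_def)
  then have "frame c1 s s1" "frame c2 s1 s'" using exec_Seq.IH by blast+
  then show ?case by (metis frame_mono frame_trans nwrites.simps(5) rwrites.simps(5) sup_ge1 sup_ge2)
next
  case (exec_Sample e s a i)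
  from exec_Sample.prems exec_Sample.hyps show ?case
    by (auto simp: frame_def)
next
  case (exec_If b s c1 c2 D)
  from exec_If.prems obtain t' where "(s', t') \<in> set_pmf D" by (auto simp: delay_def)
  from exec_If.IH[OF this] show ?case by (auto simp: frame_def split: if_splits)
next
  case (exec_While b c s D)
  from exec_While.IH[OF exec_While.prems] show ?case by (auto simp: frame_def)
qed (auto simp: frame_def)

text \<open>Time and postcondition are worst-case; \<open>v\<close> is a lower bound for the expectation of \<open>f\<close>.\<close>

definition run :: "com \<Rightarrow> state \<Rightarrow> nat \<Rightarrow> (state \<Rightarrow> bool) \<Rightarrow> (state \<Rightarrow> ennreal) \<Rightarrow> ennreal \<Rightarrow> bool" where
  "run c s T Q f v \<longleftrightarrow> (\<exists>D. exec c s D \<and> (\<forall>(s', t)\<in>set_pmf D. t \<le> T \<and> Q s') \<and>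
     v \<le> (\<integral>\<^sup>+ x. f (fst x) \<partial>measure_pmf D))"

abbreviation ok :: "com \<Rightarrow> state \<Rightarrow> nat \<Rightarrow> (state \<Rightarrow> bool) \<Rightarrow> bool" where
  "ok c s T Q \<equiv> run c s T Q (\<lambda>_. 0) 0"

lemma run_weaken:
  assumes "run c s T Q f v" "T \<le> T'" "\<And>s'. Q s' \<Longrightarrow> frame c s s' \<Longrightarrow> Q' s'"
    "\<And>s'. Q s' \<Longrightarrow> frame c s s' \<Longrightarrow> f s' \<le> f' s'" "v' \<le> v"
  shows "run c s T' Q' f' v'"
proof -
  obtain D where D: "exec c s D" "\<And>s' t. (s', t) \<in> set_pmf D \<Longrightarrow> t \<le> T \<and> Q s'"
    "v \<le> (\<integral>\<^sup>+ x. f (fst x) \<partial>measure_pmf D)"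
    using assms(1) by (auto simp: run_def)
  have "(\<integral>\<^sup>+ x. f (fst x) \<partial>measure_pmf D) \<le> (\<integral>\<^sup>+ x. f' (fst x) \<partial>measure_pmf D)"
    by (intro nn_integral_mono_AE)
      (use D assms(4) exec_frame in \<open>auto simp: AE_measure_pmf_iff\<close>)
  with D assms(2,3,5) exec_frame show ?thesis unfolding run_def
    by (intro exI[of _ D]) (force intro: order_trans)
qed

text \<open>How a deterministic part contributes to a probability bound: what holds of every outcome
  holds in expectation.\<close>

lemma ok_run:
  assumes "ok c s T Q" "\<And>s'. Q s' \<Longrightarrow> frame c s s' \<Longrightarrow> v \<le> f s'"
  shows "run c s T Q f v"
proof -
  obtain D where D: "exec c s D" "\<And>s' t. (s', t) \<in> set_pmf D \<Longrightarrow> t \<le> T \<and> Q s'"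
    using assms(1) by (auto simp: run_def)
  have "v = (\<integral>\<^sup>+ x. v \<partial>measure_pmf D)" by simp
  also have "\<dots> \<le> (\<integral>\<^sup>+ x. f (fst x) \<partial>measure_pmf D)"
    by (intro nn_integral_mono_AE)
      (use D assms(2) exec_frame in \<open>auto simp: AE_measure_pmf_iff\<close>)
  finally show ?thesis using D unfolding run_def by blast
qed

lemma run_ok: "run c s T Q f v \<Longrightarrow> ok c s T Q"
  by (auto simp: run_def)

lemma run_scale: "run c s T Q f v \<Longrightarrow> run c s T Q (\<lambda>s'. b * f s') (b * v)"
  unfolding run_def by (elim exE conjE, intro exI conjI, assumption, assumption)
    (simp add: nn_integral_cmult mult_left_mono)

lemma ok_weaken:
  assumes "ok c s T Q" "T \<le> T'" "\<And>s'. Q s' \<Longrightarrow> frame c s s' \<Longrightarrow> Q' s'"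
  shows "ok c s T' Q'"
  using assms by (rule run_weaken) auto

lemma nn_integral_delay:
  "(\<integral>\<^sup>+ x. f (fst x) \<partial>measure_pmf (delay t D)) = (\<integral>\<^sup>+ x. f (fst x) \<partial>measure_pmf D)"
  by (simp add: delay_def case_prod_beta)

lemma run_Skip: "1 \<le> T \<Longrightarrow> Q s \<Longrightarrow> v \<le> f s \<Longrightarrow> run Skip s T Q f v"
  unfolding run_def by (intro exI conjI, rule exec_Skip) auto

lemma run_NSet:
  "1 + ncost i + ncost e \<le> T \<Longrightarrow> Q (nput a (nval i s) (nval e s) s) \<Longrightarrow>
   v \<le> f (nput a (nval i s) (nval e s) s) \<Longrightarrow> run (NSet a i e) s T Q f v"
  unfolding run_def by (intro exI conjI, rule exec_NSet) auto

lemma run_RSet: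
  "1 + ncost i + rcost e \<le> T \<Longrightarrow> Q (rput a (nval i s) (rval e s) s) \<Longrightarrow>
   v \<le> f (rput a (nval i s) (rval e s) s) \<Longrightarrow> run (RSet a i e) s T Q f v"
  unfolding run_def by (intro exI conjI, rule exec_RSet) auto

lemma run_Sample:
  assumes "nval e s > 0" "1 + ncost i + ncost e \<le> T"
    "\<And>u. u < nval e s \<Longrightarrow> Q (nput a (nval i s) u s)"
    "v \<le> (\<Sum>u<nval e s. f (nput a (nval i s) u s)) / of_nat (nval e s)"
  shows "run (Sample a i e) s T Q f v"
proof -
  have ne: "{..<nval e s} \<noteq> {}" using assms(1) by auto
  let ?D = "map_pmf (\<lambda>v. (nput a (nval i s) v s, 1 + ncost i + ncost e)) (pmf_of_set {..<nval e s})"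
  have "(\<integral>\<^sup>+ x. f (fst x) \<partial>measure_pmf ?D) = (\<Sum>u<nval e s. f (nput a (nval i s) u s)) / of_nat (nval e s)"
    using ne by (simp add: nn_integral_pmf_of_set)
  moreover have "exec (Sample a i e) s ?D" using assms(1) by (rule exec_Sample)
  ultimately show ?thesis unfolding run_def using assms ne
    by (intro exI[of _ ?D]) auto
qed

text \<open>\<open>g s'\<close> is an expectation that the second program guarantees from
  \<open>s'\<close>, and the first program has to reach expectation \<open>v\<close> of it. Chaining
  this rule replaces all reasoning about independent choices.\<close>

lemma run_Seq:
  assumes "run c1 s T1 P g v"
    and "\<And>s'. P s' \<Longrightarrow> frame c1 s s' \<Longrightarrow> run c2 s' T2 Q f (g s')"
  shows "run (Seq c1 c2) s (T1 + T2) Q f v"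
proof -
  obtain D where D: "exec c1 s D" "\<And>s' t. (s', t) \<in> set_pmf D \<Longrightarrow> t \<le> T1 \<and> P s'"
    "v \<le> (\<integral>\<^sup>+ x. g (fst x) \<partial>measure_pmf D)"
    using assms(1) by (auto simp: run_def)
  \<comment> \<open>\<open>exec_Seq\<close> wants the second distribution as a function of the
    intermediate state alone, so one is chosen per state; it is arbitrary for states that do not
    occur.\<close>
  have "\<forall>s'. \<exists>E. (\<exists>t. (s', t) \<in> set_pmf D) \<longrightarrow> exec c2 s' E \<and> (\<forall>(s', t)\<in>set_pmf E. t \<le> T2 \<and> Q s') \<and>
     g s' \<le> (\<integral>\<^sup>+ x. f (fst x) \<partial>measure_pmf E)"
    using D assms(2) exec_frame unfolding run_def by meson
  then obtain E where E: "\<And>s' t. (s', t) \<in> set_pmf D \<Longrightarrow> exec c2 s' (E s') \<and>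
      (\<forall>(s', t)\<in>set_pmf (E s'). t \<le> T2 \<and> Q s') \<and>
      g s' \<le> (\<integral>\<^sup>+ x. f (fst x) \<partial>measure_pmf (E s'))"
    by metis
  let ?D = "bind_pmf D (\<lambda>(s', t). delay t (E s'))"
  have 1: "exec (Seq c1 c2) s ?D" using D(1) E by (intro exec_Seq) auto
  have 2: "t \<le> T1 + T2 \<and> Q s'" if "(s', t) \<in> set_pmf ?D" for s' t
  proof -
    from that obtain s1 t1 t2 where st: "(s1, t1) \<in> set_pmf D" "(s', t2) \<in> set_pmf (E s1)" "t = t1 + t2"
      by (auto simp: delay_def)
    then show ?thesis using D(2)[OF st(1)] E[OF st(1)] by fastforce
  qed
  have "(\<integral>\<^sup>+ x. g (fst x) \<partial>measure_pmf D) \<le>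
     (\<integral>\<^sup>+ x. (\<integral>\<^sup>+ y. f (fst y) \<partial>measure_pmf (E (fst x))) \<partial>measure_pmf D)"
    by (intro nn_integral_mono_AE) (use E in \<open>auto simp: AE_measure_pmf_iff\<close>)
  also have "\<dots> = (\<integral>\<^sup>+ x. f (fst x) \<partial>measure_pmf ?D)"
    by (simp add: case_prod_beta nn_integral_delay)
  finally have 3: "v \<le> (\<integral>\<^sup>+ x. f (fst x) \<partial>measure_pmf ?D)" using D(3) by simp
  show ?thesis unfolding run_def using 1 2 3 by blast
qed

lemma run_If:
  assumes "bval b s \<Longrightarrow> run c1 s T Q f v" "\<not> bval b s \<Longrightarrow> run c2 s T Q f v"
  shows "run (If b c1 c2) s (1 + bcost b + T) Q f v"
proof -
  obtain D where D: "exec (if bval b s then c1 else c2) s D"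
    "\<And>s' t. (s', t) \<in> set_pmf D \<Longrightarrow> t \<le> T \<and> Q s'"
    "v \<le> (\<integral>\<^sup>+ x. f (fst x) \<partial>measure_pmf D)"
    using assms by (cases "bval b s") (auto simp: run_def)
  have "exec (If b c1 c2) s (delay (1 + bcost b) D)" using D(1) by (rule exec_If)
  moreover have "t \<le> 1 + bcost b + T \<and> Q s'" if "(s', t) \<in> set_pmf (delay (1 + bcost b) D)" for s' t
    using that D(2) by (auto simp: delay_def)
  ultimately show ?thesis using D(3) unfolding run_def
    by (intro exI[of _ "delay (1 + bcost b) D"]) (auto simp: nn_integral_delay)
qed

text \<open>A single unfolding. Termination is part of \<open>exec\<close>, so loops are treated by
  induction on the number of remaining rounds.\<close>

lemma run_While:
  assumes "bval b s \<Longrightarrow> run (Seq c (While b c)) s T Q f v" "\<not> bval b s \<Longrightarrow> Q s \<and> v \<le> f s" "1 \<le> T"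
  shows "run (While b c) s (1 + bcost b + T) Q f v"
proof -
  have "run (If b (Seq c (While b c)) Skip) s (1 + bcost b + T) Q f v"
    using assms by (intro run_If) (auto intro: run_Skip)
  then show ?thesis unfolding run_def by (meson exec_While)
qed

lemma run_time: "run c s T Q f v \<Longrightarrow> T \<le> T' \<Longrightarrow> run c s T' Q f v"
  by (erule run_weaken) auto

lemma ok_NSet: "Q (nput a (nval i s) (nval e s) s) \<Longrightarrow> ok (NSet a i e) s (1 + ncost i + ncost e) Q"
  by (rule run_NSet) auto

lemma ok_RSet: "Q (rput a (nval i s) (rval e s) s) \<Longrightarrow> ok (RSet a i e) s (1 + ncost i + rcost e) Q"
  by (rule run_RSet) auto

lemma ok_Skip: "Q s \<Longrightarrow> ok Skip s 1 Q"
  by (rule run_Skip) auto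

lemma run_Seq_NSet:
  "run c (nput a (nval i s) (nval e s) s) T Q f v \<Longrightarrow>
   run (Seq (NSet a i e) c) s (1 + ncost i + ncost e + T) Q f v"
  by (rule run_Seq[where P = "\<lambda>s'. s' = nput a (nval i s) (nval e s) s" and g = "\<lambda>_. v"])
    (auto intro: run_NSet)

lemma run_Seq_RSet:
  "run c (rput a (nval i s) (rval e s) s) T Q f v \<Longrightarrow>
   run (Seq (RSet a i e) c) s (1 + ncost i + rcost e + T) Q f v"
  by (rule run_Seq[where P = "\<lambda>s'. s' = rput a (nval i s) (rval e s) s" and g = "\<lambda>_. v"])
    (auto intro: run_RSet)

lemma run_Seq_ok:
  "ok c1 s T1 Q1 \<Longrightarrow> (\<And>s'. Q1 s' \<Longrightarrow> frame c1 s s' \<Longrightarrow> run c2 s' T2 Q f v) \<Longrightarrow>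
   run (Seq c1 c2) s (T1 + T2) Q f v"
  by (rule run_Seq[where P = "\<lambda>s'. Q1 s' \<and> frame c1 s s'" and g = "\<lambda>_. v"]) (auto intro: ok_run ok_weaken)

lemma ok_If:
  assumes "bval b s \<Longrightarrow> ok c1 s T1 Q" "\<not> bval b s \<Longrightarrow> ok c2 s T2 Q"
  shows "ok (If b c1 c2) s (1 + bcost b + (T1 + T2)) Q"
  using assms by (intro run_If) (auto elim: run_time)

abbreviation V :: "nat \<Rightarrow> nexp" where "V a \<equiv> NGet a (NConst 0)"
abbreviation RV :: "nat \<Rightarrow> rexp" where "RV a \<equiv> RGet a (NConst 0)"
abbreviation nset :: "nat \<Rightarrow> nexp \<Rightarrow> com" where "nset a e \<equiv> NSet a (NConst 0) e"
abbreviation rset :: "nat \<Rightarrow> rexp \<Rightarrow> com" where "rset a e \<equiv> RSet a (NConst 0) e"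
abbreviation seq :: "com \<Rightarrow> com \<Rightarrow> com" (infixr \<open>;;\<close> 60) where "c ;; c' \<equiv> Seq c c'"

definition For :: "nat \<Rightarrow> nexp \<Rightarrow> com \<Rightarrow> com" where
  "For a e c = nset a (NConst 0) ;;
     While (NLess (V a) e) (c ;; nset a (NAdd (V a) (NConst 1)))"

lemma writes_For [simp]:
  "nwrites (For a e c) = insert a (nwrites c)" "rwrites (For a e c) = rwrites c"
  by (auto simp: For_def)

lemma frame_nput: "frame c s s' \<Longrightarrow> a \<in> nwrites c \<Longrightarrow> frame c s (nput a i v s')"
  by (auto simp: frame_def)

text \<open>\<open>f\<close> is a submartingale along the loop: by the step hypothesis, one round
  does not lower its expectation. Invariant and \<open>f\<close> are evaluated after the counter has
  been increased, because the body runs before the increment. The loop bound must have the same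
  value in every state that agrees with the initial one on the arrays the loop does not
  write.\<close>

lemma run_For:
  assumes bound: "\<And>s'. frame (For a e c) s s' \<Longrightarrow> nval e s' = B"
    and "a \<notin> nwrites c"
    and step: "\<And>i s'. i < B \<Longrightarrow> frame (For a e c) s s' \<Longrightarrow> nmem s' a 0 = i \<Longrightarrow> J i s' \<Longrightarrow>
       run c s' T (\<lambda>s''. J (Suc i) (nput a 0 (Suc i) s'')) (\<lambda>s''. f (Suc i) (nput a 0 (Suc i) s'')) (f i s')"
    and "J 0 (nput a 0 0 s)" "v \<le> f 0 (nput a 0 0 s)"
  shows "run (For a e c) s ((B + 1) * (T + 14 + ncost e)) (\<lambda>s'. J B s' \<and> nmem s' a 0 = B) (f B) v"
proof -
  let ?inc = "nset a (NAdd (V a) (NConst 1))"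
  let ?W = "While (NLess (V a) e) (c ;; ?inc)"
  let ?fr = "frame (For a e c) s"
  have W: "run ?W s' (Suc r * (T + 11 + ncost e)) (\<lambda>s'. J B s' \<and> nmem s' a 0 = B) (f B) (f i s')"
    if "i + r = B" "?fr s'" "nmem s' a 0 = i" "J i s'" for r i s'
    using that
  proof (induction r arbitrary: i s')
    case 0
    have "run ?W s' (1 + bcost (NLess (V a) e) + 1) (\<lambda>s'. J B s' \<and> nmem s' a 0 = B) (f B) (f i s')"
      using 0 bound by (intro run_While) auto
    then show ?case by (rule run_weaken) auto
  next
    case (Suc r)
    have "i < B" using Suc by simp
    have "run ?W s' (1 + bcost (NLess (V a) e) + (T + 6 + Suc r * (T + 11 + ncost e)))
        (\<lambda>s'. J B s' \<and> nmem s' a 0 = B) (f B) (f i s')"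
    proof (rule run_While)
      let ?Q1 = "\<lambda>s''. J (Suc i) s'' \<and> nmem s'' a 0 = Suc i \<and> ?fr s''"
      have 1: "run (c ;; ?inc) s' (T + 6) ?Q1 (f (Suc i)) (f i s')"
      proof (rule run_Seq)
        show "run c s' T (\<lambda>s''. J (Suc i) (nput a 0 (Suc i) s'')) (\<lambda>s''. f (Suc i) (nput a 0 (Suc i) s'')) (f i s')"
          using step \<open>i < B\<close> Suc.prems by blast
        fix s'' assume J: "J (Suc i) (nput a 0 (Suc i) s'')" and fr: "frame c s' s''"
        have a: "nmem s'' a 0 = i" using fr \<open>a \<notin> nwrites c\<close> Suc.prems by (auto simp: frame_def)
        have "frame (For a e c) s' s''" using fr by (rule frame_mono) auto
        then have "?fr s''" using Suc.prems frame_trans by blast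
        then have "?fr (nput a 0 (Suc i) s'')" by (rule frame_nput) simp
        then show "run ?inc s'' 6 ?Q1 (f (Suc i)) (f (Suc i) (nput a 0 (Suc i) s''))"
          using a J by (intro run_NSet) auto
      qed
      have "run (Seq (c ;; ?inc) ?W) s' (T + 6 + Suc r * (T + 11 + ncost e))
         (\<lambda>s'. J B s' \<and> nmem s' a 0 = B) (f B) (f i s')"
        by (rule run_Seq[OF 1]) (use Suc in auto)
      then show "run (Seq (c ;; ?inc) ?W) s' (T + 6 + Suc r * (T + 11 + ncost e))
         (\<lambda>s'. J B s' \<and> nmem s' a 0 = B) (f B) (f i s')" .
    qed (use Suc bound \<open>i < B\<close> in auto)
    then show ?case by (rule run_weaken) auto
  qed
  have "run (For a e c) s (3 + Suc B * (T + 11 + ncost e)) (\<lambda>s'. J B s' \<and> nmem s' a 0 = B) (f B) v"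
    unfolding For_def
  proof (rule run_Seq)
    show "run (nset a (NConst 0)) s 3 (\<lambda>s'. J 0 s' \<and> nmem s' a 0 = 0 \<and> ?fr s') (f 0) v"
      using assms(4,5) by (intro run_NSet) (auto intro: frame_nput frame_refl)
  qed (use W[of 0 B] in auto)
  then show ?thesis by (rule run_weaken) auto
qed

lemma ok_For:
  assumes "\<And>s'. frame (For a e c) s s' \<Longrightarrow> nval e s' = B" "a \<notin> nwrites c"
    and "\<And>i s'. i < B \<Longrightarrow> frame (For a e c) s s' \<Longrightarrow> nmem s' a 0 = i \<Longrightarrow> J i s' \<Longrightarrow>
       ok c s' T (\<lambda>s''. J (Suc i) (nput a 0 (Suc i) s''))"
    and "J 0 (nput a 0 0 s)"
    and "\<And>s'. J B s' \<Longrightarrow> nmem s' a 0 = B \<Longrightarrow> frame (For a e c) s s' \<Longrightarrow> Q s'"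
  shows "ok (For a e c) s ((B + 1) * (T + 14 + ncost e)) Q"
proof -
  have "run (For a e c) s ((B + 1) * (T + 14 + ncost e)) (\<lambda>s'. J B s' \<and> nmem s' a 0 = B) (\<lambda>_. 0) 0"
    by (rule run_For[where f = "\<lambda>_ _. 0"]) (rule assms(1) assms(2) assms(3) assms(4) order_refl; assumption)+
  then show ?thesis by (rule ok_weaken) (use assms(5) in blast)+
qed

text \<open>Rounding is not an instruction of the machine, so the ceiling is found by counting up.\<close>

definition Ceil :: "nat \<Rightarrow> rexp \<Rightarrow> com" where
  "Ceil a e = nset a (NConst 0) ;; While (RLess (OfNat (V a)) e) (nset a (NAdd (V a) (NConst 1)))"

lemma writes_Ceil [simp]: "nwrites (Ceil a e) = {a}" "rwrites (Ceil a e) = {}"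
  by (auto simp: Ceil_def)

text \<open>The time is proportional to the result. This is affordable: the sample size depends on
  \<epsilon> alone, the resolution is linear in the number of points, and the number of trials is
  spent on the trials anyway.\<close>

lemma ok_Ceil:
  assumes bound: "\<And>s'. frame (Ceil a e) s s' \<Longrightarrow> rval e s' = x"
    and "(nat \<lceil>x\<rceil> + 1) * (14 + rcost e) \<le> T"
    and "\<And>s'. nmem s' a 0 = nat \<lceil>x\<rceil> \<Longrightarrow> frame (Ceil a e) s s' \<Longrightarrow> Q s'"
  shows "ok (Ceil a e) s T Q"
proof -
  let ?inc = "nset a (NAdd (V a) (NConst 1))"
  let ?W = "While (RLess (OfNat (V a)) e) ?inc"
  let ?fr = "frame (Ceil a e) s"
  have W: "ok ?W s' (Suc r * (11 + rcost e)) (\<lambda>s'. nmem s' a 0 = nat \<lceil>x\<rceil>)"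
    if "nmem s' a 0 + r = nat \<lceil>x\<rceil>" "?fr s'" for r s'
    using that
  proof (induction r arbitrary: s')
    case 0
    have "\<not> real (nmem s' a 0) < x" using 0 by linarith
    then have "ok ?W s' (1 + bcost (RLess (OfNat (V a)) e) + 1) (\<lambda>s'. nmem s' a 0 = nat \<lceil>x\<rceil>)"
      using 0 bound by (intro run_While) auto
    then show ?case by (rule ok_weaken) auto
  next
    case (Suc r)
    have "ok ?W s' (1 + bcost (RLess (OfNat (V a)) e) + (6 + Suc r * (11 + rcost e))) (\<lambda>s'. nmem s' a 0 = nat \<lceil>x\<rceil>)"
    proof (rule run_While)
      show "ok (Seq ?inc ?W) s' (6 + Suc r * (11 + rcost e)) (\<lambda>s'. nmem s' a 0 = nat \<lceil>x\<rceil>)"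
      proof (rule run_Seq)
        show "ok ?inc s' 6 (\<lambda>s''. nmem s'' a 0 + r = nat \<lceil>x\<rceil> \<and> ?fr s'')"
          using Suc.prems by (intro run_NSet) (auto intro: frame_nput)
      qed (use Suc.IH in auto)
      assume "\<not> bval (RLess (OfNat (V a)) e) s'"
      then have "\<not> real (nmem s' a 0) < x" using bound Suc.prems by simp
      then show "nmem s' a 0 = nat \<lceil>x\<rceil> \<and> 0 \<le> (0::ennreal)" using Suc.prems by linarith
    qed simp
    then show ?case by (rule ok_weaken) auto
  qed
  have "ok (Ceil a e) s (3 + Suc (nat \<lceil>x\<rceil>) * (11 + rcost e)) (\<lambda>s'. nmem s' a 0 = nat \<lceil>x\<rceil>)"
    unfolding Ceil_def
  proof (rule run_Seq)
    show "ok (nset a (NConst 0)) s 3 (\<lambda>s'. nmem s' a 0 = 0 \<and> ?fr s')"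
      by (intro run_NSet) (auto intro: frame_nput frame_refl)
  qed (use W in auto)
  then show ?thesis using assms(2,3) by (elim ok_weaken) (auto intro: order_trans[rotated])
qed

section \<open>Sampling a cluster\<close>

definition sqdist :: "nat \<Rightarrow> (nat \<Rightarrow> real) \<Rightarrow> (nat \<Rightarrow> real) \<Rightarrow> real" where
  "sqdist d u v = (\<Sum>l<d. (u l - v l)\<^sup>2)"

definition mean :: "'i set \<Rightarrow> ('i \<Rightarrow> nat \<Rightarrow> real) \<Rightarrow> nat \<Rightarrow> real" where
  "mean I a l = (\<Sum>i\<in>I. a i l) / real (card I)"

lemma sqdist_nonneg [simp]: "0 \<le> sqdist d u v"
  by (simp add: sqdist_def sum_nonneg)

lemma sqdist_commute: "sqdist d u v = sqdist d v u"
  by (simp add: sqdist_def power2_commute)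

text \<open>In each coordinate this is (a + b)^2 \<le> 2 a^2 + 2 b^2, that is, (a - b)^2 \<ge>
  0.\<close>

lemma sqdist_triangle: "sqdist d u w \<le> 2 * sqdist d u v + 2 * sqdist d v w"
proof -
  have "(u l - w l)\<^sup>2 \<le> 2 * (u l - v l)\<^sup>2 + 2 * (v l - w l)\<^sup>2" for l
    using zero_le_power2[of "(u l - v l) - (v l - w l)"] by (simp add: power2_eq_square algebra_simps)
  then show ?thesis
    unfolding sqdist_def sum_distrib_left sum.distrib[symmetric] by (intro sum_mono)
qed

lemma sum_minus_mean:
  assumes "finite I" "I \<noteq> {}"
  shows "(\<Sum>i\<in>I. a i l - mean I a l) = 0"
  using assms by (simp add: mean_def sum_subtractf)

text \<open>The decomposition into bias and variance. Shift \<open>u\<close> and factor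
  \<open>t\<close> describe one sampling step, where \<open>a i / m\<close> is added to a partial
  average; \<open>u = 0\<close> and \<open>t = 1\<close> give the usual identity for the
  mean.\<close>

lemma sum_sqdist_shift:
  assumes "finite I" "I \<noteq> {}"
  shows "(\<Sum>i\<in>I. sqdist d (\<lambda>l. u l + t * a i l) v) =
    real (card I) * sqdist d (\<lambda>l. u l + t * mean I a l) v + t\<^sup>2 * (\<Sum>i\<in>I. sqdist d (a i) (mean I a))"
proof -
  have 1: "(\<Sum>i\<in>I. (u l + t * a i l - v l)\<^sup>2) =
      real (card I) * (u l + t * mean I a l - v l)\<^sup>2 + t\<^sup>2 * (\<Sum>i\<in>I. (a i l - mean I a l)\<^sup>2)" for l
  proof -
    define e where "e = u l + t * mean I a l - v l"
    have "(\<Sum>i\<in>I. (u l + t * a i l - v l)\<^sup>2) =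
        (\<Sum>i\<in>I. e\<^sup>2 + 2 * e * t * (a i l - mean I a l) + t\<^sup>2 * (a i l - mean I a l)\<^sup>2)"
      by (intro sum.cong) (simp_all add: e_def power2_eq_square algebra_simps)
    also have "\<dots> = real (card I) * e\<^sup>2 + 2 * e * t * (\<Sum>i\<in>I. a i l - mean I a l) +
        t\<^sup>2 * (\<Sum>i\<in>I. (a i l - mean I a l)\<^sup>2)"
      by (simp add: sum.distrib sum_distrib_left)
    finally show ?thesis using sum_minus_mean[OF assms] by (simp add: e_def)
  qed
  have "(\<Sum>i\<in>I. sqdist d (\<lambda>l. u l + t * a i l) v) = (\<Sum>l<d. \<Sum>i\<in>I. (u l + t * a i l - v l)\<^sup>2)"
    unfolding sqdist_def by (rule sum.swap)
  also have "\<dots> = (\<Sum>l<d. real (card I) * (u l + t * mean I a l - v l)\<^sup>2 +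
      t\<^sup>2 * (\<Sum>i\<in>I. (a i l - mean I a l)\<^sup>2))"
    by (simp only: 1)
  also have "\<dots> = real (card I) * sqdist d (\<lambda>l. u l + t * mean I a l) v +
      t\<^sup>2 * (\<Sum>l<d. \<Sum>i\<in>I. (a i l - mean I a l)\<^sup>2)"
    by (simp only: sqdist_def sum.distrib sum_distrib_left)
  also have "(\<Sum>l<d. \<Sum>i\<in>I. (a i l - mean I a l)\<^sup>2) = (\<Sum>i\<in>I. sqdist d (a i) (mean I a))"
    unfolding sqdist_def by (rule sum.swap)
  finally show ?thesis .
qed

lemma sum_sqdist_mean:
  assumes "finite I" "I \<noteq> {}"
  shows "(\<Sum>i\<in>I. sqdist d (a i) v) =
    real (card I) * sqdist d (mean I a) v + (\<Sum>i\<in>I. sqdist d (a i) (mean I a))"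
  using sum_sqdist_shift[OF assms, of d "\<lambda>_. 0" 1 a v] by simp

text \<open>Cauchy-Schwarz in each coordinate: displacing points moves their mean by at most the
  root mean square displacement.\<close>

lemma sqdist_mean_le:
  assumes "finite I" "I \<noteq> {}"
  shows "real (card I) * sqdist d (mean I a) (mean I b) \<le> (\<Sum>i\<in>I. sqdist d (a i) (b i))"
proof -
  have n: "real (card I) > 0" using assms by (simp add: card_gt_0_iff)
  have 1: "real (card I) * (mean I a l - mean I b l)\<^sup>2 \<le> (\<Sum>i\<in>I. (a i l - b i l)\<^sup>2)" for l
  proof -
    have "mean I a l - mean I b l = (\<Sum>i\<in>I. a i l - b i l) / real (card I)"
      by (simp add: mean_def sum_subtractf diff_divide_distrib)
    then have "real (card I) * (mean I a l - mean I b l)\<^sup>2 = (\<Sum>i\<in>I. a i l - b i l)\<^sup>2 / real (card I)"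
      using n by (simp add: power_divide power2_eq_square)
    also have "\<dots> \<le> (\<Sum>i\<in>I. (a i l - b i l)\<^sup>2)"
      using sum_squared_le_sum_of_squares[of "\<lambda>i. a i l - b i l" I] n assms
      by (simp add: field_simps)
    finally show ?thesis .
  qed
  have "real (card I) * sqdist d (mean I a) (mean I b) \<le> (\<Sum>l<d. \<Sum>i\<in>I. (a i l - b i l)\<^sup>2)"
    unfolding sqdist_def sum_distrib_left by (intro sum_mono 1)
  also have "\<dots> = (\<Sum>i\<in>I. sqdist d (a i) (b i))"
    unfolding sqdist_def by (rule sum.swap)
  finally show ?thesis .
qed

text \<open>\<open>\<Psi> r S\<close> is a lower bound for the probability that \<open>r\<close> further uniform samples turn the
  partial average \<open>S\<close> into a point close to \<open>\<mu>\<close>; it is obtained from Markov's inequality for the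
  conditional second moment \<open>A r S\<close>.\<close>

lemma sample_mean_potential:
  assumes I: "finite I" "I \<noteq> {}" and m: "m > 0"
    and thr: "2 * (sqdist d (mean I a) \<mu> + (\<Sum>i\<in>I. sqdist d (a i) (mean I a)) / real (card I) / real m) \<le> thr"
  shows "\<exists>\<Psi>. (\<forall>r S. 0 \<le> \<Psi> r S) \<and> 1 / 2 \<le> \<Psi> m (\<lambda>_. 0) \<and>
    (\<forall>S. \<Psi> 0 S \<le> (1::real) \<and> (\<Psi> 0 S > 0 \<longrightarrow> sqdist d S \<mu> \<le> thr)) \<and>
    (\<forall>r S. \<Psi> (Suc r) S \<le> (\<Sum>i\<in>I. \<Psi> r (\<lambda>l. S l + a i l / real m)) / real (card I))"
proof -
  define v where "v = (\<Sum>i\<in>I. sqdist d (a i) (mean I a)) / real (card I)"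
  have n: "real (card I) > 0" using I by (simp add: card_gt_0_iff)
  have v0: "0 \<le> v" by (simp add: v_def sum_nonneg)
  \<comment> \<open>The expected squared distance to \<mu> after \<open>r\<close> further uniform
    samples: that of the expected final average, plus a variance of \<open>v / m ^ 2\<close> for
    each sample.\<close>
  define A where "A r S = sqdist d (\<lambda>l. S l + real r / real m * mean I a l) \<mu> + real r * v / (real m)\<^sup>2" for r S
  have A0: "0 \<le> A r S" for r S using v0 by (simp add: A_def)
  have A_step: "(\<Sum>i\<in>I. A r (\<lambda>l. S l + a i l / real m)) / real (card I) = A (Suc r) S" for r S
  proof -
    have "(\<Sum>i\<in>I. A r (\<lambda>l. S l + a i l / real m)) =
       (\<Sum>i\<in>I. sqdist d (\<lambda>l. (S l + real r / real m * mean I a l) + (1 / real m) * a i l) \<mu>) +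
       real (card I) * (real r * v / (real m)\<^sup>2)"
      by (simp add: A_def sum.distrib add.assoc add.commute add.left_commute)
    also have "\<dots> = real (card I) * sqdist d (\<lambda>l. S l + real r / real m * mean I a l + 1 / real m * mean I a l) \<mu>
       + (1 / real m)\<^sup>2 * (real (card I) * v) + real (card I) * (real r * v / (real m)\<^sup>2)"
      using n by (subst sum_sqdist_shift[OF I]) (simp add: v_def)
    also have "(\<lambda>l. S l + real r / real m * mean I a l + 1 / real m * mean I a l) =
        (\<lambda>l. S l + real (Suc r) / real m * mean I a l)"
      by (simp add: fun_eq_iff field_simps add_divide_distrib)
    finally show ?thesis using n m by (simp add: A_def field_simps)
  qed
  have Am: "A m (\<lambda>_. 0) = sqdist d (mean I a) \<mu> + v / real m"
    using m by (simp add: A_def power2_eq_square)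
  have thr': "2 * A m (\<lambda>_. 0) \<le> thr" using thr by (simp add: Am v_def)
  then have thr0: "0 \<le> thr" using A0[of m "\<lambda>_. 0"] by linarith
  \<comment> \<open>Markov's bound \<open>1 - A / thr\<close> for the probability of ending within
    \<open>thr\<close>. For \<open>thr = 0\<close> the quotient is meaningless; then distance 0 is
    certain as soon as \<open>A\<close> vanishes.\<close>
  define \<Psi> where "\<Psi> r S = (if thr > 0 then max 0 (1 - A r S / thr) else if A r S = 0 then 1 else 0)" for r S
  have "0 \<le> \<Psi> r S" for r S by (simp add: \<Psi>_def)
  moreover have "1 / 2 \<le> \<Psi> m (\<lambda>_. 0)"
    using thr' A0[of m "\<lambda>_. 0"] thr0 by (auto simp: \<Psi>_def field_simps max_def)
  moreover have "\<Psi> 0 S \<le> 1 \<and> (\<Psi> 0 S > 0 \<longrightarrow> sqdist d S \<mu> \<le> thr)" for S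
    using A0[of 0 S] thr0 by (auto simp: \<Psi>_def field_simps max_def A_def split: if_splits)
  moreover have "\<Psi> (Suc r) S \<le> (\<Sum>i\<in>I. \<Psi> r (\<lambda>l. S l + a i l / real m)) / real (card I)" for r S
  proof (cases "thr > 0")
    case True
    let ?s = "\<lambda>i l. S l + a i l / real m"
    have "1 - A (Suc r) S / thr = (\<Sum>i\<in>I. 1 - A r (?s i) / thr) / real (card I)"
      using n True A_step[of r S, symmetric] by (simp add: sum_subtractf sum_divide_distrib[symmetric] field_simps)
    also have "\<dots> \<le> (\<Sum>i\<in>I. \<Psi> r (?s i)) / real (card I)"
      using True n by (intro divide_right_mono sum_mono) (auto simp: \<Psi>_def)
    finally have "1 - A (Suc r) S / thr \<le> (\<Sum>i\<in>I. \<Psi> r (?s i)) / real (card I)" .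
    moreover have "0 \<le> (\<Sum>i\<in>I. \<Psi> r (?s i)) / real (card I)"
      by (intro divide_nonneg_nonneg sum_nonneg) (auto simp: \<Psi>_def)
    ultimately show ?thesis using True by (simp add: \<Psi>_def)
  next
    case False
    let ?s = "\<lambda>i l. S l + a i l / real m"
    show ?thesis
    proof (cases "A (Suc r) S = 0")
      case True
      \<comment> \<open>A vanishing average of nonnegative terms has only vanishing terms, so
        certainty persists under every sample.\<close>
      then have "(\<Sum>i\<in>I. A r (?s i)) = 0" using n A_step[of r S] by simp
      then have "\<forall>i\<in>I. A r (?s i) = 0" using A0 I by (simp add: sum_nonneg_eq_0_iff)
      then show ?thesis using n False by (simp add: \<Psi>_def)
    next
      case False': False
      then show ?thesis using False by (auto simp: \<Psi>_def intro!: divide_nonneg_nonneg sum_nonneg)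
    qed
  qed
  ultimately show ?thesis by blast
qed

text \<open>If item \<open>t\<close> is drawn with probability at least \<open>p t\<close>, then the mean of the vectors of \<open>m\<close> independent
  items satisfies \<open>A\<close> with probability at least \<open>\<gamma> ^ m / 2\<close>: by induction, \<open>\<gamma> ^ r * \<Psi> r S\<close> bounds the
  probability that \<open>r\<close> further items complete the partial mean \<open>S\<close> to such a vector.\<close>

definition hits :: "nat \<Rightarrow> real \<Rightarrow> nat \<Rightarrow> (nat \<Rightarrow> real) \<Rightarrow> (nat \<Rightarrow> nat \<Rightarrow> real) \<Rightarrow>
    ((nat \<Rightarrow> real) \<Rightarrow> bool) \<Rightarrow> bool" where
  "hits m \<gamma> K p pt A \<longleftrightarrow> (\<exists>\<Psi>. (\<forall>r S. 0 \<le> \<Psi> r S) \<and> 1 / 2 \<le> \<Psi> m (\<lambda>_. 0) \<and>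
     (\<forall>S. \<Psi> 0 S \<le> (1::real) \<and> (\<Psi> 0 S > 0 \<longrightarrow> A S)) \<and>
     (\<forall>r S. \<gamma> * \<Psi> (Suc r) S \<le> (\<Sum>t<K. p t * \<Psi> r (\<lambda>l. S l + pt t l / real m))))"

lemma hits_mono: "hits m \<gamma> K p pt A \<Longrightarrow> (\<And>S. A S \<Longrightarrow> A' S) \<Longrightarrow> hits m \<gamma> K p pt A'"
  unfolding hits_def by meson

text \<open>The item distribution \<open>p\<close> dominates \<gamma> times the image under
  \<open>h\<close> of the uniform distribution on \<open>I\<close>. Potentials are nonnegative, so
  the average over items is at least \<gamma> times the average over \<open>I\<close>, and the
  potential for uniform samples serves here as well.\<close>

lemma hits_near_mean:
  fixes p :: "nat \<Rightarrow> real"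
  assumes I: "finite I" "I \<noteq> {}" and m: "m > 0"
    and thr: "2 * (sqdist d (mean I (\<lambda>i. pt (h i))) \<mu> +
       (\<Sum>i\<in>I. sqdist d (pt (h i)) (mean I (\<lambda>i. pt (h i)))) / real (card I) / real m) \<le> thr"
    and h: "\<And>i. i \<in> I \<Longrightarrow> h i < K"
    and p: "\<And>t. t < K \<Longrightarrow> \<gamma> * real (card {i\<in>I. h i = t}) \<le> real (card I) * p t"
    and "\<gamma> \<ge> 0"
  shows "hits m \<gamma> K p pt (\<lambda>S. sqdist d S \<mu> \<le> thr)"
proof -
  obtain \<Psi> where \<Psi>: "\<forall>r S. 0 \<le> \<Psi> r S" "1 / 2 \<le> \<Psi> m (\<lambda>_. 0)"
    "\<forall>S. \<Psi> 0 S \<le> (1::real) \<and> (\<Psi> 0 S > 0 \<longrightarrow> sqdist d S \<mu> \<le> thr)"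
    "\<And>r S. \<Psi> (Suc r) S \<le> (\<Sum>i\<in>I. \<Psi> r (\<lambda>l. S l + pt (h i) l / real m)) / real (card I)"
    using sample_mean_potential[OF I m thr] by blast
  have n: "real (card I) > 0" using I by (simp add: card_gt_0_iff)
  have "\<gamma> * \<Psi> (Suc r) S \<le> (\<Sum>t<K. p t * \<Psi> r (\<lambda>l. S l + pt t l / real m))" for r S
  proof -
    let ?F = "\<lambda>t. \<Psi> r (\<lambda>l. S l + pt t l / real m)"
    have "(\<Sum>i\<in>I. ?F (h i)) = (\<Sum>t<K. \<Sum>i\<in>{i\<in>I. h i = t}. ?F (h i))"
      using h I by (intro sum.group[symmetric]) auto
    also have "\<dots> = (\<Sum>t<K. real (card {i\<in>I. h i = t}) * ?F t)" by simp
    finally have "\<gamma> * \<Psi> (Suc r) S \<le> \<gamma> * ((\<Sum>t<K. real (card {i\<in>I. h i = t}) * ?F t) / real (card I))"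
      using \<Psi>(4)[of r S] \<open>\<gamma> \<ge> 0\<close> by (intro mult_left_mono) auto
    also have "\<dots> = (\<Sum>t<K. \<gamma> * real (card {i\<in>I. h i = t}) / real (card I) * ?F t)"
      by (simp add: sum_distrib_left sum_divide_distrib mult.assoc)
    also have "\<dots> \<le> (\<Sum>t<K. p t * ?F t)"
      using p n \<Psi>(1) by (intro sum_mono mult_right_mono) (auto simp: field_simps)
    finally show ?thesis .
  qed
  with \<Psi> show ?thesis unfolding hits_def by blast
qed

text \<open>Item \<open>t < N\<close> is a point and item \<open>N + i\<close> is slot \<open>i\<close>, where slot 0 is the origin and slot \<open>i + 1\<close> the center
  numbered \<open>i\<close>. Each of the slots \<open>0, \<dots>, j\<close> is drawn with probability \<open>1 / (j + 2)\<close>, and otherwise point \<open>t\<close>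
  with probability \<open>W t / T\<close> up to a discretization error of \<open>1 / M\<close>.\<close>

definition draw_prob :: "nat \<Rightarrow> (nat \<Rightarrow> real) \<Rightarrow> real \<Rightarrow> real \<Rightarrow> nat \<Rightarrow> nat \<Rightarrow> real" where
  "draw_prob N W T M j t = (if t < N then max 0 (W t / T - 1 / M) else 1) / real (j + 2)"

definition item :: "nat \<Rightarrow> (nat \<Rightarrow> 'a) \<Rightarrow> (nat \<Rightarrow> 'a) \<Rightarrow> nat \<Rightarrow> 'a" where
  "item N x slot t = (if t < N then x t else slot (t - N))"

section \<open>One round of center selection against a fixed partition\<close>

locale clustered_points =
  fixes N d k :: nat and x :: "nat \<Rightarrow> nat \<Rightarrow> real" and \<phi> :: "nat \<Rightarrow> nat" and \<epsilon> :: real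
  assumes \<phi>_less: "q < N \<Longrightarrow> \<phi> q < k" and \<epsilon>: "0 < \<epsilon>" "\<epsilon> < 1"
begin

text \<open>What one draw guarantees relative to a uniform draw from the cluster: \<epsilon> / 48
  for a point that is far from the slots, times the share \<epsilon> / (48 k) of its cluster in the
  total, times 1/2 for rounding, times 1 / (k + 1) for the choice between slots and points.\<close>

definition rate :: real where "rate = \<epsilon>\<^sup>2 / (4608 * real k * real (k + 1))"

definition cls :: "nat \<Rightarrow> nat set" where "cls j = {q. q < N \<and> \<phi> q = j}"

definition cost :: "nat \<Rightarrow> (nat \<Rightarrow> real) \<Rightarrow> real" where
  "cost j c = (\<Sum>q\<in>cls j. sqdist d (x q) c)"

definition cst :: "nat \<Rightarrow> real" where "cst j = cost j (mean (cls j) x)"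

definition OPT :: real where "OPT = (\<Sum>j<k. cst j)"

text \<open>\<open>\<pi>\<close> records which cluster each center was chosen for; the program does
  not control this order. The error has a relative part and an absolute part, the latter for
  clusters that are wholly replaced by slots. Summed over \<open>k\<close> clusters the two amount
  to \<epsilon> times \<open>OPT\<close>.\<close>

definition covers :: "nat \<Rightarrow> (nat \<Rightarrow> nat \<Rightarrow> real) \<Rightarrow> bool" where
  "covers j c \<longleftrightarrow> (\<exists>\<pi>. inj_on \<pi> {..<j} \<and>
     (\<forall>i<j. \<pi> i < k \<and> cost (\<pi> i) (c i) \<le> (1 + \<epsilon> / 2) * cst (\<pi> i) + \<epsilon> / (2 * real k) * OPT))"

lemma cost_nonneg: "0 \<le> cost j c"
  by (simp add: cost_def sum_nonneg)

lemma cst_nonneg: "0 \<le> cst j"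
  by (simp add: cst_def cost_nonneg)

lemma OPT_nonneg: "0 \<le> OPT"
  by (simp add: OPT_def sum_nonneg cst_nonneg)

lemma finite_cls [simp]: "finite (cls j)"
  by (simp add: cls_def)

lemma card_cls_le: "card (cls j) \<le> N"
  using card_mono[of "{..<N}" "cls j"] by (auto simp: cls_def)

lemma cost_eq: "cls j \<noteq> {} \<Longrightarrow> cost j c = real (card (cls j)) * sqdist d (mean (cls j) x) c + cst j"
  by (simp add: cost_def cst_def sum_sqdist_mean[where v = c])

lemma sum_cls: "(\<Sum>j<k. \<Sum>q\<in>cls j. f q) = (\<Sum>q<N. f q :: real)"
  unfolding cls_def using sum.group[of "{..<N}" "{..<k}" \<phi> f] \<phi>_less by auto

lemma covers_Suc:
  assumes "inj_on \<pi> {..<j}" "\<And>i. i < j \<Longrightarrow> \<pi> i < k \<and>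
      cost (\<pi> i) (c i) \<le> (1 + \<epsilon> / 2) * cst (\<pi> i) + \<epsilon> / (2 * real k) * OPT"
    "y < k" "y \<notin> \<pi> ` {..<j}" "cost y S \<le> (1 + \<epsilon> / 2) * cst y + \<epsilon> / (2 * real k) * OPT"
  shows "covers (Suc j) (c(j := S))"
  unfolding covers_def
proof (intro exI[of _ "\<pi>(j := y)"] conjI)
  show "inj_on (\<pi>(j := y)) {..<Suc j}"
    using assms(1,4) by (auto simp: inj_on_def less_Suc_eq)
qed (use assms in \<open>auto simp: less_Suc_eq\<close>)

text \<open>Every point \<open>x q\<close> of the cluster is replaced by a vector \<open>pt (h q)\<close> that is likely to be drawn; a total
  squared displacement of \<open>E\<close> spoils the mean of \<open>m\<close> samples by \<open>O(E + cst / m)\<close> only.\<close>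

lemma hits_replaced:
  fixes p :: "nat \<Rightarrow> real"
  assumes y: "cls y \<noteq> {}" and m: "m > 0" and "\<gamma> \<ge> 0"
    and E: "(\<Sum>q\<in>cls y. sqdist d (pt (h q)) (x q)) \<le> E"
    and h: "\<And>i. i \<in> cls y \<Longrightarrow> h i < K"
    and p: "\<And>t. t < K \<Longrightarrow> \<gamma> * real (card {i\<in>cls y. h i = t}) \<le> real (card (cls y)) * p t"
  shows "hits m \<gamma> K p pt (\<lambda>S. cost y S \<le> cst y + 2 * E + (4 * E + 4 * cst y) / real m)"
proof -
  let ?Y = "cls y" and ?a = "\<lambda>i. pt (h i)" and ?\<mu> = "mean (cls y) x"
  let ?n = "real (card (cls y))"
  have n: "?n > 0" using y by (simp add: card_gt_0_iff)
  \<comment> \<open>The mean of the replaced vectors minimizes the sum of their squared distances,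
    so measuring from the mean of the original cluster can only increase it.\<close>
  have "(\<Sum>i\<in>?Y. sqdist d (?a i) (mean ?Y ?a)) \<le> (\<Sum>i\<in>?Y. sqdist d (?a i) ?\<mu>)"
    using y by (subst (2) sum_sqdist_mean) auto
  also have "\<dots> \<le> (\<Sum>i\<in>?Y. 2 * sqdist d (?a i) (x i) + 2 * sqdist d (x i) ?\<mu>)"
    by (intro sum_mono sqdist_triangle)
  also have "\<dots> \<le> 2 * E + 2 * cst y"
    using E by (simp add: sum.distrib sum_distrib_left[symmetric] cst_def cost_def)
  finally have V: "(\<Sum>i\<in>?Y. sqdist d (?a i) (mean ?Y ?a)) \<le> 2 * E + 2 * cst y" .
  have D: "sqdist d (mean ?Y ?a) ?\<mu> \<le> E / ?n"
    using sqdist_mean_le[of ?Y d ?a x] E y n by (simp add: field_simps)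
  let ?thr = "2 * (E / ?n + (2 * E + 2 * cst y) / ?n / real m)"
  have "2 * (sqdist d (mean ?Y ?a) ?\<mu> +
      (\<Sum>i\<in>?Y. sqdist d (?a i) (mean ?Y ?a)) / ?n / real m) \<le> ?thr"
    using D V n m by (intro mult_left_mono add_mono divide_right_mono) auto
  from hits_near_mean[OF _ y m this h p \<open>\<gamma> \<ge> 0\<close>]
  have hits: "hits m \<gamma> K p pt (\<lambda>S. sqdist d S ?\<mu> \<le> ?thr)" by simp
  have "cost y S \<le> cst y + 2 * E + (4 * E + 4 * cst y) / real m" if "sqdist d S ?\<mu> \<le> ?thr" for S
  proof -
    have "?n * sqdist d S ?\<mu> \<le> ?n * ?thr" using that n by (intro mult_left_mono) auto
    also have "\<dots> = 2 * E + (4 * E + 4 * cst y) / real m" using n m y by (simp add: field_simps)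
    finally show ?thesis using cost_eq[OF y, of S] by (simp add: sqdist_commute)
  qed
  with hits show ?thesis by (rule hits_mono)
qed

text \<open>Origin of the sample size 40 / \<epsilon>: it makes \<open>4 / m\<close> at most
  \<epsilon> / 10.\<close>

lemma mult_le_one_div_plus:
  "0 \<le> a \<Longrightarrow> 0 \<le> (b::real) \<Longrightarrow> 40 / \<epsilon> \<le> m \<Longrightarrow> (4 * a + 4 * b) / m \<le> \<epsilon> / 10 * (a + b)"
proof -
  assume *: "0 \<le> a" "0 \<le> b" "40 / \<epsilon> \<le> m"
  have "m > 0" using *(3) \<epsilon> by (meson divide_pos_pos less_le_trans zero_less_numeral)
  moreover have "40 * (a + b) \<le> (\<epsilon> * m) * (a + b)"
    using * \<epsilon> by (intro mult_right_mono) (auto simp: field_simps)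
  ultimately show ?thesis by (simp add: field_simps)
qed

lemma rate: "0 \<le> rate" "j < k \<Longrightarrow> rate \<le> 1 / real (j + 2)"
proof -
  show "0 \<le> rate" by (simp add: rate_def)
  assume "j < k"
  have "rate \<le> 1 / (4608 * real k * real (k + 1))"
    unfolding rate_def using \<epsilon> by (intro divide_right_mono) (auto simp: power_le_one)
  also have "\<dots> \<le> 1 / real (j + 2)"
    using \<open>j < k\<close> mult_mono[of 1 "4608 * real k" "real (j + 2)" "real (k + 1)"]
    by (intro divide_left_mono) auto
  finally show "rate \<le> 1 / real (j + 2)" .
qed

text \<open>Points whose squared distance is below \<open>\<epsilon> / 48\<close> times the average of the cluster are replaced by
  their nearest slot; the others are hit by squared distance sampling.\<close>

lemma round_far:
  fixes W :: "nat \<Rightarrow> real"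
  assumes "j < k" and m: "real m \<ge> 40 / \<epsilon>"
    and M: "M \<ge> 4608 * real k * real N / \<epsilon>\<^sup>2" "M > 0"
    and W: "\<And>q. q < N \<Longrightarrow> near q \<le> j \<and> W q = sqdist d (x q) (slot (near q))"
    and W_le: "\<And>q i. q < N \<Longrightarrow> i \<le> j \<Longrightarrow> W q \<le> sqdist d (x q) (slot i)"
    and T: "T = (\<Sum>q<N. W q)"
    and far: "(\<Sum>q\<in>cls y. W q) > \<epsilon> / (48 * real k) * T"
  shows "hits m rate (N + j + 1) (draw_prob N W T M j) (item N x slot)
    (\<lambda>S. cost y S \<le> (1 + \<epsilon> / 2) * cst y)"
proof -
  let ?Y = "cls y" and ?pt = "item N x slot"
  let ?n = "real (card ?Y)" and ?p = "draw_prob N W T M j"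
  define F where "F = (\<Sum>q\<in>?Y. W q)"
  define \<delta> where "\<delta> = \<epsilon> / 48"
  define h where "h q = (if W q < \<delta> * F / ?n then N + near q else q)" for q
  have W0: "0 \<le> W q" if "q < N" for q using W[OF that] by simp
  have T0: "0 \<le> T" unfolding T by (intro sum_nonneg) (auto simp: W0)
  have k: "0 < k" using \<open>j < k\<close> by simp
  then have F0: "0 < F" using far T0 \<epsilon> unfolding F_def by (meson divide_nonneg_nonneg le_less_trans mult_nonneg_nonneg of_nat_0_le_iff order_less_imp_le zero_le_numeral)
  then have Y: "?Y \<noteq> {}" by (auto simp: F_def)
  then have n: "?n > 0" by (simp add: card_gt_0_iff)
  have YN: "q < N" if "q \<in> ?Y" for q using that by (simp add: cls_def)
  have "F \<le> T" unfolding F_def T by (intro sum_mono2) (auto simp: W0 YN)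
  then have Tpos: "T > 0" using F0 by simp
  have "real m > 0" using m \<epsilon> by (meson divide_pos_pos less_le_trans zero_less_numeral)
  then have mpos: "m > 0" by simp
  let ?\<mu> = "mean ?Y x"
  \<comment> \<open>\<open>F\<close> is at most the cost of serving the whole cluster from the slot
    next to \<open>x q\<close>. This cost is controlled by \<open>cst y\<close>, the distance of
    \<open>x q\<close> from the cluster mean, and \<open>W q\<close> itself; after scaling by
    \<delta> the last term has a factor of at most 1/2 and is absorbed on the left.\<close>
  have near: "W q \<le> \<epsilon> / 24 * (cst y / ?n) + \<epsilon> / 12 * sqdist d (x q) ?\<mu>"
    if "q \<in> ?Y" "W q < \<delta> * F / ?n" for q
  proof -
    have q: "q < N" using YN that by blast
    define s where "s = slot (near q)"
    have "F \<le> cost y s"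
      unfolding F_def cost_def s_def using W[OF q] YN W_le by (intro sum_mono) auto
    also have "\<dots> = ?n * sqdist d ?\<mu> s + cst y" by (rule cost_eq[OF Y])
    also have "sqdist d ?\<mu> s \<le> 2 * sqdist d (x q) ?\<mu> + 2 * W q"
      using sqdist_triangle[of d ?\<mu> s "x q"] W[OF q] by (simp add: s_def sqdist_commute)
    finally have "F / ?n \<le> 2 * sqdist d (x q) ?\<mu> + 2 * W q + cst y / ?n"
      using n Y by (simp add: field_simps)
    then have "\<delta> * (F / ?n) \<le> \<delta> * (2 * sqdist d (x q) ?\<mu> + 2 * W q + cst y / ?n)"
      using \<epsilon> by (intro mult_left_mono) (auto simp: \<delta>_def)
    then have "W q \<le> \<delta> * (2 * sqdist d (x q) ?\<mu> + 2 * W q + cst y / ?n)" using that by simp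
    moreover have "2 * \<delta> * W q \<le> W q / 2"
      using W0[OF q] \<epsilon> mult_right_mono[of \<delta> "1 / 4" "W q"] by (simp add: \<delta>_def)
    ultimately show ?thesis by (simp add: \<delta>_def algebra_simps)
  qed
  have sq0: "sqdist d u u = 0" for u by (simp add: sqdist_def)
  have E: "(\<Sum>q\<in>?Y. sqdist d (?pt (h q)) (x q)) \<le> \<epsilon> / 8 * cst y"
  proof -
    have "(\<Sum>q\<in>?Y. sqdist d (?pt (h q)) (x q)) \<le>
        (\<Sum>q\<in>?Y. \<epsilon> / 24 * (cst y / ?n) + \<epsilon> / 12 * sqdist d (x q) ?\<mu>)"
    proof (rule sum_mono)
      fix q assume q: "q \<in> ?Y"
      show "sqdist d (?pt (h q)) (x q) \<le> \<epsilon> / 24 * (cst y / ?n) + \<epsilon> / 12 * sqdist d (x q) ?\<mu>"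
        using near[OF q] W[OF YN[OF q]] YN[OF q] \<epsilon> cst_nonneg[of y]
        by (auto simp: h_def sq0 sqdist_commute item_def)
    qed
    also have "\<dots> = ?n * (\<epsilon> / 24 * (cst y / ?n)) + \<epsilon> / 12 * cst y"
      unfolding sum.distrib cst_def cost_def by (simp add: sum_distrib_left)
    also have "\<dots> = \<epsilon> / 8 * cst y" using n Y by (simp add: field_simps)
    finally show ?thesis .
  qed
  have p: "rate * real (card {i\<in>?Y. h i = t}) \<le> ?n * ?p t" if "t < N + j + 1" for t
  proof (cases "t < N")
    case True
    show ?thesis
    proof (cases "t \<in> ?Y \<and> \<delta> * F / ?n \<le> W t")
      case False
      then have "{i\<in>?Y. h i = t} = {}" using True by (auto simp: h_def)
      then have c0: "card {i\<in>?Y. h i = t} = 0" by (metis card.empty)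
      show ?thesis unfolding c0 using n True by (simp add: draw_prob_def)
    next
      case far_t: True
      have "{i\<in>?Y. h i = t} \<subseteq> {t}" using True by (auto simp: h_def split: if_splits)
      then have "card {i\<in>?Y. h i = t} \<le> 1" using card_mono[of "{t}"] by fastforce
      then have "rate * real (card {i\<in>?Y. h i = t}) \<le> rate * 1"
        using rate(1) by (intro mult_left_mono) auto
      also have "\<dots> = \<delta> * (\<epsilon> / (48 * real k)) / 2 / real (k + 1)"
        by (simp add: rate_def \<delta>_def power2_eq_square)
      also have "\<dots> \<le> \<delta> * (\<epsilon> / (48 * real k)) / 2 / real (j + 2)"
        using \<epsilon> \<open>j < k\<close> by (intro divide_left_mono) (auto simp: \<delta>_def)
      also have "\<dots> \<le> (?n * (W t / T - 1 / M)) / real (j + 2)"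
      proof (rule divide_right_mono)
        have "\<delta> * (\<epsilon> / (48 * real k)) * T \<le> \<delta> * F"
          using far \<epsilon> unfolding F_def mult.assoc by (intro mult_left_mono) (auto simp: \<delta>_def)
        also have "\<dots> \<le> ?n * W t" using far_t n by (simp add: field_simps)
        finally have 1: "\<delta> * (\<epsilon> / (48 * real k)) \<le> ?n * (W t / T)"
          using Tpos by (simp add: field_simps)
        \<comment> \<open>This is what the resolution was chosen for: the rounding error
          \<open>?n / M\<close> is at most \<epsilon>^2 / (4608 k), half of the lower bound just
          found for \<open>?n * (W t / T)\<close>.\<close>
        have "2 * ?n * (2304 * real k / \<epsilon>\<^sup>2) \<le> 2 * real N * (2304 * real k / \<epsilon>\<^sup>2)"
          using card_cls_le[of y] by (intro mult_right_mono) auto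
        also have "\<dots> \<le> M" using M by (simp add: mult.commute mult.left_commute)
        finally have 2: "?n * (1 / M) \<le> \<delta> * (\<epsilon> / (48 * real k)) / 2"
          using M(2) \<epsilon> k by (simp add: field_simps \<delta>_def power2_eq_square)
        show "\<delta> * (\<epsilon> / (48 * real k)) / 2 \<le> ?n * (W t / T - 1 / M)"
          using 1 2 by (simp add: right_diff_distrib)
      qed simp
      also have "\<dots> \<le> ?n * ?p t"
        using True n by (simp add: draw_prob_def divide_right_mono)
      finally show ?thesis .
    qed
  next
    case False
    have "card {i\<in>?Y. h i = t} \<le> card ?Y" by (intro card_mono) auto
    then have "rate * real (card {i\<in>?Y. h i = t}) \<le> rate * ?n"
      using rate(1) by (intro mult_left_mono) auto
    also have "\<dots> \<le> (1 / real (j + 2)) * ?n"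
      using rate(2)[OF \<open>j < k\<close>] by (rule mult_right_mono) simp
    finally show ?thesis using False by (simp add: draw_prob_def)
  qed
  have h: "h q < N + j + 1" if "q \<in> ?Y" for q
    using W[OF YN[OF that]] YN[OF that] by (auto simp: h_def)
  have "hits m rate (N + j + 1) ?p ?pt (\<lambda>S. cost y S \<le> cst y + 2 * (\<epsilon> / 8 * cst y) +
      (4 * (\<epsilon> / 8 * cst y) + 4 * cst y) / real m)"
    by (rule hits_replaced[OF Y mpos rate(1) E h p])
  \<comment> \<open>The budget: displacement takes 1/4 and sampling variance 9/80 of
    \<open>\<epsilon> * cst y\<close>, together less than the permitted half.\<close>
  moreover have "cst y + 2 * (\<epsilon> / 8 * cst y) + (4 * (\<epsilon> / 8 * cst y) + 4 * cst y) / real m \<le> (1 + \<epsilon> / 2) * cst y"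
  proof -
    have "(4 * (\<epsilon> / 8 * cst y) + 4 * cst y) / real m \<le> \<epsilon> / 10 * (\<epsilon> / 8 * cst y + cst y)"
      using \<epsilon> cst_nonneg[of y] m by (intro mult_le_one_div_plus) auto
    also have "\<dots> \<le> \<epsilon> / 10 * (cst y / 8 + cst y)"
      using \<epsilon> cst_nonneg[of y] mult_right_mono[of \<epsilon> 1 "cst y"] by (intro mult_left_mono) auto
    also have "\<epsilon> / 10 * (cst y / 8 + cst y) = 9 / 80 * (\<epsilon> * cst y)" by simp
    finally have "(4 * (\<epsilon> / 8 * cst y) + 4 * cst y) / real m \<le> 9 / 80 * (\<epsilon> * cst y)" .
    moreover have "2 * (\<epsilon> / 8 * cst y) = \<epsilon> * cst y / 4" by simp
    moreover have "(1 + \<epsilon> / 2) * cst y = cst y + \<epsilon> * cst y / 2" by (simp add: algebra_simps)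
    moreover have "0 \<le> \<epsilon> * cst y" using \<epsilon> cst_nonneg[of y] by simp
    ultimately show ?thesis by linarith
  qed
  ultimately show ?thesis by (elim hits_mono) (rule order_trans)
qed

text \<open>Every point of the cluster is represented by its nearest slot. However the points are
  distributed over the slots, no slot represents more than all of them, so the fixed probability of
  each slot suffices. The displacement is one sixth of the absolute error that is allowed.\<close>

lemma round_near:
  fixes W :: "nat \<Rightarrow> real"
  assumes "j < k" and m: "real m \<ge> 40 / \<epsilon>"
    and W: "\<And>q. q < N \<Longrightarrow> near q \<le> j \<and> W q = sqdist d (x q) (slot (near q))"
    and p: "\<And>i. i \<le> j \<Longrightarrow> p (N + i) = 1 / real (j + 2)" "\<And>t. t < N \<Longrightarrow> p t \<ge> 0"
    and pt: "\<And>i. i \<le> j \<Longrightarrow> pt (N + i) = slot i"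
    and near: "(\<Sum>q\<in>cls y. W q) \<le> \<epsilon> / (12 * real k) * OPT"
  shows "hits m rate (N + j + 1) p pt (\<lambda>S. cost y S \<le> (1 + \<epsilon> / 2) * cst y + \<epsilon> / (2 * real k) * OPT)"
proof -
  have k: "0 < k" using \<open>j < k\<close> by simp
  have "real m > 0" using m \<epsilon> by (meson divide_pos_pos less_le_trans zero_less_numeral)
  then have mpos: "m > 0" by simp
  note \<gamma>_le = rate(2)[OF \<open>j < k\<close>]
  show ?thesis
  proof (cases "cls y = {}")
    case True
    have p0: "0 \<le> p t" if "t < N + j + 1" for t
      using p(1)[of "t - N"] p(2)[of t] that by (cases "t < N") auto
    have "rate \<le> (\<Sum>t<N + j + 1. p t)"
    proof -
      have "rate \<le> p (N + 0)" using \<gamma>_le by (simp add: p(1)[of 0, simplified])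
      also have "\<dots> \<le> (\<Sum>t<N + j + 1. p t)" using p0 by (intro member_le_sum) auto
      finally show ?thesis .
    qed
    \<comment> \<open>Any vector serves an empty cluster, so the constant potential 1 works once the
      items have total probability at least \<open>rate\<close>.\<close>
    then show ?thesis using True \<epsilon> OPT_nonneg unfolding hits_def
      by (intro exI[of _ "\<lambda>_ _. 1"]) (auto simp: cost_def cst_def)
  next
    case Y: False
    let ?Y = "cls y"
    let ?E = "\<epsilon> / (12 * real k) * OPT"
    have YN: "q < N" if "q \<in> ?Y" for q using that by (simp add: cls_def)
    have E: "(\<Sum>q\<in>?Y. sqdist d (pt (N + near q)) (x q)) \<le> ?E"
      using near W YN pt by (simp add: sqdist_commute)
    have p': "rate * real (card {i\<in>?Y. N + near i = t}) \<le> real (card ?Y) * p t" if t: "t < N + j + 1" for t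
    proof (cases "t < N")
      case True
      then have "{i\<in>?Y. N + near i = t} = {}" by auto
      then have c0: "card {i\<in>?Y. N + near i = t} = 0" by (metis card.empty)
      show ?thesis unfolding c0 using p(2)[OF True] by simp
    next
      case False
      have "card {i\<in>?Y. N + near i = t} \<le> card ?Y" by (intro card_mono) auto
      then have "rate * real (card {i\<in>?Y. N + near i = t}) \<le> rate * real (card ?Y)"
        using rate(1) by (intro mult_left_mono) auto
      also have "\<dots> \<le> 1 / real (j + 2) * real (card ?Y)" using \<gamma>_le by (intro mult_right_mono) auto
      finally show ?thesis using p(1)[of "t - N"] t False by simp
    qed
    have h: "N + near q < N + j + 1" if "q \<in> ?Y" for q
      using W[OF YN[OF that]] by auto
    have "hits m rate (N + j + 1) p pt (\<lambda>S. cost y S \<le> cst y + 2 * ?E + (4 * ?E + 4 * cst y) / real m)"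
      by (rule hits_replaced[OF Y mpos rate(1) E h p'])
    moreover have "cst y + 2 * ?E + (4 * ?E + 4 * cst y) / real m \<le> (1 + \<epsilon> / 2) * cst y + \<epsilon> / (2 * real k) * OPT"
    proof -
      have E0: "0 \<le> ?E" using \<epsilon> OPT_nonneg by simp
      have "(4 * ?E + 4 * cst y) / real m \<le> \<epsilon> / 10 * (?E + cst y)"
        using E0 cst_nonneg[of y] m by (intro mult_le_one_div_plus) auto
      moreover have "\<epsilon> / 10 * ?E \<le> ?E" using \<epsilon> E0 by (intro mult_left_le_one_le) auto
      moreover have "\<epsilon> / (2 * real k) * OPT = 6 * ?E" by simp
      moreover have "0 \<le> \<epsilon> * cst y" using \<epsilon> cst_nonneg[of y] by simp
      ultimately show ?thesis using E0 by (simp add: algebra_simps del: times_divide_eq_left)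
    qed
    ultimately show ?thesis by (elim hits_mono) (rule order_trans)
  qed
qed

text \<open>If all uncovered clusters are close to the current slots, then the total squared distance
  is \<open>O(OPT)\<close>, so that replacing all points of a cluster by slots costs little.\<close>

lemma round:
  fixes W :: "nat \<Rightarrow> real"
  assumes "j < k" and c: "covers j c" and m: "real m \<ge> 40 / \<epsilon>"
    and M: "M \<ge> 4608 * real k * real N / \<epsilon>\<^sup>2" "M > 0"
    and slot: "\<And>i. i < j \<Longrightarrow> slot (Suc i) = c i"
    and W: "\<And>q. q < N \<Longrightarrow> \<exists>i\<le>j. W q = sqdist d (x q) (slot i)"
    and W_le: "\<And>q i. q < N \<Longrightarrow> i \<le> j \<Longrightarrow> W q \<le> sqdist d (x q) (slot i)"
    and T: "T = (\<Sum>q<N. W q)"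
  shows "hits m rate (N + j + 1) (draw_prob N W T M j) (item N x slot) (\<lambda>S. covers (Suc j) (c(j := S)))"
proof -
  obtain \<pi> where \<pi>: "inj_on \<pi> {..<j}" "\<And>i. i < j \<Longrightarrow> \<pi> i < k \<and>
      cost (\<pi> i) (c i) \<le> (1 + \<epsilon> / 2) * cst (\<pi> i) + \<epsilon> / (2 * real k) * OPT"
    using c by (auto simp: covers_def)
  obtain near where near: "\<And>q. q < N \<Longrightarrow> near q \<le> j \<and> W q = sqdist d (x q) (slot (near q))"
    using W by metis
  have k: "0 < k" using \<open>j < k\<close> by simp
  let ?\<tau> = "\<epsilon> / (2 * real k) * OPT"
  have \<tau>: "0 \<le> ?\<tau>" using \<epsilon> OPT_nonneg by simp
  show ?thesis
  proof (cases "\<exists>y<k. y \<notin> \<pi> ` {..<j} \<and> (\<Sum>q\<in>cls y. W q) > \<epsilon> / (48 * real k) * T")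
    case True
    then obtain y where y: "y < k" "y \<notin> \<pi> ` {..<j}" "(\<Sum>q\<in>cls y. W q) > \<epsilon> / (48 * real k) * T"
      by blast
    have cov: "covers (Suc j) (c(j := S))" if "cost y S \<le> (1 + \<epsilon> / 2) * cst y" for S
      using that \<tau> \<pi> y by (intro covers_Suc[of \<pi>]) auto
    show ?thesis by (rule hits_mono[OF round_far[OF \<open>j < k\<close> m M near W_le T y(3)]]) (assumption | erule cov)+
  next
    case False
    define U where "U = {..<k} - \<pi> ` {..<j}"
    have T0: "0 \<le> T" unfolding T using near by (intro sum_nonneg) auto
    \<comment> \<open>Fewer than \<open>k\<close> clusters are covered, so at least one is left; in
      this case any of them can be taken.\<close>
    have "card (\<pi> ` {..<j}) < card {..<k}"
      using \<open>j < k\<close> card_image_le[of "{..<j}" \<pi>] by simp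
    then obtain y where y: "y < k" "y \<notin> \<pi> ` {..<j}"
      by (metis card_mono finite_imageI finite_lessThan leD lessThan_iff subsetI)
    have sub: "\<pi> ` {..<j} \<subseteq> {..<k}" using \<pi>(2) by auto
    have "T = (\<Sum>i<k. \<Sum>q\<in>cls i. W q)" by (simp add: T sum_cls)
    also have "\<dots> = (\<Sum>i\<in>U. \<Sum>q\<in>cls i. W q) + (\<Sum>i\<in>\<pi> ` {..<j}. \<Sum>q\<in>cls i. W q)"
      unfolding U_def using sub by (intro sum.subset_diff) auto
    also have "(\<Sum>i\<in>\<pi> ` {..<j}. \<Sum>q\<in>cls i. W q) = (\<Sum>i<j. \<Sum>q\<in>cls (\<pi> i). W q)"
      by (simp add: sum.reindex[OF \<pi>(1)])
    also have "(\<Sum>i<j. \<Sum>q\<in>cls (\<pi> i). W q) \<le> (\<Sum>i<j. (1 + \<epsilon> / 2) * cst (\<pi> i) + ?\<tau>)"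
    proof (rule sum_mono)
      fix i assume "i \<in> {..<j}"
      then have "(\<Sum>q\<in>cls (\<pi> i). W q) \<le> cost (\<pi> i) (c i)"
        unfolding cost_def using W_le[of _ "Suc i"] slot[of i] by (intro sum_mono) (auto simp: cls_def)
      then show "(\<Sum>q\<in>cls (\<pi> i). W q) \<le> (1 + \<epsilon> / 2) * cst (\<pi> i) + ?\<tau>"
        using \<pi>(2)[of i] \<open>i \<in> {..<j}\<close> by auto
    qed
    also have "(\<Sum>i<j. (1 + \<epsilon> / 2) * cst (\<pi> i) + ?\<tau>) = (1 + \<epsilon> / 2) * (\<Sum>i<j. cst (\<pi> i)) + real j * ?\<tau>"
      by (simp add: sum.distrib sum_distrib_left)
    also have "(\<Sum>i<j. cst (\<pi> i)) = (\<Sum>i\<in>\<pi> ` {..<j}. cst i)"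
      by (simp add: sum.reindex[OF \<pi>(1)])
    also have "(1 + \<epsilon> / 2) * (\<Sum>i\<in>\<pi> ` {..<j}. cst i) \<le> (1 + \<epsilon> / 2) * OPT"
      unfolding OPT_def using sub \<epsilon> by (intro mult_left_mono sum_mono2) (auto simp: cst_nonneg)
    also have "real j * ?\<tau> \<le> real k * ?\<tau>" using \<open>j < k\<close> \<tau> by (intro mult_right_mono) auto
    also have "real k * ?\<tau> = \<epsilon> / 2 * OPT" using k by simp
    also have "(\<Sum>i\<in>U. \<Sum>q\<in>cls i. W q) \<le> (\<Sum>i\<in>U. \<epsilon> / (48 * real k) * T)"
    proof (rule sum_mono)
      fix i assume "i \<in> U"
      then have "i < k" "i \<notin> \<pi> ` {..<j}" by (auto simp: U_def)
      then show "(\<Sum>q\<in>cls i. W q) \<le> \<epsilon> / (48 * real k) * T" using False not_less by blast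
    qed
    also have "\<dots> \<le> real k * (\<epsilon> / (48 * real k) * T)"
    proof -
      have "card U \<le> k" using card_mono[of "{..<k}" U] by (auto simp: U_def)
      then show ?thesis using T0 \<epsilon> unfolding sum_constant by (intro mult_right_mono) auto
    qed
    also have "\<dots> = \<epsilon> / 48 * T" using k by simp
    finally have "T \<le> \<epsilon> / 48 * T + ((1 + \<epsilon> / 2) * OPT + \<epsilon> / 2 * OPT)" by simp
    moreover have "\<epsilon> * T \<le> T" "\<epsilon> * OPT \<le> OPT"
      using \<epsilon> T0 OPT_nonneg by (auto intro: mult_left_le_one_le)
    \<comment> \<open>Since \<epsilon> < 1, the bound above implies
      \<open>T \<le> T / 48 + 2 * OPT\<close>. The constant 4 turns the share \<epsilon> / (48 k) of
      \<open>T\<close> into the \<epsilon> / (12 k) of \<open>OPT\<close> that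
      \<open>round_near\<close> asks for.\<close>
    ultimately have "T \<le> 4 * OPT" using OPT_nonneg by (simp add: algebra_simps)
    then have "\<epsilon> / (48 * real k) * T \<le> \<epsilon> / (48 * real k) * (4 * OPT)"
      using \<epsilon> by (intro mult_left_mono) auto
    moreover have "(\<Sum>q\<in>cls y. W q) \<le> \<epsilon> / (48 * real k) * T" using False y not_less by blast
    ultimately have small: "(\<Sum>q\<in>cls y. W q) \<le> \<epsilon> / (12 * real k) * OPT" by simp
    have cov: "covers (Suc j) (c(j := S))" if "cost y S \<le> (1 + \<epsilon> / 2) * cst y + ?\<tau>" for S
      using that \<pi> y by (intro covers_Suc[of \<pi>]) auto
    have "hits m rate (N + j + 1) (draw_prob N W T M j) (item N x slot)
        (\<lambda>S. cost y S \<le> (1 + \<epsilon> / 2) * cst y + ?\<tau>)"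
      by (rule round_near[OF \<open>j < k\<close> m near _ _ _ small]) (auto simp: draw_prob_def item_def)
    then show ?thesis by (rule hits_mono) (rule cov)
  qed
qed

text \<open>An injection of the \<open>k\<close> indices into themselves is a permutation.
  Relabelling the partition by its inverse gives each cluster its own center and never merges two
  classes, so injectivity within a point-set survives.\<close>

lemma covers_assignment:
  assumes "covers k c"
  shows "\<exists>\<psi>. (\<forall>q<N. \<psi> q < k) \<and> (\<forall>q<N. \<forall>q'<N. \<psi> q = \<psi> q' \<longrightarrow> \<phi> q = \<phi> q') \<and>
    (\<Sum>q<N. sqdist d (x q) (c (\<psi> q))) \<le> (1 + \<epsilon>) * OPT"
proof -
  obtain \<pi> where \<pi>: "inj_on \<pi> {..<k}" "\<And>i. i < k \<Longrightarrow> \<pi> i < k \<and>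
      cost (\<pi> i) (c i) \<le> (1 + \<epsilon> / 2) * cst (\<pi> i) + \<epsilon> / (2 * real k) * OPT"
    using assms by (auto simp: covers_def)
  have "\<pi> ` {..<k} \<subseteq> {..<k}" using \<pi>(2) by auto
  then have "\<pi> ` {..<k} = {..<k}" using \<pi>(1) by (simp add: endo_inj_surj)
  then have bij: "bij_betw \<pi> {..<k} {..<k}" using \<pi>(1) by (simp add: bij_betw_def)
  have "(\<Sum>i<k. cost (\<pi> i) (c i)) \<le> (\<Sum>i<k. (1 + \<epsilon> / 2) * cst (\<pi> i) + \<epsilon> / (2 * real k) * OPT)"
    using \<pi>(2) by (intro sum_mono) auto
  also have "\<dots> = (1 + \<epsilon> / 2) * (\<Sum>i<k. cst (\<pi> i)) + real k * (\<epsilon> / (2 * real k) * OPT)"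
    by (simp add: sum.distrib sum_distrib_left)
  also have "(\<Sum>i<k. cst (\<pi> i)) = OPT"
    unfolding OPT_def by (rule sum.reindex_bij_betw[OF bij])
  also have "real k * (\<epsilon> / (2 * real k) * OPT) \<le> \<epsilon> / 2 * OPT"
    using \<epsilon> OPT_nonneg by (cases "k = 0") auto
  finally have le: "(\<Sum>i<k. cost (\<pi> i) (c i)) \<le> (1 + \<epsilon>) * OPT" by (simp add: algebra_simps)
  define \<psi> where "\<psi> q = the_inv_into {..<k} \<pi> (\<phi> q)" for q
  have inj: "inj_on \<pi> {..<k}" and im: "\<pi> ` {..<k} = {..<k}" using bij by (auto simp: bij_betw_def)
  have \<pi>\<psi>: "\<pi> (\<psi> q) = \<phi> q" if "q < N" for q
    unfolding \<psi>_def using f_the_inv_into_f[OF inj] \<phi>_less[OF that] im by simp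
  have \<psi>k: "\<psi> q < k" if "q < N" for q
    unfolding \<psi>_def using the_inv_into_into[OF inj, of "\<phi> q" "{..<k}"] \<phi>_less[OF that] im by simp
  have "(\<Sum>q<N. sqdist d (x q) (c (\<psi> q))) = (\<Sum>i<k. \<Sum>q\<in>{q\<in>{..<N}. \<psi> q = i}. sqdist d (x q) (c (\<psi> q)))"
    using \<psi>k by (intro sum.group[symmetric]) auto
  also have "\<dots> = (\<Sum>i<k. cost (\<pi> i) (c i))"
  proof (rule sum.cong)
    fix i assume i: "i \<in> {..<k}"
    have "\<psi> q = i \<longleftrightarrow> \<phi> q = \<pi> i" if "q < N" for q
    proof
      show "\<psi> q = i" if "\<phi> q = \<pi> i" unfolding \<psi>_def that using the_inv_into_f_f[OF inj i] .
    qed (use \<pi>\<psi>[OF that] in simp)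
    then have eq: "{q\<in>{..<N}. \<psi> q = i} = cls (\<pi> i)" unfolding cls_def by blast
    show "(\<Sum>q\<in>{q\<in>{..<N}. \<psi> q = i}. sqdist d (x q) (c (\<psi> q))) = cost (\<pi> i) (c i)"
      unfolding cost_def eq[symmetric] by (intro sum.cong refl) simp
  qed simp
  finally show ?thesis using le \<psi>k \<pi>\<psi> by (intro exI[of _ \<psi>]) metis
qed

end

section \<open>Squared distance sampling\<close>

text \<open>Arrays of naturals and of reals; a scalar is kept in cell 0 of an array of its own.\<close>

abbreviation (input) "n_N \<equiv> 3 :: nat"
abbreviation (input) "n_m \<equiv> 4 :: nat"
abbreviation (input) "n_M \<equiv> 5 :: nat"
abbreviation (input) "n_R \<equiv> 6 :: nat"
abbreviation (input) "n_K \<equiv> 7 :: nat"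
abbreviation (input) "n_pos \<equiv> 8 :: nat"
abbreviation (input) "n_off \<equiv> 9 :: nat"
abbreviation (input) "n_cnt \<equiv> 10 :: nat"
abbreviation (input) "n_j \<equiv> 11 :: nat"
abbreviation (input) "n_r \<equiv> 12 :: nat"
abbreviation (input) "n_q \<equiv> 13 :: nat"
abbreviation (input) "n_l \<equiv> 14 :: nat"
abbreviation (input) "n_i \<equiv> 15 :: nat"
abbreviation (input) "n_e \<equiv> 16 :: nat"
abbreviation (input) "n_t \<equiv> 17 :: nat"
abbreviation (input) "n_t' \<equiv> 18 :: nat"
abbreviation (input) "n_v \<equiv> 19 :: nat"
abbreviation (input) "n_u \<equiv> 20 :: nat"
abbreviation (input) "n_sel \<equiv> 21 :: nat"
abbreviation (input) "n_dig \<equiv> 22 :: nat"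
abbreviation (input) "n_asg \<equiv> 23 :: nat"
abbreviation (input) "n_inj \<equiv> 24 :: nat"
abbreviation (input) "n_base \<equiv> 25 :: nat"
abbreviation (input) "n_carry \<equiv> 26 :: nat"
abbreviation (input) "n_tmp \<equiv> 27 :: nat"

abbreviation (input) "r_w \<equiv> 3 :: nat"
abbreviation (input) "r_dist \<equiv> 4 :: nat"
abbreviation (input) "r_acc \<equiv> 5 :: nat"
abbreviation (input) "r_tot \<equiv> 6 :: nat"
abbreviation (input) "r_cum \<equiv> 7 :: nat"
abbreviation (input) "r_cost \<equiv> 8 :: nat"
abbreviation (input) "r_grp \<equiv> 9 :: nat"
abbreviation (input) "r_best \<equiv> 10 :: nat"
abbreviation (input) "r_cur \<equiv> 11 :: nat"
abbreviation (input) "r_prod \<equiv> 12 :: nat"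

abbreviation "e_n \<equiv> V 0"
abbreviation "e_d \<equiv> NGet 0 (NConst 1)"
abbreviation "e_k \<equiv> NGet 0 (NConst 2)"
abbreviation "e_eps \<equiv> RV 0"
abbreviation rnum :: "nat \<Rightarrow> rexp" where "rnum c \<equiv> OfNat (NConst c)"

text \<open>All vectors live in array 1 of the reals: vector \<open>q\<close> starts at cell \<open>q * d\<close>. The input points
  come first; they are followed by the slots \<open>N, \<dots>, N + k\<close>, where slot \<open>N\<close> is the origin and
  slot \<open>N + 1 + j\<close> the center of class \<open>j\<close>.\<close>

abbreviation "e_pos_q \<equiv> NGet n_pos (V n_q)"
abbreviation "e_slot \<equiv> NGet n_pos (NAdd (V n_N) (V n_j))"
abbreviation "e_new \<equiv> NGet n_pos (NAdd (V n_N) (NAdd (V n_j) (NConst 1)))"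
abbreviation "e_diff \<equiv> RSub (RGet 1 (NAdd e_pos_q (V n_l))) (RGet 1 (NAdd e_slot (V n_l)))"

definition c_dist :: com where
  "c_dist = rset r_acc (rnum 0) ;;
     For n_l e_d (rset r_acc (RAdd (RV r_acc) (RMul e_diff e_diff)))"

text \<open>Tests have no disjunction; by De Morgan the condition reads: \<open>j = 0\<close>, or
  the new distance is smaller. Round 0 thus overwrites the weights left by the previous trial. The
  table \<open>r_dist\<close> filled on the way is read by the assignment later.\<close>

definition c_refresh :: com where
  "c_refresh = rset r_tot (rnum 0) ;;
     For n_q (V n_N) (c_dist ;;
       RSet r_dist (NAdd (NGet n_off (V n_j)) (V n_q)) (RV r_acc) ;;
       If (Neg (Conj (Neg (NLess (V n_j) (NConst 1))) (Neg (RLess (RV r_acc) (RGet r_w (V n_q))))))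
         (RSet r_w (V n_q) (RV r_acc)) Skip ;;
       rset r_tot (RAdd (RV r_tot) (RGet r_w (V n_q))))"

definition c_zero :: com where
  "c_zero = For n_l e_d (RSet 1 (NAdd e_new (V n_l)) (rnum 0))"

definition c_add :: com where
  "c_add = For n_l e_d (RSet 1 (NAdd e_new (V n_l))
     (RAdd (RGet 1 (NAdd e_new (V n_l)))
       (RDiv (RGet 1 (NAdd (NGet n_pos (V n_sel)) (V n_l))) (OfNat (V n_m)))))"

text \<open>The segment test is cleared of denominators, so a vanishing total weight does no harm:
  no point is hit then, and the origin stays selected by default.\<close>

definition c_select :: com where
  "c_select = nset n_sel (V n_N) ;; rset r_cum (rnum 0) ;;
     For n_q (V n_N)
       (If (Conj (Neg (RLess (RMul (OfNat (V n_u)) (RV r_tot)) (RMul (RV r_cum) (OfNat (V n_M)))))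
             (RLess (RMul (OfNat (V n_u)) (RV r_tot))
               (RMul (RAdd (RV r_cum) (RGet r_w (V n_q))) (OfNat (V n_M)))))
         (nset n_sel (V n_q)) Skip ;;
       rset r_cum (RAdd (RV r_cum) (RGet r_w (V n_q))))"

definition c_draw :: com where
  "c_draw = Sample n_v (NConst 0) (NAdd (V n_j) (NConst 2)) ;;
     If (NLess (V n_v) (NAdd (V n_j) (NConst 1)))
       (nset n_sel (NAdd (V n_N) (V n_v)))
       (Sample n_u (NConst 0) (V n_M) ;; c_select)"

text \<open>The last refresh runs with the counter at \<open>k\<close>. It serves the assignment,
  not the sampling: it enters the distances to the last center into the table.\<close>

definition c_sampling :: com where
  "c_sampling = For n_j e_k (c_refresh ;; c_zero ;; For n_r (V n_m) (c_draw ;; c_add)) ;; c_refresh"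

lemma writes_c_dist [simp]: "nwrites c_dist = {n_l}" "rwrites c_dist = {r_acc}"
  by (simp_all add: c_dist_def)

lemma writes_c_refresh [simp]:
  "nwrites c_refresh = {n_q, n_l}" "rwrites c_refresh = {r_tot, r_acc, r_dist, r_w}"
  by (auto simp: c_refresh_def)

lemma writes_c_zero [simp]: "nwrites c_zero = {n_l}" "rwrites c_zero = {1}"
  by (simp_all add: c_zero_def)

lemma writes_c_add [simp]: "nwrites c_add = {n_l}" "rwrites c_add = {1}"
  by (simp_all add: c_add_def)

lemma writes_c_select [simp]: "nwrites c_select = {n_sel, n_q}" "rwrites c_select = {r_cum}"
  by (auto simp: c_select_def)

lemma writes_c_draw [simp]: "nwrites c_draw = {n_v, n_sel, n_u, n_q}" "rwrites c_draw = {r_cum}"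
  by (auto simp: c_draw_def)

lemma writes_c_sampling [simp]:
  "nwrites c_sampling = {n_j, n_r, n_v, n_sel, n_u, n_q, n_l}"
  "rwrites c_sampling = {1, r_tot, r_acc, r_dist, r_w, r_cum}"
  by (auto simp: c_sampling_def)

lemma run_Seq_If_RSet:
  assumes "run c (if bval b s then rput a (nval i s) (rval e s) s else s) T Q f v"
  shows "run (If b (RSet a i e) Skip ;; c) s (3 + bcost b + ncost i + rcost e + T) Q f v"
proof -
  have "ok (If b (RSet a i e) Skip) s (1 + bcost b + (1 + ncost i + rcost e + 1))
      (\<lambda>s'. s' = (if bval b s then rput a (nval i s) (rval e s) s else s))"
    by (intro ok_If ok_RSet ok_Skip) auto
  then have "run (If b (RSet a i e) Skip ;; c) s (1 + bcost b + (1 + ncost i + rcost e + 1) + T) Q f v"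
    by (rule run_Seq_ok) (use assms in simp)
  then show ?thesis by (rule run_time) simp
qed

lemma run_Seq_If_NSet:
  assumes "run c (if bval b s then nput a (nval i s) (nval e s) s else s) T Q f v"
  shows "run (If b (NSet a i e) Skip ;; c) s (3 + bcost b + ncost i + ncost e + T) Q f v"
proof -
  have "ok (If b (NSet a i e) Skip) s (1 + bcost b + (1 + ncost i + ncost e + 1))
      (\<lambda>s'. s' = (if bval b s then nput a (nval i s) (nval e s) s else s))"
    by (intro ok_If ok_NSet ok_Skip) auto
  then have "run (If b (NSet a i e) Skip ;; c) s (1 + bcost b + (1 + ncost i + ncost e + 1) + T) Q f v"
    by (rule run_Seq_ok) (use assms in simp)
  then show ?thesis by (rule run_time) simp
qed

text \<open>Lets averages be estimated in the reals; the nonnegative \<open>h\<close> mediates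
  between them and the \<open>ennreal\<close>-valued \<open>f\<close>.\<close>

lemma run_Sample_real:
  assumes B: "nval e s = B" "B > 0" and T: "1 + ncost i + ncost e \<le> T"
    and "\<And>u. u < B \<Longrightarrow> Q (nput a (nval i s) u s)"
    and h: "\<And>u. u < B \<Longrightarrow> 0 \<le> h u \<and> ennreal (h u) \<le> f (nput a (nval i s) u s)"
    and r: "r \<le> (\<Sum>u<B. h u) / real B"
  shows "run (Sample a i e) s T Q f (ennreal r)"
proof (rule run_Sample)
  have "ennreal r \<le> ennreal ((\<Sum>u<B. h u) / real B)" using r by (rule ennreal_leI)
  also have "\<dots> = ennreal (\<Sum>u<B. h u) / ennreal (real B)"
    using h B by (subst divide_ennreal) (auto intro: sum_nonneg)
  also have "\<dots> = (\<Sum>u<B. ennreal (h u)) / of_nat B"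
    using h sum_ennreal[of "{..<B}" h] by (simp add: ennreal_of_nat_eq_real_of_nat)
  also have "\<dots> \<le> (\<Sum>u<B. f (nput a (nval i s) u s)) / of_nat B"
    using h by (intro divide_right_mono_ennreal sum_mono) auto
  finally show "ennreal r \<le> (\<Sum>u<nval e s. f (nput a (nval i s) u s)) / of_nat (nval e s)"
    using B by simp
qed (use assms in auto)

text \<open>The interval contains \<open>\<lceil>b\<rceil> - \<lceil>a\<rceil>\<close> integers; the
  1 is the rounding loss.\<close>

lemma card_nat_interval_ge:
  assumes "0 \<le> a" "b \<le> real M"
  shows "b - a - 1 \<le> real (card {u. u < M \<and> a \<le> real u \<and> real u < b})"
proof (cases "a \<le> b")
  case True
  have "{nat \<lceil>a\<rceil>..<nat \<lceil>b\<rceil>} \<subseteq> {u. u < M \<and> a \<le> real u \<and> real u < b}"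
  proof safe
    fix u assume u: "u \<in> {nat \<lceil>a\<rceil>..<nat \<lceil>b\<rceil>}"
    then show "a \<le> real u" by (auto simp: nat_le_iff ceiling_le_iff)
    from u show "real u < b" by (simp add: less_ceiling_iff zless_nat_eq_int_zless)
    then show "u < M" using assms by linarith
  qed
  then have "card {nat \<lceil>a\<rceil>..<nat \<lceil>b\<rceil>} \<le> card {u. u < M \<and> a \<le> real u \<and> real u < b}"
    by (intro card_mono) auto
  moreover have "real (nat \<lceil>b\<rceil> - nat \<lceil>a\<rceil>) \<ge> b - a - 1" using assms True by linarith
  ultimately show ?thesis by simp
qed auto

text \<open>Division by \<open>T\<close> turns the segment of \<open>q\<close> into an interval of
  length \<open>M * W q / T\<close>; the one integer lost to rounding is the \<open>1 / M\<close> of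
  \<open>draw_prob\<close>. For \<open>T = 0\<close> the left side is 0, because division by zero
  gives zero.\<close>

lemma card_cumulative_ge:
  fixes W :: "nat \<Rightarrow> real"
  assumes W: "\<And>i. i < N \<Longrightarrow> 0 \<le> W i" and "q < N" "M > 0" and T: "T = (\<Sum>i<N. W i)"
  shows "max 0 (W q / T - 1 / real M) \<le>
    real (card {u. u < M \<and> (\<Sum>i<q. W i) * real M \<le> real u * T \<and> real u * T < ((\<Sum>i<q. W i) + W q) * real M}) / real M"
proof (cases "T = 0")
  case False
  then have T0: "T > 0" using T W by (metis lessThan_iff order_le_less sum_nonneg)
  define a where "a = (\<Sum>i<q. W i) * real M / T"
  define b where "b = ((\<Sum>i<q. W i) + W q) * real M / T"
  have "(\<Sum>i<q. W i) + W q = (\<Sum>i<Suc q. W i)" by simp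
  also have "\<dots> \<le> T" unfolding T using \<open>q < N\<close> W by (intro sum_mono2) auto
  finally have "b \<le> T * real M / T" unfolding b_def using T0 by (intro divide_right_mono mult_right_mono) auto
  then have b: "b \<le> real M" using T0 by simp
  have a: "0 \<le> a" unfolding a_def using W T0 \<open>q < N\<close> by (intro divide_nonneg_nonneg mult_nonneg_nonneg sum_nonneg) auto
  have "{u. u < M \<and> (\<Sum>i<q. W i) * real M \<le> real u * T \<and> real u * T < ((\<Sum>i<q. W i) + W q) * real M} =
     {u. u < M \<and> a \<le> real u \<and> real u < b}"
    unfolding a_def b_def using T0 by (auto simp: field_simps)
  moreover have "b - a - 1 = (W q / T - 1 / real M) * real M"
    using T0 \<open>M > 0\<close> by (simp add: a_def b_def field_simps)
  ultimately have "W q / T - 1 / real M \<le> real (card {u. u < M \<and> (\<Sum>i<q. W i) * real M \<le> real u * T \<and>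
      real u * T < ((\<Sum>i<q. W i) + W q) * real M}) / real M"
    using card_nat_interval_ge[OF a b] \<open>M > 0\<close> by (simp only: pos_le_divide_eq of_nat_0_less_iff)
  then show ?thesis by simp
qed simp

locale machine =
  fixes n d k m M R :: nat and sz :: "nat \<Rightarrow> nat" and x :: "nat \<Rightarrow> nat \<Rightarrow> real"
  assumes m_pos: "m > 0" and M_pos: "M > 0" and k2: "2 \<le> k"
    and sz_le: "i < n \<Longrightarrow> sz i \<le> k"
begin

definition bs :: "nat \<Rightarrow> nat" where "bs i = sum sz {..<i}"

abbreviation N :: nat where "N \<equiv> bs n"

text \<open>The machine cannot multiply natural numbers, so the products \<open>q * d\<close> and
  \<open>j * N\<close> needed for addressing, and the number \<open>k ^ k\<close>, are prepared
  once.\<close>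

definition ready :: "state \<Rightarrow> bool" where
  "ready s \<longleftrightarrow> nmem s 0 0 = n \<and> nmem s 0 1 = d \<and> nmem s 0 2 = k \<and> (\<forall>i<n. nmem s 1 i = sz i) \<and>
     nmem s n_N 0 = N \<and> nmem s n_m 0 = m \<and> nmem s n_M 0 = M \<and> nmem s n_R 0 = R \<and>
     nmem s n_K 0 = k ^ k \<and> (\<forall>q\<le>N + k. nmem s n_pos q = q * d) \<and> (\<forall>j\<le>k. nmem s n_off j = j * N)"

text \<open>Cut off at \<open>d\<close>, so that equal vectors are equal functions and neighbouring
  cells do not matter.\<close>

definition pt :: "state \<Rightarrow> nat \<Rightarrow> nat \<Rightarrow> real" where
  "pt s q = (\<lambda>l. if l < d then rmem s 1 (q * d + l) else 0)"

definition loaded :: "state \<Rightarrow> bool" where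
  "loaded s \<longleftrightarrow> (\<forall>q<N. pt s q = x q) \<and> pt s N = (\<lambda>_. 0)"

lemma readyD:
  assumes "ready s"
  shows "nmem s 0 0 = n" "nmem s 0 (Suc 0) = d" "nmem s 0 2 = k" "i < n \<Longrightarrow> nmem s (Suc 0) i = sz i"
    "nmem s n_N 0 = N" "nmem s n_m 0 = m" "nmem s n_M 0 = M" "nmem s n_R 0 = R"
    "nmem s n_K 0 = k ^ k" "q \<le> N + k \<Longrightarrow> nmem s n_pos q = q * d" "j \<le> k \<Longrightarrow> nmem s n_off j = j * N"
  using assms by (auto simp: ready_def)

lemma ready_cong:
  assumes "ready s" "\<And>a. a \<in> {0, 1, 3, 4, 5, 6, 7, 8, 9} \<Longrightarrow> nmem s' a = nmem s a"
  shows "ready s'"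
  using assms by (simp add: ready_def)

lemma ready_frame:
  "ready s \<Longrightarrow> frame c s s' \<Longrightarrow> nwrites c \<inter> {0, 1, 3, 4, 5, 6, 7, 8, 9} = {} \<Longrightarrow> ready s'"
  by (erule ready_cong) (auto simp: frame_def)

lemma ready_nput [simp]: "a \<ge> 10 \<Longrightarrow> ready (nput a i v s) = ready s"
  by (auto simp: ready_def)

lemma ready_rput [simp]: "ready (rput a i v s) = ready s"
  by (auto simp: ready_def)

lemma pt_cong: "rmem s 1 = rmem s' 1 \<Longrightarrow> pt s = pt s'"
  by (simp add: pt_def fun_eq_iff)

lemma pt_nput [simp]: "pt (nput a i v s) = pt s"
  by (rule pt_cong) simp

lemma pt_rput [simp]: "a \<noteq> 1 \<Longrightarrow> pt (rput a i v s) = pt s"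
  by (rule pt_cong) simp

lemma pt_frame: "frame c s s' \<Longrightarrow> 1 \<notin> rwrites c \<Longrightarrow> pt s' = pt s"
  by (rule pt_cong) (simp add: frame_def)

lemma ok_c_dist:
  assumes "ready s" "nmem s n_q 0 = q" "q \<le> N + k" "nmem s n_j 0 = j" "j \<le> k"
  shows "ok c_dist s (150 * (d + 1)) (\<lambda>s'. rmem s' r_acc 0 = sqdist d (pt s q) (pt s (N + j)))"
  unfolding c_dist_def
proof (rule run_time, rule run_Seq_RSet, rule ok_For[where B = d and T = 60 and
      J = "\<lambda>i s'. rmem s' r_acc 0 = (\<Sum>l<i. (pt s q l - pt s (N + j) l)\<^sup>2)"], goal_cases)
  case (3 i s')
  then show ?case
    using assms readyD[OF assms(1)] by (intro run_RSet) (auto simp: frame_def pt_def power2_eq_square)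
qed (use assms readyD[OF assms(1)] in \<open>auto simp: frame_def sqdist_def\<close>)

definition dist_ok :: "nat \<Rightarrow> state \<Rightarrow> bool" where
  "dist_ok j s \<longleftrightarrow> (\<forall>i<j. \<forall>q<N. rmem s r_dist (i * N + q) = sqdist d (pt s q) (pt s (N + i)))"

definition near_ok :: "nat \<Rightarrow> state \<Rightarrow> bool" where
  "near_ok j s \<longleftrightarrow> (\<forall>q<N. (\<exists>i<j. rmem s r_w q = sqdist d (pt s q) (pt s (N + i))) \<and>
     (\<forall>i<j. rmem s r_w q \<le> sqdist d (pt s q) (pt s (N + i))))"

lemma ok_c_refresh:
  assumes "ready s" "nmem s n_j 0 = j" "j \<le> k" "dist_ok j s" "j = 0 \<or> near_ok j s"
  shows "ok c_refresh s (300 * ((N + 1) * (d + 1)))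
    (\<lambda>s'. dist_ok (Suc j) s' \<and> near_ok (Suc j) s' \<and> rmem s' r_tot 0 = (\<Sum>q<N. rmem s' r_w q))"
proof -
  define D where "D q = sqdist d (pt s q) (pt s (N + j))" for q
  define W where "W = rmem s r_w"
  define W' where "W' q = (if j = 0 \<or> D q < W q then D q else W q)" for q
  define J where "J i s' \<longleftrightarrow>
     rmem s' r_dist = (\<lambda>a. if j * N \<le> a \<and> a < j * N + i then D (a - j * N) else rmem s r_dist a) \<and>
     rmem s' r_w = (\<lambda>q. if q < i then W' q else W q) \<and> rmem s' r_tot 0 = (\<Sum>q<i. W' q)" for i and s' :: state
  show ?thesis
    unfolding c_refresh_def
  proof (rule run_time, rule run_Seq_RSet, rule ok_For[where B = N and T = "150 * (d + 1) + 100" and J = J], goal_cases)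
    case (3 i s')
    note i = 3(1,3) and fr = 3(2) and J = 3(4)
    have r': "ready s'" by (rule ready_frame[OF _ fr]) (use assms in auto)
    have p': "pt s' = pt s" using pt_frame[OF fr] by simp
    have j': "nmem s' n_j 0 = j" using fr assms by (simp add: frame_def)
    show ?case
    proof (rule run_time, rule run_Seq_ok[where ?T2.0 = 100], rule ok_c_dist[OF r' i(2) _ j' \<open>j \<le> k\<close>], goal_cases)
      case (2 s2)
      then have acc: "rmem s2 r_acc 0 = D i" and fr2: "frame c_dist s' s2" using p' by (simp_all add: D_def)
      have r2: "ready s2" by (rule ready_frame[OF r' fr2]) auto
      have s2: "nmem s2 n_j 0 = j" "nmem s2 n_q 0 = i" "rmem s2 r_w = rmem s' r_w"
        "rmem s2 r_dist = rmem s' r_dist" "rmem s2 r_tot = rmem s' r_tot" "nmem s2 n_off j = j * N"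
        using fr2 j' i readyD[OF r2] \<open>j \<le> k\<close> by (simp_all add: frame_def)
      show ?case
        by (rule run_time, rule run_Seq_RSet, rule run_Seq_If_RSet, rule ok_RSet)
          (use J in \<open>auto simp: J_def W'_def s2 acc fun_eq_iff less_Suc_eq\<close>)
    qed (use i in auto)
  next
    case (5 s')
    note J = 5(1)
    have p': "pt s' = pt s" using pt_frame[OF 5(3)] by simp
    have "dist_ok (Suc j) s'"
      unfolding dist_ok_def
    proof (intro allI impI)
      fix i q assume "i < Suc j" "q < N"
      show "rmem s' r_dist (i * N + q) = sqdist d (pt s' q) (pt s' (N + i))"
      proof (cases "i = j")
        case True then show ?thesis using J \<open>q < N\<close> by (simp add: J_def D_def p')
      next
        case False
        then have "i < j" using \<open>i < Suc j\<close> by simp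
        \<comment> \<open>Row \<open>i\<close> of the distance table ends before row
          \<open>j\<close> begins, so earlier rows are untouched.\<close>
        then have "Suc i * N \<le> j * N" by (intro mult_right_mono) auto
        then have "i * N + q < j * N" using \<open>q < N\<close> by simp
        then show ?thesis using J assms(4) \<open>i < j\<close> \<open>q < N\<close> by (simp add: J_def dist_ok_def p')
      qed
    qed
    moreover have "near_ok (Suc j) s'"
    proof (cases "j = 0")
      case True
      then show ?thesis using J by (simp add: near_ok_def J_def W'_def D_def p')
    next
      case False
      then have near: "near_ok j s" using assms by simp
      show ?thesis
        unfolding near_ok_def
      proof (intro allI impI conjI)
        fix q assume q: "q < N"
        have w: "rmem s' r_w q = (if D q < W q then D q else W q)"
          using J q False by (simp add: J_def W'_def)
        show "\<exists>i<Suc j. rmem s' r_w q = sqdist d (pt s' q) (pt s' (N + i))"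
          using near q unfolding w p' near_ok_def W_def[symmetric] by (metis D_def less_SucI lessI)
        fix i assume "i < Suc j"
        then show "rmem s' r_w q \<le> sqdist d (pt s' q) (pt s' (N + i))"
          using near q unfolding w p' near_ok_def W_def[symmetric] less_Suc_eq
          by (fastforce simp: D_def)
      qed
    qed
    moreover have "rmem s' r_tot 0 = (\<Sum>q<N. rmem s' r_w q)" using J by (simp add: J_def)
    ultimately show ?case by blast
  qed (use assms readyD[OF assms(1)] in \<open>auto simp: frame_def J_def W_def fun_eq_iff algebra_simps\<close>)
qed

lemma cell_neq: "l < d \<Longrightarrow> l' < d \<Longrightarrow> q \<noteq> q' \<Longrightarrow> q * d + l \<noteq> q' * d + (l' :: nat)"
  by (metis div_mult_self3 add.commute div_less add_cancel_right_left less_nat_zero_code)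

lemma pt_put: "i < d \<Longrightarrow> pt (rput 1 (q * d + i) y s) = (pt s)(q := (pt s q)(i := y))"
  using cell_neq[of _ i _ q] by (auto simp: pt_def fun_eq_iff)

lemma ok_c_zero:
  assumes "ready s" "nmem s n_j 0 = j" "j < k"
  shows "ok c_zero s (50 * (d + 1)) (\<lambda>s'. pt s' = (pt s)(N + Suc j := (\<lambda>_. 0)))"
  unfolding c_zero_def
proof (rule run_time, rule ok_For[where B = d and T = 25 and
    J = "\<lambda>i s'. pt s' = (\<lambda>q l. if q = N + Suc j \<and> l < i then 0 else pt s q l)"], goal_cases)
  case (3 i s')
  have "pt (nput n_l 0 (Suc i) (rput 1 ((N + Suc j) * d + i) 0 s')) q l =
     (if q = N + Suc j \<and> l < Suc i then 0 else pt s q l)" for q l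
    unfolding pt_nput pt_put[OF 3(1)] 3(4) by (auto simp: less_Suc_eq)
  then show ?case
    using 3 assms readyD[OF assms(1)] by (intro run_RSet) (auto simp: frame_def fun_eq_iff)
qed (use assms readyD[OF assms(1)] in \<open>auto simp: frame_def fun_eq_iff pt_def\<close>)

text \<open>The bound on \<open>t\<close> keeps the added vector apart from the slot being written,
  so that it does not change during the loop.\<close>

lemma ok_c_add:
  assumes "ready s" "nmem s n_j 0 = j" "j < k" "nmem s n_sel 0 = t" "t \<le> N + j"
  shows "ok c_add s (70 * (d + 1))
    (\<lambda>s'. pt s' = (pt s)(N + Suc j := (\<lambda>l. pt s (N + Suc j) l + pt s t l / real m)))"
  unfolding c_add_def
proof (rule run_time, rule ok_For[where B = d and T = 45 and
    J = "\<lambda>i s'. pt s' = (\<lambda>q l. if q = N + Suc j \<and> l < i then pt s (N + Suc j) l + pt s t l / real m else pt s q l)"], goal_cases)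
  case (3 i s')
  note pt = 3(4)
  have r': "ready s'" by (rule ready_frame[OF assms(1) 3(2)]) auto
  have s': "nmem s' n_j 0 = j" "nmem s' n_sel 0 = t" using 3(2) assms by (simp_all add: frame_def)
  have cell: "rmem s' 1 (q * d + i) = pt s q i" if "q \<le> N + Suc j" for q
    using fun_cong[OF fun_cong[OF pt, of q], of i] 3(1) by (simp add: pt_def)
  let ?y = "pt s (N + Suc j) i + pt s t i / real m"
  have "pt (nput n_l 0 (Suc i) (rput 1 ((N + Suc j) * d + i) ?y s')) q l =
     (if q = N + Suc j \<and> l < Suc i then pt s (N + Suc j) l + pt s t l / real m else pt s q l)" for q l
    unfolding pt_nput pt_put[OF 3(1)] pt by (auto simp: less_Suc_eq)
  moreover have "nval (NAdd e_new (V n_l)) s' = (N + Suc j) * d + i"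
    "rval (RAdd (RGet 1 (NAdd e_new (V n_l)))
       (RDiv (RGet 1 (NAdd (NGet n_pos (V n_sel)) (V n_l))) (OfNat (V n_m)))) s' = ?y"
    using 3(3) s' readyD[OF r'] assms cell[of "N + Suc j"] cell[of t] by simp_all
  ultimately show ?case by (intro run_RSet) (simp_all add: fun_eq_iff)
qed (use assms readyD[OF assms(1)] in \<open>auto simp: frame_def fun_eq_iff pt_def\<close>)

text \<open>The random number \<open>u\<close> selects the point in whose segment of the cumulated weights \<open>u * T / M\<close> lies.\<close>

definition hit :: "(nat \<Rightarrow> real) \<Rightarrow> real \<Rightarrow> nat \<Rightarrow> nat \<Rightarrow> bool" where
  "hit W T u q \<longleftrightarrow> (\<Sum>i<q. W i) * real M \<le> real u * T \<and> real u * T < ((\<Sum>i<q. W i) + W q) * real M"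

lemma hit_unique:
  assumes W: "\<And>i. i < N \<Longrightarrow> 0 \<le> W i" and "q' < N" "hit W T u q" "hit W T u q'" "q < q'"
  shows False
proof -
  have "(\<Sum>i<q. W i) + W q = (\<Sum>i<Suc q. W i)" by simp
  also have "\<dots> \<le> (\<Sum>i<q'. W i)" using assms by (intro sum_mono2) auto
  finally have "((\<Sum>i<q. W i) + W q) * real M \<le> (\<Sum>i<q'. W i) * real M" by (intro mult_right_mono) auto
  then show False using assms by (auto simp: hit_def)
qed

lemma ok_c_select:
  assumes "ready s" "\<And>q. q < N \<Longrightarrow> 0 \<le> rmem s r_w q"
  shows "ok c_select s (100 * (N + 1))
    (\<lambda>s'. nmem s' n_sel 0 \<le> N \<and>
       (\<forall>q<N. hit (rmem s r_w) (rmem s r_tot 0) (nmem s n_u 0) q \<longrightarrow> nmem s' n_sel 0 = q))"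
proof -
  define W where "W = rmem s r_w"
  define H where "H = hit W (rmem s r_tot 0) (nmem s n_u 0)"
  let ?b = "Conj (Neg (RLess (RMul (OfNat (V n_u)) (RV r_tot)) (RMul (RV r_cum) (OfNat (V n_M)))))
             (RLess (RMul (OfNat (V n_u)) (RV r_tot))
               (RMul (RAdd (RV r_cum) (RGet r_w (V n_q))) (OfNat (V n_M))))"
  define J where "J i s' \<longleftrightarrow> rmem s' r_cum 0 = (\<Sum>q<i. W q) \<and> nmem s' n_sel 0 \<le> N \<and>
     (\<forall>q<i. H q \<longrightarrow> nmem s' n_sel 0 = q)" for i and s' :: state
  show ?thesis
    unfolding c_select_def
  proof (rule run_time, rule run_Seq_NSet, rule run_Seq_RSet, rule ok_For[where B = N and T = 60 and J = J], goal_cases)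
    case (3 i s')
    note i = 3(1,3) and fr = 3(2) and J = 3(4)
    have r': "ready s'" by (rule ready_frame[OF _ fr]) (use assms in auto)
    have s': "nmem s' n_u 0 = nmem s n_u 0" "rmem s' r_w = W" "rmem s' r_tot 0 = rmem s r_tot 0"
      using fr by (simp_all add: frame_def W_def)
    have b: "bval ?b s' \<longleftrightarrow> H i"
      using J i s' readyD[OF r'] by (simp add: J_def H_def hit_def not_less)
    \<comment> \<open>Segments of nonnegative weights are disjoint, so a selection made by a hit is
      never replaced by a later hit.\<close>
    have *: "\<not> H q" if "H i" "q < i" for q
      using that hit_unique[of W i _ _ q] assms(2) \<open>i < N\<close> by (auto simp: H_def W_def)
    show ?case
    proof (rule run_time, rule run_Seq_If_NSet, rule ok_RSet, goal_cases)
      case 1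
      show ?case unfolding b using J i s' * by (auto simp: J_def less_Suc_eq)
    qed simp
  qed (use assms readyD[OF assms(1)] in \<open>auto simp: frame_def J_def H_def W_def\<close>)
qed

text \<open>Stated for every nonnegative \<open>g\<close>, because the potential of the extended
  partial mean will be substituted for it.\<close>

lemma run_c_draw:
  assumes "ready s" "nmem s n_j 0 = j" "j < k" and W: "\<And>q. q < N \<Longrightarrow> 0 \<le> rmem s r_w q"
    and T: "rmem s r_tot 0 = (\<Sum>q<N. rmem s r_w q)" and g: "\<And>t. 0 \<le> g t"
  shows "run c_draw s (150 * (N + 1)) (\<lambda>s'. nmem s' n_sel 0 \<le> N + j)
    (\<lambda>s'. ennreal (g (nmem s' n_sel 0)))
    (ennreal (\<Sum>t<N + j + 1. draw_prob N (rmem s r_w) (rmem s r_tot 0) (real M) j t * g t))"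
proof -
  define w where "w t = max 0 (rmem s r_w t / rmem s r_tot 0 - 1 / real M)" for t
  define G where "G = (\<Sum>t<N. w t * g t)"
  have G0: "0 \<le> G" unfolding G_def w_def using g by (intro sum_nonneg mult_nonneg_nonneg) auto
  let ?hit = "hit (rmem s r_w) (rmem s r_tot 0)"
  let ?h = "\<lambda>u. \<Sum>q<N. if ?hit u q then g q else 0"
  \<comment> \<open>The items are regrouped by the outcome of the first random number: each slot has
    a value of its own, and all points share the value \<open>j + 1\<close>, which contributes
    \<open>G\<close>.\<close>
  have "(\<Sum>t<N + j + 1. (if t < N then w t else 1) / real (j + 2) * g t) =
      (\<Sum>t<N. w t / real (j + 2) * g t) + (\<Sum>v<j + 1. 1 / real (j + 2) * g (N + v))"
    using sum.atLeastLessThan_concat[of 0 N "N + j + 1" "\<lambda>t. (if t < N then w t else 1) / real (j + 2) * g t"]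
      sum.shift_bounds_nat_ivl[of "\<lambda>t. (if t < N then w t else 1) / real (j + 2) * g t" 0 N "j + 1"]
    by (simp add: atLeast0LessThan add.commute add.left_commute)
  also have "\<dots> = (\<Sum>v<j + 2. if v \<le> j then g (N + v) else G) / real (j + 2)"
    by (simp add: G_def sum_divide_distrib add_divide_distrib lessThan_Suc)
  finally have sum_eq: "(\<Sum>t<N + j + 1. (if t < N then w t else 1) / real (j + 2) * g t) =
    (\<Sum>v<j + 2. if v \<le> j then g (N + v) else G) / real (j + 2)" .
  have G_le: "G \<le> (\<Sum>u<M. ?h u) / real M"
  proof -
    have "G \<le> (\<Sum>q<N. real (card {u. u < M \<and> ?hit u q}) / real M * g q)"
      unfolding G_def w_def hit_def using card_cumulative_ge[OF W _ M_pos T] g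
      by (intro sum_mono mult_right_mono) auto
    also have "\<dots> = (\<Sum>q<N. \<Sum>u<M. if ?hit u q then g q else 0) / real M"
      by (simp add: sum.If_cases sum_divide_distrib Int_def lessThan_def)
    also have "(\<Sum>q<N. \<Sum>u<M. if ?hit u q then g q else 0) = (\<Sum>u<M. ?h u)" by (rule sum.swap)
    finally show ?thesis .
  qed
  \<comment> \<open>At most one point is hit by \<open>u\<close>; if there is none, the sum is 0 and
    nonnegativity of \<open>g\<close> suffices.\<close>
  have h_le: "?h u \<le> g t" if "\<And>q. q < N \<Longrightarrow> ?hit u q \<Longrightarrow> t = q" for u t
  proof (cases "\<exists>q<N. ?hit u q")
    case True
    then have t: "t < N" "?hit u t" using that by metis+
    have "?h u = (\<Sum>q<N. if q = t then g q else 0)" 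
    proof (rule sum.cong)
      fix q assume "q \<in> {..<N}"
      then have "?hit u q \<longleftrightarrow> q = t" using that t(2) by blast
      then show "(if ?hit u q then g q else 0) = (if q = t then g q else 0)" by (rule arg_cong)
    qed simp
    then show ?thesis using t by simp
  next
    case False
    then have "?h u = 0" by (intro sum.neutral) auto
    then show ?thesis using g by simp
  qed
  let ?P = "\<lambda>s'. \<exists>v<j + 2. s' = nput n_v 0 v s"
  let ?f = "\<lambda>s'. ennreal (if nmem s' n_v 0 \<le> j then g (N + nmem s' n_v 0) else G)"
  show ?thesis
    unfolding c_draw_def draw_prob_def w_def[symmetric]
  proof (rule run_time, rule run_Seq[where P = ?P and g = ?f])
    show "run (Sample n_v (NConst 0) (NAdd (V n_j) (NConst 2))) s 10 ?P ?f
       (ennreal (\<Sum>t<N + j + 1. (if t < N then w t else 1) / real (j + 2) * g t))"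
      by (rule run_Sample_real[where B = "j + 2" and h = "\<lambda>v. if v \<le> j then g (N + v) else G"])
        (use assms G0 sum_eq in auto)
  next
    fix s' assume "?P s'"
    then obtain v where v: "v < j + 2" and s': "s' = nput n_v 0 v s" by blast
    let ?Q = "\<lambda>s'. nmem s' n_sel 0 \<le> N + j" and ?g = "\<lambda>s'. ennreal (g (nmem s' n_sel 0))"
    show "run (If (NLess (V n_v) (NAdd (V n_j) (NConst 1))) (nset n_sel (NAdd (V n_N) (V n_v)))
       (Sample n_u (NConst 0) (V n_M) ;; c_select)) s' (1 + bcost (NLess (V n_v) (NAdd (V n_j) (NConst 1))) + (100 * (N + 1) + 20)) ?Q ?g (?f s')"
    proof (rule run_If)
      assume "bval (NLess (V n_v) (NAdd (V n_j) (NConst 1))) s'"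
      then show "run (nset n_sel (NAdd (V n_N) (V n_v))) s' (100 * (N + 1) + 20) ?Q ?g (?f s')"
        using s' assms readyD[OF assms(1)] by (intro run_NSet) auto
    next
      assume "\<not> bval (NLess (V n_v) (NAdd (V n_j) (NConst 1))) s'"
      then have "\<not> v \<le> j" using s' assms by auto
      then have f: "?f s' = ennreal G" using s' by simp
      have "run (Sample n_u (NConst 0) (V n_M) ;; c_select) s' (20 + 100 * (N + 1)) ?Q ?g (ennreal G)"
      proof (rule run_Seq[where P = "\<lambda>s2. \<exists>u<M. s2 = nput n_u 0 u s'" and g = "\<lambda>s2. ennreal (?h (nmem s2 n_u 0))"])
        show "run (Sample n_u (NConst 0) (V n_M)) s' 20 (\<lambda>s2. \<exists>u<M. s2 = nput n_u 0 u s')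
           (\<lambda>s2. ennreal (?h (nmem s2 n_u 0))) (ennreal G)"
          by (rule run_Sample_real[where B = M and h = ?h])
            (use s' readyD[OF assms(1)] M_pos G_le g in \<open>auto intro!: sum_nonneg\<close>)
      next
        fix s2 assume "\<exists>u<M. s2 = nput n_u 0 u s'"
        then obtain u where u: "s2 = nput n_u 0 u (nput n_v 0 v s)" using s' by blast
        have rs: "rmem s2 = rmem s" "ready s2" using u assms(1) by simp_all
        have "ok c_select s2 (100 * (N + 1)) (\<lambda>s3. nmem s3 n_sel 0 \<le> N \<and>
            (\<forall>q<N. ?hit (nmem s2 n_u 0) q \<longrightarrow> nmem s3 n_sel 0 = q))"
          using ok_c_select[OF rs(2)] W unfolding rs(1) by blast
        then have "run c_select s2 (100 * (N + 1)) (\<lambda>s3. nmem s3 n_sel 0 \<le> N \<and>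
            (\<forall>q<N. ?hit (nmem s2 n_u 0) q \<longrightarrow> nmem s3 n_sel 0 = q)) ?g (ennreal (?h (nmem s2 n_u 0)))"
          by (rule ok_run) (intro ennreal_leI h_le, blast)
        then show "run c_select s2 (100 * (N + 1)) ?Q ?g (ennreal (?h (nmem s2 n_u 0)))"
          by (rule run_weaken) auto
      qed
      then show "run (Sample n_u (NConst 0) (V n_M) ;; c_select) s' (100 * (N + 1) + 20) ?Q ?g (?f s')"
        unfolding f by (rule run_time) simp
    qed
  qed simp
qed

end

context machine begin

abbreviation slot_prob :: "state \<Rightarrow> nat \<Rightarrow> nat \<Rightarrow> real" where
  "slot_prob s \<equiv> draw_prob N (rmem s r_w) (rmem s r_tot 0) (real M)"

text \<open>\<open>\<gamma> ^ (m - i) * \<Psi> (m - i)\<close>, taken at the partial mean, is a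
  submartingale of the loop: each draw uses up one factor \<gamma>. The weights are not refreshed
  while the slot is built, so all draws have the same distribution.\<close>

lemma run_slot:
  assumes "ready s" "nmem s n_j 0 = j" "j < k" and W: "\<And>q. q < N \<Longrightarrow> 0 \<le> rmem s r_w q"
    and T: "rmem s r_tot 0 = (\<Sum>q<N. rmem s r_w q)"
    and \<Psi>: "\<And>r S. 0 \<le> \<Psi> r S" and \<gamma>: "0 \<le> \<gamma>"
    and step: "\<And>r S. \<gamma> * \<Psi> (Suc r) S \<le>
      (\<Sum>t<N + j + 1. slot_prob s j t * \<Psi> r (\<lambda>l. S l + pt s t l / real m))"
  shows "run (c_zero ;; For n_r (V n_m) (c_draw ;; c_add)) s (300 * ((m + 1) * (N + 1) * (d + 1)))
    (\<lambda>s'. \<exists>S. pt s' = (pt s)(N + Suc j := S)) (\<lambda>s'. ennreal (\<Psi> 0 (pt s' (N + Suc j))))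
    (ennreal (\<gamma> ^ m * \<Psi> m (\<lambda>_. 0)))"
proof (rule run_time, rule run_Seq_ok, rule ok_c_zero[OF assms(1-3)])
  fix s1 assume pt1: "pt s1 = (pt s)(N + Suc j := \<lambda>_. 0)" and fr1: "frame c_zero s s1"
  define J where "J (i::nat) s' \<longleftrightarrow> (\<exists>S. pt s' = (pt s)(N + Suc j := S))" for i s'
  define f where "f i s' = ennreal (\<gamma> ^ (m - i) * \<Psi> (m - i) (pt s' (N + Suc j)))" for i s'
  have r1: "ready s1" by (rule ready_frame[OF assms(1) fr1]) auto
  have s1: "nmem s1 n_j 0 = j" "rmem s1 r_w = rmem s r_w" "rmem s1 r_tot = rmem s r_tot"
    using fr1 assms by (simp_all add: frame_def)
  let ?loop = "For n_r (V n_m) (c_draw ;; c_add)"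
  let ?T = "(m + 1) * (150 * (N + 1) + 70 * (d + 1) + 14 + ncost (V n_m))"
  have "run ?loop s1 ?T
     (\<lambda>s'. J m s' \<and> nmem s' n_r 0 = m) (f m) (ennreal (\<gamma> ^ m * \<Psi> m (\<lambda>_. 0)))"
  proof (rule run_For[where J = J], goal_cases)
    case (3 i s')
    note i = 3(1,3) and fr = 3(2) and J = 3(4)
    obtain S where pt': "pt s' = (pt s)(N + Suc j := S)" using J by (auto simp: J_def)
    have r': "ready s'" by (rule ready_frame[OF r1 fr]) auto
    have s': "nmem s' n_j 0 = j" "rmem s' r_w = rmem s r_w" "rmem s' r_tot = rmem s r_tot"
      using fr s1 by (simp_all add: frame_def)
    have mi: "m - i = Suc (m - Suc i)" using i by simp
    define g where "g t = \<gamma> ^ (m - Suc i) * \<Psi> (m - Suc i) (\<lambda>l. S l + pt s' t l / real m)" for t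
    have draw: "run c_draw s' (150 * (N + 1)) (\<lambda>s''. nmem s'' n_sel 0 \<le> N + j) (\<lambda>s''. ennreal (g (nmem s'' n_sel 0)))
       (ennreal (\<Sum>t<N + j + 1. slot_prob s' j t * g t))"
      by (rule run_c_draw[OF r' s'(1) \<open>j < k\<close>]) (use W T \<Psi> \<gamma> s' in \<open>auto simp: g_def\<close>)
    have "\<gamma> ^ (m - i) * \<Psi> (m - i) S = \<gamma> ^ (m - Suc i) * (\<gamma> * \<Psi> (Suc (m - Suc i)) S)"
      unfolding mi by simp
    also have "\<dots> \<le> \<gamma> ^ (m - Suc i) * (\<Sum>t<N + j + 1. slot_prob s j t * \<Psi> (m - Suc i) (\<lambda>l. S l + pt s t l / real m))"
      using step \<gamma> by (intro mult_left_mono) auto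
    also have "\<dots> = (\<Sum>t<N + j + 1. slot_prob s' j t * g t)"
      unfolding sum_distrib_left
      by (intro sum.cong) (auto simp: g_def pt' s' mult_ac)
    finally have f_le: "f i s' \<le> ennreal (\<Sum>t<N + j + 1. slot_prob s' j t * g t)"
      unfolding f_def pt' by (simp add: ennreal_leI)
    show ?case
    proof (rule run_Seq[where P = "\<lambda>s''. nmem s'' n_sel 0 \<le> N + j" and g = "\<lambda>s''. ennreal (g (nmem s'' n_sel 0))"], goal_cases)
      case 1
      show ?case by (rule run_weaken[OF draw]) (use f_le in auto)
    next
      case (2 s2)
      note sel = 2(1) and fr2 = 2(2)
      have r2: "ready s2" by (rule ready_frame[OF r' fr2]) auto
      have j2: "nmem s2 n_j 0 = j" using fr2 s' by (simp add: frame_def)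
      have p2: "pt s2 = pt s'" using pt_frame[OF fr2] by simp
      have add: "ok c_add s2 (70 * (d + 1)) (\<lambda>s''. pt s'' = (pt s2)(N + Suc j :=
          (\<lambda>l. pt s2 (N + Suc j) l + pt s2 (nmem s2 n_sel 0) l / real m)))"
        by (rule ok_c_add[OF r2 j2 \<open>j < k\<close> refl sel])
      show ?case
        by (rule run_weaken[OF ok_run[OF add, where f = "\<lambda>s''. f (Suc i) (nput n_r 0 (Suc i) s'')" and
              v = "ennreal (g (nmem s2 n_sel 0))"]])
          (auto simp: f_def J_def g_def p2 pt')
    qed
  qed (use r1 pt1 in \<open>auto simp: frame_def J_def f_def readyD\<close>)
  then show "run ?loop s1 ?T
     (\<lambda>s'. \<exists>S. pt s' = (pt s)(N + Suc j := S)) (\<lambda>s'. ennreal (\<Psi> 0 (pt s' (N + Suc j))))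
    (ennreal (\<gamma> ^ m * \<Psi> m (\<lambda>_. 0)))"
    by (rule run_weaken) (auto simp: J_def f_def)
qed (simp add: algebra_simps)

text \<open>\<open>\<Psi> 0\<close> is at most the indicator of \<open>A\<close>, so its expectation
  is a lower bound for the probability of \<open>A\<close>.\<close>

lemma run_slot_hits:
  assumes "ready s" "nmem s n_j 0 = j" "j < k" "\<And>q. q < N \<Longrightarrow> 0 \<le> rmem s r_w q"
    "rmem s r_tot 0 = (\<Sum>q<N. rmem s r_w q)" and \<gamma>: "0 \<le> \<gamma>"
    and hits: "hits m \<gamma> (N + j + 1) (slot_prob s j) (pt s) A"
  shows "run (c_zero ;; For n_r (V n_m) (c_draw ;; c_add)) s (300 * ((m + 1) * (N + 1) * (d + 1)))
    (\<lambda>s'. \<exists>S. pt s' = (pt s)(N + Suc j := S)) (\<lambda>s'. if A (pt s' (N + Suc j)) then 1 else 0)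
    (ennreal (\<gamma> ^ m / 2))"
proof -
  obtain \<Psi> where \<Psi>: "\<And>r S. 0 \<le> \<Psi> r S" "1 / 2 \<le> \<Psi> m (\<lambda>_. 0)"
    "\<And>S. \<Psi> 0 S \<le> (1::real)" "\<And>S. \<Psi> 0 S > 0 \<Longrightarrow> A S"
    "\<And>r S. \<gamma> * \<Psi> (Suc r) S \<le> (\<Sum>t<N + j + 1. slot_prob s j t * \<Psi> r (\<lambda>l. S l + pt s t l / real m))"
    using hits unfolding hits_def by blast
  have "\<Psi> 0 S = 0" if "\<not> A S" for S using \<Psi>(1)[of 0 S] \<Psi>(4)[of S] that by fastforce
  moreover have "\<gamma> ^ m / 2 \<le> \<gamma> ^ m * \<Psi> m (\<lambda>_. 0)"
    using mult_left_mono[OF \<Psi>(2), of "\<gamma> ^ m"] \<gamma> by simp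
  ultimately show ?thesis
    by (intro run_weaken[OF run_slot[where \<Psi> = \<Psi>, OF assms(1-5) \<Psi>(1) \<gamma> \<Psi>(5)]]) (auto simp: \<Psi>(3) ennreal_leI)
qed

definition centers :: "state \<Rightarrow> nat \<Rightarrow> nat \<Rightarrow> real" where
  "centers s i = pt s (N + Suc i)"

lemma centers_cong: "pt s' = pt s \<Longrightarrow> centers s' = centers s"
  by (simp add: centers_def fun_eq_iff)

text \<open>The submartingale over the centers is \<open>a ^ (k - j)\<close> while the first
  \<open>j\<close> centers cover distinct clusters, and 0 otherwise; each round pays one factor
  \<open>a\<close>.\<close>

lemma run_c_sampling:
  assumes cp: "clustered_points N k \<phi> \<epsilon>" and "ready s" "loaded s"
    and m: "real m \<ge> 40 / \<epsilon>" and M: "real M \<ge> 4608 * real k * real N / \<epsilon>\<^sup>2"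
    and a: "a = clustered_points.rate k \<epsilon> ^ m / 2"
  shows "run c_sampling s (1000 * ((k + 1) * (m + 1) * (N + 1) * (d + 1)))
    (\<lambda>s'. loaded s' \<and> dist_ok (Suc k) s')
    (\<lambda>s'. if clustered_points.covers N d k x \<phi> \<epsilon> k (centers s') then 1 else 0) (ennreal (a ^ k))"
proof -
  interpret clustered_points N d k x \<phi> \<epsilon> by (rule cp)
  have a0: "0 \<le> a" unfolding a using rate(1) by simp
  define J where "J j s' \<longleftrightarrow> loaded s' \<and> dist_ok j s' \<and> (j = 0 \<or> near_ok j s')" for j s'
  define f where "f j s' = (if covers j (centers s') then ennreal (a ^ (k - j)) else 0)" for j s'
  let ?body = "c_refresh ;; c_zero ;; For n_r (V n_m) (c_draw ;; c_add)"
  let ?T = "300 * ((N + 1) * (d + 1)) + 300 * ((m + 1) * (N + 1) * (d + 1))"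
  have loop: "run (For n_j e_k ?body) s ((k + 1) * (?T + 14 + ncost e_k)) (\<lambda>s'. J k s' \<and> nmem s' n_j 0 = k) (f k) (ennreal (a ^ k))"
  proof (rule run_For[where J = J], goal_cases)
    case (3 j s')
    note j = 3(1,3) and fr = 3(2) and J = 3(4)
    have r': "ready s'" by (rule ready_frame[OF \<open>ready s\<close> fr]) auto
    show ?case
    proof (rule run_Seq_ok, rule ok_c_refresh[OF r' j(2)], goal_cases)
      case (4 s2)
      then have d2: "dist_ok (Suc j) s2" and n2: "near_ok (Suc j) s2"
        and T2: "rmem s2 r_tot 0 = (\<Sum>q<N. rmem s2 r_w q)" and fr2: "frame c_refresh s' s2" by auto
      have r2: "ready s2" by (rule ready_frame[OF r' fr2]) auto
      have j2: "nmem s2 n_j 0 = j" using fr2 j by (simp add: frame_def)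
      have p2: "pt s2 = pt s'" using pt_frame[OF fr2] by simp
      then have c2: "centers s2 = centers s'" by (simp add: centers_def fun_eq_iff)
      have l2: "loaded s2" using J p2 by (simp add: J_def loaded_def)
      have W0: "0 \<le> rmem s2 r_w q" if "q < N" for q
        using n2 that unfolding near_ok_def by (metis sqdist_nonneg)
      let ?slot = "c_zero ;; For n_r (V n_m) (c_draw ;; c_add)"
      let ?T' = "300 * ((m + 1) * (N + 1) * (d + 1))"
      \<comment> \<open>The new vector is slot \<open>j + 1\<close>, to which weights and table do
        not refer yet.\<close>
      have post: "J (Suc j) (nput n_j 0 (Suc j) s3)" if "\<exists>S. pt s3 = (pt s2)(N + Suc j := S)" "frame ?slot s2 s3" for s3
      proof -
        have 1: "pt s3 q = pt s2 q" if "q < N + Suc j" for q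
          using \<open>\<exists>S. pt s3 = (pt s2)(N + Suc j := S)\<close> that by auto
        have 2: "rmem s3 r_w = rmem s2 r_w" "rmem s3 r_dist = rmem s2 r_dist"
          using that(2) by (simp_all add: frame_def)
        have 3: "pt s3 (N + i) = pt s2 (N + i)" if "i < Suc j" for i using 1[of "N + i"] that by simp
        have "near_ok (Suc j) s3"
          unfolding near_ok_def 2
        proof (intro allI impI conjI)
          fix q assume q: "q < N"
          show "\<exists>i<Suc j. rmem s2 r_w q = sqdist d (pt s3 q) (pt s3 (N + i))"
            using n2 q 1[of q] unfolding near_ok_def by (metis 3 trans_less_add1)
          show "rmem s2 r_w q \<le> sqdist d (pt s3 q) (pt s3 (N + i))" if "i < Suc j" for i
            using n2 q 1[of q] that unfolding near_ok_def by (metis 3 trans_less_add1)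
        qed
        moreover have "dist_ok (Suc j) s3" "loaded s3"
          using l2 d2 by (simp_all add: loaded_def dist_ok_def 1 2)
        ultimately show ?thesis
          by (simp add: J_def loaded_def dist_ok_def near_ok_def)
      qed
      show ?case
      proof (cases "covers j (centers s')")
        case False
        \<comment> \<open>Once covering has failed the required expectation is 0; the zero potential
          still yields time bound and postcondition.\<close>
        have "run ?slot s2 ?T' (\<lambda>s'. \<exists>S. pt s' = (pt s2)(N + Suc j := S)) (\<lambda>s'. 0) 0"
          using run_slot[OF r2 j2 j(1) W0 T2, of "\<lambda>_ _. 0" rate] rate(1) by simp
        then show ?thesis by (rule run_weaken) (use post False in \<open>auto simp: f_def\<close>)
      next
        case True
        \<comment> \<open>Points and slots lie consecutively in memory, so an item is simply the
          number of a vector.\<close>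
        have item: "item N x (\<lambda>i. pt s2 (N + i)) = pt s2"
          using l2 by (auto simp: item_def loaded_def)
        have hits: "hits m rate (N + j + 1) (slot_prob s2 j) (item N x (\<lambda>i. pt s2 (N + i)))
            (\<lambda>S. covers (Suc j) ((centers s2)(j := S)))"
        proof (rule round)
          show "covers j (centers s2)" using True c2 by simp
          show "\<exists>i\<le>j. rmem s2 r_w q = sqdist d (x q) (pt s2 (N + i))" if "q < N" for q
            using n2 l2 that unfolding near_ok_def loaded_def by (metis less_Suc_eq_le)
          show "rmem s2 r_w q \<le> sqdist d (x q) (pt s2 (N + i))" if "q < N" "i \<le> j" for q i
            using n2 l2 that unfolding near_ok_def loaded_def by (metis less_Suc_eq_le)
        qed (use j m M M_pos T2 in \<open>auto simp: centers_def\<close>)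
        define b where "b = a ^ (k - Suc j)"
        have "k - j = Suc (k - Suc j)" using j by simp
        then have fj: "f j s' = ennreal b * ennreal (rate ^ m / 2)"
          using True a0 by (simp add: f_def b_def a[symmetric] ennreal_mult[symmetric] mult.commute)
        have f_Suc: "f (Suc j) (nput n_j 0 (Suc j) s3) =
            ennreal b * (if covers (Suc j) ((centers s2)(j := pt s3 (N + Suc j))) then 1 else 0)"
          if "\<exists>S. pt s3 = (pt s2)(N + Suc j := S)" for s3
        proof -
          have "centers (nput n_j 0 (Suc j) s3) = (centers s2)(j := pt s3 (N + Suc j))"
            using that by (auto simp: centers_def fun_eq_iff)
          then show ?thesis by (simp add: f_def b_def)
        qed
        show ?thesis
          by (rule run_weaken[OF run_scale[OF run_slot_hits[OF r2 j2 j(1) W0 T2 rate(1) hits[unfolded item]], of "ennreal b"]])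
            (use post in \<open>auto simp: fj f_Suc\<close>)
      qed
    qed (use j J in \<open>auto simp: J_def\<close>)
  next
    case 5
    show ?case by (simp add: f_def covers_def)
  qed (use assms in \<open>auto simp: frame_def readyD J_def dist_ok_def loaded_def\<close>)
  show ?thesis
    unfolding c_sampling_def
  proof (rule run_time, rule run_Seq[OF loop, where ?T2.0 = "300 * ((N + 1) * (d + 1))"], goal_cases)
    case (1 s')
    note s' = 1(1) and fr = 1(2)
    have r': "ready s'" by (rule ready_frame[OF \<open>ready s\<close> fr]) auto
    have ref: "ok c_refresh s' (300 * ((N + 1) * (d + 1)))
      (\<lambda>s''. dist_ok (Suc k) s'' \<and> near_ok (Suc k) s'' \<and> rmem s'' r_tot 0 = (\<Sum>q<N. rmem s'' r_w q))"
      by (rule ok_c_refresh[OF r']) (use s' in \<open>auto simp: J_def\<close>)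
    have "ok c_refresh s' (300 * ((N + 1) * (d + 1))) (\<lambda>s''. (loaded s'' \<and> dist_ok (Suc k) s'') \<and> pt s'' = pt s')"
      by (rule ok_weaken[OF ref]) (use s' in \<open>auto simp: J_def loaded_def pt_frame\<close>)
    then have "run c_refresh s' (300 * ((N + 1) * (d + 1))) (\<lambda>s''. (loaded s'' \<and> dist_ok (Suc k) s'') \<and> pt s'' = pt s')
       (\<lambda>s'. if covers k (centers s') then 1 else 0) (f k s')"
      by (rule ok_run) (auto simp: f_def dest: centers_cong)
    then show ?case
      by (rule run_weaken) auto
  qed (simp add: algebra_simps)
qed

end

section \<open>Optimal chromatic assignment\<close>

text \<open>For each point-set the program tries all assignments of its points to the classes; they are
  enumerated as the base \<open>k\<close> representations of the numbers below \<open>k ^ k\<close>.\<close>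

abbreviation "e_size \<equiv> NGet 1 (V n_i)"
abbreviation "e_dig \<equiv> NGet n_dig (V n_t)"
abbreviation "e_base_t \<equiv> NAdd (V n_base) (V n_t)"

text \<open>The first candidate sends point \<open>t\<close> to class \<open>t\<close>, which is
  admissible because a point-set has at most \<open>k\<close> points. Starting from a genuine
  assignment avoids an infinite initial cost.\<close>

definition c_start :: com where
  "c_start = rset r_grp (rnum 0) ;;
     For n_t e_size (NSet n_asg e_base_t (V n_t) ;;
       rset r_grp (RAdd (RV r_grp) (RGet r_dist (NAdd (NGet n_off (NAdd (V n_t) (NConst 1))) e_base_t))))"

definition c_digits :: com where
  "c_digits = For n_t e_k (NSet n_dig (V n_t) (NConst 0))"

definition c_eval :: com where
  "c_eval = nset n_inj (NConst 1) ;; rset r_cur (rnum 0) ;;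
     For n_t e_size
       (rset r_cur (RAdd (RV r_cur) (RGet r_dist (NAdd (NGet n_off (NAdd e_dig (NConst 1))) e_base_t))) ;;
        For n_t' (V n_t)
          (If (Conj (Neg (NLess e_dig (NGet n_dig (V n_t')))) (Neg (NLess (NGet n_dig (V n_t')) e_dig)))
             (nset n_inj (NConst 0)) Skip))"

definition c_keep :: com where
  "c_keep = If (Conj (NLess (NConst 0) (V n_inj)) (RLess (RV r_cur) (RV r_grp)))
     (rset r_grp (RV r_cur) ;; For n_t e_size (NSet n_asg e_base_t e_dig)) Skip"

text \<open>An odometer in base \<open>k\<close>, in place of division. After the last number it
  wraps around to 0, when the enumeration is over.\<close>

definition c_incr :: com where
  "c_incr = nset n_carry (NConst 1) ;;
     For n_t e_k (If (NLess (NConst 0) (V n_carry))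
       (If (NLess (NAdd e_dig (NConst 1)) e_k)
          (NSet n_dig (V n_t) (NAdd e_dig (NConst 1)) ;; nset n_carry (NConst 0))
          (NSet n_dig (V n_t) (NConst 0)))
       Skip)"

definition c_match :: com where
  "c_match = c_start ;; c_digits ;; For n_e (V n_K) (c_eval ;; c_keep ;; c_incr)"

definition c_assign :: com where
  "c_assign = rset r_cost (rnum 0) ;; nset n_base (NConst 0) ;;
     For n_i e_n (c_match ;; rset r_cost (RAdd (RV r_cost) (RV r_grp)) ;;
       nset n_base (NAdd (V n_base) e_size))"

lemma writes_c_start [simp]: "nwrites c_start = {n_t, n_asg}" "rwrites c_start = {r_grp}"
  by (auto simp: c_start_def)

lemma writes_c_digits [simp]: "nwrites c_digits = {n_t, n_dig}" "rwrites c_digits = {}"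
  by (auto simp: c_digits_def)

lemma writes_c_eval [simp]: "nwrites c_eval = {n_t, n_t', n_inj}" "rwrites c_eval = {r_cur}"
  by (auto simp: c_eval_def)

lemma writes_c_keep [simp]: "nwrites c_keep = {n_t, n_asg}" "rwrites c_keep = {r_grp}"
  by (auto simp: c_keep_def)

lemma writes_c_incr [simp]: "nwrites c_incr = {n_t, n_carry, n_dig}" "rwrites c_incr = {}"
  by (auto simp: c_incr_def)

lemma writes_c_match [simp]:
  "nwrites c_match = {n_e, n_t, n_t', n_inj, n_carry, n_dig, n_asg}" "rwrites c_match = {r_cur, r_grp}"
  by (auto simp: c_match_def)

lemma writes_c_assign [simp]:
  "nwrites c_assign = {n_i, n_base, n_e, n_t, n_t', n_inj, n_carry, n_dig, n_asg}"
  "rwrites c_assign = {r_cost, r_cur, r_grp}"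
  by (auto simp: c_assign_def)

section \<open>Enumeration of digit strings\<close>

definition digit :: "nat \<Rightarrow> nat \<Rightarrow> nat \<Rightarrow> nat" where
  "digit b e t = e div b ^ t mod b"

lemma digit_less: "0 < b \<Longrightarrow> digit b e t < b"
  by (simp add: digit_def)

lemma digits_surj:
  assumes "0 < b" "\<And>t. t < l \<Longrightarrow> f t < b"
  shows "\<exists>e<b ^ l. \<forall>t<l. digit b e t = f t"
  using assms(2)
proof (induction l)
  case (Suc l)
  then obtain e where e: "e < b ^ l" "\<And>t. t < l \<Longrightarrow> digit b e t = f t" by force
  have fl: "f l < b" using Suc.prems by simp
  let ?e = "e + f l * b ^ l"
  have "?e < (1 + f l) * b ^ l" using e(1) by simp
  also have "\<dots> \<le> b * b ^ l" using fl by (intro mult_right_mono) auto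
  finally have "?e < b ^ Suc l" by simp
  moreover have "digit b ?e t = f t" if "t < Suc l" for t
  proof (cases "t = l")
    case True
    then show ?thesis using e(1) fl \<open>0 < b\<close> by (simp add: digit_def)
  next
    case False
    then have "t < l" using that by simp
    \<comment> \<open>For \<open>t < l\<close> the new leading term is divisible by
      \<open>b ^ Suc t\<close>, so it leaves digit \<open>t\<close> alone.\<close>
    then have "b ^ l = b ^ t * (b * b ^ (l - Suc t))"
      by (metis Suc_diff_Suc power_Suc power_add le_add_diff_inverse less_imp_le_nat)
    then have "?e = e + b ^ t * (b * (b ^ (l - Suc t) * f l))" by simp
    then have "?e div b ^ t = (e + b ^ t * (b * (b ^ (l - Suc t) * f l))) div b ^ t" by (rule arg_cong)
    also have "\<dots> = e div b ^ t + b * (b ^ (l - Suc t) * f l)" using \<open>0 < b\<close> by simp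
    finally have "?e div b ^ t = e div b ^ t + b * (b ^ (l - Suc t) * f l)" .
    then show ?thesis using e(2)[OF \<open>t < l\<close>] by (simp add: digit_def)
  qed
  ultimately show ?case by blast
qed simp

text \<open>\<open>b ^ t dvd Suc e\<close> says that all digits of \<open>e\<close> below position
  \<open>t\<close> are \<open>b - 1\<close>, so that the carry arrives there. In this closed form it
  is the loop invariant for the carry flag.\<close>

lemma digit_Suc_no_carry: "\<not> b ^ t dvd Suc e \<Longrightarrow> digit b (Suc e) t = digit b e t"
  by (simp add: digit_def div_Suc dvd_eq_mod_eq_0)

lemma digit_Suc_carry:
  assumes "0 < b" "b ^ t dvd Suc e"
  shows "digit b (Suc e) t = (if Suc (digit b e t) < b then Suc (digit b e t) else 0)"
    "b ^ Suc t dvd Suc e \<longleftrightarrow> \<not> Suc (digit b e t) < b"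
proof -
  have div: "Suc e div b ^ t = Suc (e div b ^ t)" using assms by (simp add: div_Suc dvd_eq_mod_eq_0)
  have "digit b e t < b" using assms by (simp add: digit_less)
  then show 1: "digit b (Suc e) t = (if Suc (digit b e t) < b then Suc (digit b e t) else 0)"
    unfolding digit_def div by (auto simp: mod_Suc)
  have "b ^ Suc t dvd Suc e \<longleftrightarrow> b ^ t * b dvd b ^ t * (Suc e div b ^ t)"
    using assms(2) by (simp add: mult.commute del: mult_Suc_right)
  also have "\<dots> \<longleftrightarrow> b dvd Suc e div b ^ t" using assms(1) by (simp del: mult_Suc_right)
  also have "\<dots> \<longleftrightarrow> digit b (Suc e) t = 0" by (simp add: digit_def dvd_eq_mod_eq_0)
  finally show "b ^ Suc t dvd Suc e \<longleftrightarrow> \<not> Suc (digit b e t) < b" using 1 by simp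
qed

lemma inj_on_lessThan_Suc: "inj_on f {..<Suc t} \<longleftrightarrow> inj_on f {..<t} \<and> (\<forall>u<t. f u \<noteq> f t)"
  by (auto simp: lessThan_Suc) (metis imageI lessThan_iff)

context machine begin

lemma k_pos: "0 < k"
  using k2 by simp

text \<open>Row \<open>Suc (f t)\<close>, because row 0 of the table belongs to the origin.\<close>

definition grp_cost :: "state \<Rightarrow> nat \<Rightarrow> (nat \<Rightarrow> nat) \<Rightarrow> real" where
  "grp_cost s i f = (\<Sum>t<sz i. rmem s r_dist (Suc (f t) * N + (bs i + t)))"

lemma ok_c_digits:
  assumes "ready s"
  shows "ok c_digits s (30 * (k + 1)) (\<lambda>s'. \<forall>t<k. nmem s' n_dig t = 0)"
  unfolding c_digits_def
proof (rule run_time, rule ok_For[where B = k and T = 10 and J = "\<lambda>i s'. \<forall>t<i. nmem s' n_dig t = 0"], goal_cases)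
  case (3 i s')
  then show ?case by (intro run_NSet) (auto simp: less_Suc_eq)
qed (use readyD[OF assms] in \<open>auto simp: frame_def\<close>)

lemma ok_c_incr:
  assumes "ready s" "\<And>t. t < k \<Longrightarrow> nmem s n_dig t = digit k e t"
  shows "ok c_incr s (100 * (k + 1)) (\<lambda>s'. \<forall>t<k. nmem s' n_dig t = digit k (Suc e) t)"
proof -
  define J where "J i s' \<longleftrightarrow> (0 < nmem s' n_carry 0 \<longleftrightarrow> k ^ i dvd Suc e) \<and>
     (\<forall>t<k. nmem s' n_dig t = digit k (if t < i then Suc e else e) t)" for i and s' :: state
  show ?thesis
    unfolding c_incr_def
  proof (rule run_time, rule run_Seq_NSet, rule ok_For[where B = k and T = 70 and J = J], goal_cases)
    case (3 i s')
    note i = 3(1,3) and J = 3(4)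
    have r': "ready s'" by (rule ready_frame[OF _ 3(2)]) (use assms in auto)
    have dig: "nmem s' n_dig i = digit k e i" using J i by (simp add: J_def)
    have not_dvd: "\<not> k ^ Suc i dvd Suc e" if "\<not> k ^ i dvd Suc e"
      using that by (metis dvd_mult_left power_Suc2)
    show ?case
    proof (rule run_time, rule ok_If[where ?T1.0 = 50 and ?T2.0 = 1], rule run_time,
        rule ok_If[where ?T2.0 = 10], rule run_Seq_NSet, rule ok_NSet, goal_cases)
      case 1
      then show ?case
        using J i dig readyD[OF r'] digit_Suc_carry[of k i e] k_pos by (auto simp: J_def less_Suc_eq)
    next
      case 2
      then show ?case
        using J i dig readyD[OF r'] digit_Suc_carry[of k i e] k_pos
        by (intro run_NSet) (auto simp: J_def less_Suc_eq)
    next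
      case 4
      then show ?case
        using J i dig digit_Suc_no_carry[of k i e] not_dvd
        by (intro run_Skip) (auto simp: J_def less_Suc_eq)
    qed simp_all
  qed (use assms readyD[OF assms(1)] in \<open>auto simp: frame_def J_def\<close>)
qed

lemma bs_le: "i < n \<Longrightarrow> bs i + sz i \<le> N"
  unfolding bs_def using sum_mono2[of "{..<n}" "{..<Suc i}" sz] by auto

lemma ok_c_eval:
  assumes "ready s" "nmem s n_i 0 = i" "i < n" "nmem s n_base 0 = bs i"
    and dig: "\<And>t. t < k \<Longrightarrow> nmem s n_dig t < k"
  shows "ok c_eval s (150 * ((k + 1) * (k + 1))) (\<lambda>s'. rmem s' r_cur 0 = grp_cost s i (nmem s n_dig) \<and>
     (0 < nmem s' n_inj 0 \<longleftrightarrow> inj_on (nmem s n_dig) {..<sz i}))"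
proof -
  define f where "f = nmem s n_dig"
  let ?inner = "If (Conj (Neg (NLess e_dig (NGet n_dig (V n_t')))) (Neg (NLess (NGet n_dig (V n_t')) e_dig)))
             (nset n_inj (NConst 0)) Skip"
  define J where "J t s' \<longleftrightarrow> rmem s' r_cur 0 = (\<Sum>u<t. rmem s r_dist (Suc (f u) * N + (bs i + u))) \<and>
     (0 < nmem s' n_inj 0 \<longleftrightarrow> inj_on f {..<t})" for t and s' :: state
  show ?thesis
    unfolding c_eval_def
  proof (rule run_time, rule run_Seq_NSet, rule run_Seq_RSet, rule ok_For[where B = "sz i" and T = "60 * (k + 1) + 40" and J = J], goal_cases)
    case (3 t s')
    note t = 3(1,3) and fr = 3(2) and J = 3(4)
    have r': "ready s'" by (rule ready_frame[OF _ fr]) (use assms in auto)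
    have tk: "t < k" using t sz_le[OF \<open>i < n\<close>] by simp
    have s': "nmem s' n_dig = f" "nmem s' n_base 0 = bs i" "rmem s' r_dist = rmem s r_dist"
      using fr assms by (simp_all add: frame_def f_def)
    have off: "nmem s' n_off (Suc (f t)) = Suc (f t) * N"
      using dig[OF tk] readyD(11)[OF r', of "Suc (f t)"] by (simp add: f_def)
    define s2 where "s2 = rput r_cur 0 (rmem s' r_cur 0 + rmem s r_dist (Suc (f t) * N + (bs i + t))) s'"
    have s2: "nmem s2 n_dig = f" "nmem s2 n_t 0 = t" by (simp_all add: s2_def s' t)
    have "ok (For n_t' (V n_t) ?inner) s2 ((t + 1) * (30 + 14 + ncost (V n_t))) (\<lambda>s''. J (Suc t) (nput n_t 0 (Suc t) s''))"
    proof (rule ok_For[where B = t and J = "\<lambda>u s'. 0 < nmem s' n_inj 0 \<longleftrightarrow> inj_on f {..<t} \<and> (\<forall>v<u. f v \<noteq> f t)"], goal_cases)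
      case (3 u s3)
      have s3: "nmem s3 n_dig = f" "nmem s3 n_t 0 = t" using 3(2) s2 by (simp_all add: frame_def)
      show ?case
      proof (rule run_time, rule ok_If[where ?T2.0 = 1], rule ok_NSet, goal_cases)
        case 2
        then show ?case using 3 s3 by (intro run_Skip) (auto simp: less_Suc_eq)
      qed (use 3 s3 in auto)
    next
      case (5 s3)
      moreover have "rmem s3 r_cur = rmem s2 r_cur" using 5(3) by (simp add: frame_def)
      ultimately show ?case using J by (simp add: J_def inj_on_lessThan_Suc s2_def)
    qed (use J s2 in \<open>auto simp: frame_def J_def s2_def\<close>)
    then show ?case
      by (intro run_time[OF run_Seq_RSet]) (use s' t off in \<open>simp_all add: s2_def\<close>, use tk in linarith)
  next
    case (5 s')
    then show ?case by (simp add: J_def grp_cost_def f_def)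
  next
    case 6
    have "sz i \<le> k" using sz_le[OF \<open>i < n\<close>] .
    then have "(sz i + 1) * (60 * (k + 1) + 40 + 14 + ncost e_size) \<le> (k + 1) * (60 * (k + 1) + 40 + 14 + ncost e_size)"
      by (intro mult_right_mono) auto
    then show ?case by (simp add: algebra_simps)
  qed (use assms readyD[OF assms(1)] in \<open>auto simp: frame_def J_def\<close>)
qed

definition block :: "state \<Rightarrow> nat \<Rightarrow> nat \<Rightarrow> nat" where
  "block s i t = nmem s n_asg (bs i + t)"

definition admissible :: "nat \<Rightarrow> (nat \<Rightarrow> nat) \<Rightarrow> bool" where
  "admissible i f \<longleftrightarrow> inj_on f {..<sz i} \<and> (\<forall>t<sz i. f t < k)"

lemma grp_cost_cong:
  "rmem s r_dist = rmem s' r_dist \<Longrightarrow> (\<And>t. t < sz i \<Longrightarrow> f t = g t) \<Longrightarrow> grp_cost s i f = grp_cost s' i g"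
  by (simp add: grp_cost_def)

lemma admissible_cong: "(\<And>t. t < sz i \<Longrightarrow> f t = g t) \<Longrightarrow> admissible i f \<longleftrightarrow> admissible i g"
  unfolding admissible_def by (intro conj_cong inj_on_cong) auto

lemma ok_c_start:
  assumes "ready s" "nmem s n_i 0 = i" "i < n" "nmem s n_base 0 = bs i"
  shows "ok c_start s (80 * (k + 1)) (\<lambda>s'. admissible i (block s' i) \<and>
     rmem s' r_grp 0 = grp_cost s i (block s' i) \<and> (\<forall>q<bs i. nmem s' n_asg q = nmem s n_asg q))"
proof -
  have szk: "sz i \<le> k" using sz_le[OF \<open>i < n\<close>] .
  define J where "J t s' \<longleftrightarrow> (\<forall>u<t. nmem s' n_asg (bs i + u) = u) \<and>
     rmem s' r_grp 0 = (\<Sum>u<t. rmem s r_dist (Suc u * N + (bs i + u))) \<and>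
     (\<forall>q<bs i. nmem s' n_asg q = nmem s n_asg q)" for t and s' :: state
  show ?thesis
    unfolding c_start_def
  proof (rule run_time, rule run_Seq_RSet, rule ok_For[where B = "sz i" and T = 40 and J = J], goal_cases)
    case (3 t s')
    have r': "ready s'" by (rule ready_frame[OF _ 3(2)]) (use assms in auto)
    have s': "nmem s' n_base 0 = bs i" "rmem s' r_dist = rmem s r_dist" "nmem s' n_off (Suc t) = Suc t * N"
      using 3(1,2) assms readyD(11)[OF r', of "Suc t"] szk by (simp_all add: frame_def)
    show ?case
      by (rule run_time, rule run_Seq_NSet, rule ok_RSet) (use 3(1,3,4) s' in \<open>auto simp: J_def less_Suc_eq\<close>)
  next
    case (5 s')
    then have "admissible i (block s' i) \<longleftrightarrow> admissible i (\<lambda>t. t)"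
      by (intro admissible_cong) (simp add: J_def block_def)
    then show ?case using 5(1) szk by (auto simp: J_def grp_cost_def admissible_def block_def)
  qed (use assms readyD[OF assms(1)] szk in \<open>auto simp: frame_def J_def\<close>)
qed

lemma ok_c_keep:
  assumes "ready s" "nmem s n_i 0 = i" "i < n" "nmem s n_base 0 = bs i"
    and dig: "\<And>t. t < k \<Longrightarrow> nmem s n_dig t < k"
    and adm: "admissible i (block s i)" "rmem s r_grp 0 = grp_cost s i (block s i)"
    and cur: "rmem s r_cur 0 = grp_cost s i (nmem s n_dig)" "0 < nmem s n_inj 0 \<longleftrightarrow> inj_on (nmem s n_dig) {..<sz i}"
  shows "ok c_keep s (80 * (k + 1)) (\<lambda>s'. admissible i (block s' i) \<and>
     rmem s' r_grp 0 = grp_cost s i (block s' i) \<and> rmem s' r_grp 0 \<le> rmem s r_grp 0 \<and>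
     (inj_on (nmem s n_dig) {..<sz i} \<longrightarrow> rmem s' r_grp 0 \<le> grp_cost s i (nmem s n_dig)) \<and>
     (\<forall>q<bs i. nmem s' n_asg q = nmem s n_asg q))"
    (is "ok _ _ _ ?Q")
proof -
  have szk: "sz i \<le> k" using sz_le[OF \<open>i < n\<close>] .
  define f where "f = nmem s n_dig"
  define J where "J t s' \<longleftrightarrow> (\<forall>u<t. nmem s' n_asg (bs i + u) = f u) \<and>
     (\<forall>q<bs i. nmem s' n_asg q = nmem s n_asg q)" for t and s' :: state
  show ?thesis
    unfolding c_keep_def
  proof (rule run_time, rule ok_If[where ?T2.0 = 1], rule run_Seq_RSet, rule ok_For[where B = "sz i" and T = 20 and J = J], goal_cases)
    case (3 t s')
    have s': "nmem s' n_base 0 = bs i" "nmem s' n_dig = f"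
      using 3(3) assms by (simp_all add: frame_def f_def)
    show ?case by (rule run_NSet) (use 3(2,4,5) s' in \<open>auto simp: J_def less_Suc_eq\<close>)
  next
    case (5 s')
    note b = 5(1) and J = 5(2)
    have "rmem s' r_grp 0 = grp_cost s i f" using 5(4) cur by (simp add: frame_def f_def)
    moreover have "grp_cost s i f < rmem s r_grp 0" "inj_on f {..<sz i}" using b cur by (auto simp: f_def)
    moreover have "grp_cost s i (block s' i) = grp_cost s i f"
      using J by (intro grp_cost_cong) (auto simp: J_def block_def)
    moreover have "admissible i (block s' i) \<longleftrightarrow> admissible i f"
      using J by (intro admissible_cong) (auto simp: J_def block_def)
    ultimately show ?case using J dig szk by (auto simp: J_def admissible_def f_def)
  next
    case 6
    then show ?case using adm cur by (intro run_Skip) auto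
  qed (use assms readyD[OF assms(1)] szk in \<open>auto simp: frame_def J_def\<close>)
qed

lemma ok_c_match:
  assumes "ready s" "nmem s n_i 0 = i" "i < n" "nmem s n_base 0 = bs i"
  shows "ok c_match s (1000 * ((k ^ k + 1) * ((k + 1) * (k + 1)))) (\<lambda>s'. admissible i (block s' i) \<and>
     rmem s' r_grp 0 = grp_cost s i (block s' i) \<and>
     (\<forall>f. admissible i f \<longrightarrow> rmem s' r_grp 0 \<le> grp_cost s i f) \<and>
     (\<forall>q<bs i. nmem s' n_asg q = nmem s n_asg q))"
    (is "ok _ _ _ ?Q")
proof -
  have szk: "sz i \<le> k" using sz_le[OF \<open>i < n\<close>] .
  let ?T3 = "150 * ((k + 1) * (k + 1)) + (80 * (k + 1) + 100 * (k + 1))"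
  define J where "J e s' \<longleftrightarrow> (\<forall>t<k. nmem s' n_dig t = digit k e t) \<and> admissible i (block s' i) \<and>
     rmem s' r_grp 0 = grp_cost s i (block s' i) \<and>
     (\<forall>e'<e. inj_on (digit k e') {..<sz i} \<longrightarrow> rmem s' r_grp 0 \<le> grp_cost s i (digit k e')) \<and>
     (\<forall>q<bs i. nmem s' n_asg q = nmem s n_asg q)" for e and s' :: state
  show ?thesis
    unfolding c_match_def
  proof (rule run_time, rule run_Seq_ok[where ?T2.0 = "30 * (k + 1) + (k ^ k + 1) * (?T3 + 14 + ncost (V n_K))"], rule ok_c_start[OF assms], goal_cases)
    case (1 s1)
    note s1 = 1(1) and fr1 = 1(2)
    have r1: "ready s1" by (rule ready_frame[OF assms(1) fr1]) auto
    show ?case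
    proof (rule run_Seq_ok, rule ok_c_digits[OF r1], goal_cases)
      case (1 s2)
      note s2 = 1(1) and fr2 = 1(2)
      have r2: "ready s2" by (rule ready_frame[OF r1 fr2]) auto
      have asg2: "nmem s2 n_asg = nmem s1 n_asg" "rmem s2 = rmem s1" using fr2 by (auto simp: frame_def)
      then have J2: "J 0 (nput n_e 0 0 s2)"
        using s1 s2 by (simp add: J_def block_def[abs_def] digit_def)
      have i2: "nmem s2 n_i 0 = i" "nmem s2 n_base 0 = bs i" "rmem s2 r_dist = rmem s r_dist"
        using fr1 fr2 assms by (simp_all add: frame_def)
      show ?case
      proof (rule ok_For[where J = J], goal_cases)
        case (3 e s')
        note e = 3(1) and fr = 3(2) and J = 3(4)
        have r': "ready s'" by (rule ready_frame[OF r2 fr]) auto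
        have s': "nmem s' n_i 0 = i" "nmem s' n_base 0 = bs i" "rmem s' r_dist = rmem s r_dist"
          using fr i2 by (simp_all add: frame_def)
        have dig: "nmem s' n_dig t = digit k e t" if "t < k" for t using J that by (simp add: J_def)
        have dig_less: "nmem s' n_dig t < k" if "t < k" for t using dig[OF that] digit_less[OF k_pos] by simp
        have gc: "grp_cost s' i f = grp_cost s i f" for f using s' by (simp add: grp_cost_def)
        have gd: "grp_cost s i (nmem s' n_dig) = grp_cost s i (digit k e)"
          using dig szk by (intro grp_cost_cong) auto
        have inj: "inj_on (nmem s' n_dig) {..<sz i} \<longleftrightarrow> inj_on (digit k e) {..<sz i}"
          using dig szk by (intro inj_on_cong) auto
        show ?case
        proof (rule run_Seq_ok, rule ok_c_eval[OF r' s'(1) \<open>i < n\<close> s'(2) dig_less], assumption, goal_cases)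
          case (1 s3)
          note s3 = 1(1) and fr3 = 1(2)
          have r3: "ready s3" by (rule ready_frame[OF r' fr3]) auto
          have same3: "nmem s3 n_i 0 = i" "nmem s3 n_base 0 = bs i" "rmem s3 r_dist = rmem s r_dist"
            "nmem s3 n_dig = nmem s' n_dig" "nmem s3 n_asg = nmem s' n_asg" "rmem s3 r_grp = rmem s' r_grp"
            using fr3 s' by (simp_all add: frame_def)
          have gc3: "grp_cost s3 i f = grp_cost s i f" for f using same3 by (simp add: grp_cost_def)
          have bl3: "block s3 = block s'" by (simp add: block_def[abs_def] same3)
          note keep = ok_c_keep[OF r3 same3(1) \<open>i < n\<close> same3(2), unfolded same3 gc3 bl3]
          show ?case
          proof (rule run_Seq_ok, rule keep, goal_cases)
            case (6 s4)
            note s4 = 6(1) and fr4 = 6(2)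
            have r4: "ready s4" by (rule ready_frame[OF r3 fr4]) auto
            have dig4: "nmem s4 n_dig = nmem s' n_dig" using fr4 same3 by (simp add: frame_def)
            have incr: "ok c_incr s4 (100 * (k + 1)) (\<lambda>s5. \<forall>t<k. nmem s5 n_dig t = digit k (Suc e) t)"
              by (rule ok_c_incr[OF r4]) (use dig dig4 in simp)
            show ?case
            proof (rule ok_weaken[OF incr order_refl], goal_cases)
              case (1 s5)
              note d5 = 1(1) and fr5 = 1(2)
              define s6 where "s6 = nput n_e 0 (Suc e) s5"
              have asg6: "nmem s6 n_asg = nmem s4 n_asg" and r6: "rmem s6 = rmem s4" and dig6: "nmem s6 n_dig = nmem s5 n_dig"
                using fr5 by (auto simp: frame_def s6_def)
              have bl6: "block s6 = block s4" by (simp add: block_def[abs_def] asg6)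
              have le: "rmem s4 r_grp 0 \<le> rmem s' r_grp 0" using s4 same3 by simp
              have "rmem s4 r_grp 0 \<le> grp_cost s i (digit k e')"
                if "e' < Suc e" "inj_on (digit k e') {..<sz i}" for e'
              proof (cases "e' = e")
                case True
                then show ?thesis using s4 that inj gd by (simp add: same3 gc3)
              next
                case False
                then have "e' < e" using that by simp
                then have "rmem s' r_grp 0 \<le> grp_cost s i (digit k e')" using J that(2) unfolding J_def by blast
                then show ?thesis using le by linarith
              qed
              then show ?case
                using J s4 d5 unfolding s6_def[symmetric] J_def asg6 bl6 r6 dig6 by (simp add: gc3 same3)
            qed
          qed (use s3 J dig_less in \<open>auto simp: same3 gc3 bl3 gc J_def\<close>)
        qed
      next
        case (5 s')
        note J = 5(1)
        have "rmem s' r_grp 0 \<le> grp_cost s i f" if f: "admissible i f" for f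
        proof -
          \<comment> \<open>\<open>f\<close> is continued by zeros to \<open>k\<close> digits;
            injectivity is asked of the first \<open>sz i\<close> of them only.\<close>
          obtain e where e: "e < k ^ k" "\<forall>t<k. digit k e t = (if t < sz i then f t else 0)"
          proof -
            have "\<exists>e<k ^ k. \<forall>t<k. digit k e t = (if t < sz i then f t else 0)"
              using f k_pos by (intro digits_surj) (auto simp: admissible_def)
            then show ?thesis using that by blast
          qed
          have "inj_on (digit k e) {..<sz i} \<longleftrightarrow> inj_on f {..<sz i}"
            using e szk by (intro inj_on_cong) auto
          moreover have "grp_cost s i (digit k e) = grp_cost s i f"
            using e szk by (intro grp_cost_cong) auto
          ultimately show ?thesis using J e f by (auto simp: J_def admissible_def)
        qed
        then show ?case using J by (auto simp: J_def)
      qed (use J2 readyD[OF r2] in \<open>auto simp: frame_def\<close>)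
    qed
  qed (simp add: algebra_simps)
qed

text \<open>The chromatic constraint never relates points of different point-sets, so each set can
  be optimized separately and the costs added. Treating set \<open>i\<close> leaves all cells below
  \<open>bs i\<close> alone, where the earlier sets are stored.\<close>

lemma ok_c_assign:
  assumes "ready s"
  shows "ok c_assign s (1100 * ((n + 1) * ((k ^ k + 1) * ((k + 1) * (k + 1))))) (\<lambda>s'.
     (\<forall>i<n. admissible i (block s' i) \<and> (\<forall>f. admissible i f \<longrightarrow> grp_cost s i (block s' i) \<le> grp_cost s i f)) \<and>
     rmem s' r_cost 0 = (\<Sum>i<n. grp_cost s i (block s' i)))"
proof -
  define J where "J i s' \<longleftrightarrow> nmem s' n_base 0 = bs i \<and>
     (\<forall>i'<i. admissible i' (block s' i') \<and> (\<forall>f. admissible i' f \<longrightarrow> grp_cost s i' (block s' i') \<le> grp_cost s i' f)) \<and>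
     rmem s' r_cost 0 = (\<Sum>i'<i. grp_cost s i' (block s' i'))" for i and s' :: state
  show ?thesis
    unfolding c_assign_def
  proof (rule run_time, rule run_Seq_RSet, rule run_Seq_NSet, rule ok_For[where B = n and J = J and
        T = "1000 * ((k ^ k + 1) * ((k + 1) * (k + 1))) + 30"], goal_cases)
    case (3 i s')
    note i = 3(1,3) and fr = 3(2) and J = 3(4)
    have r': "ready s'" by (rule ready_frame[OF _ fr]) (use assms in auto)
    have dist': "rmem s' r_dist = rmem s r_dist" using fr by (simp add: frame_def)
    have gc: "grp_cost s' i' f = grp_cost s i' f" for i' f using dist' by (simp add: grp_cost_def)
    have base: "nmem s' n_base 0 = bs i" using J by (simp add: J_def)
    show ?case
    proof (rule run_time, rule run_Seq_ok[where ?T2.0 = 30], rule ok_c_match[OF r' i(2) i(1) base], goal_cases)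
      case (1 s1)
      note s1 = 1(1) and fr1 = 1(2)
      have r1: "ready s1" by (rule ready_frame[OF r' fr1]) auto
      have same1: "nmem s1 n_i 0 = i" "nmem s1 n_base 0 = bs i" "rmem s1 r_cost = rmem s' r_cost"
        using fr1 i base by (simp_all add: frame_def)
      have bl: "block s1 i' t = block s' i' t" if "i' < i" "t < sz i'" for i' t
      proof -
        have "bs i' + sz i' \<le> bs i" unfolding bs_def using sum_mono2[of "{..<i}" "{..<Suc i'}" sz] that by auto
        then show ?thesis using s1 that by (simp add: block_def)
      qed
      have adm: "admissible i' (block s1 i') \<longleftrightarrow> admissible i' (block s' i')"
        and gcb: "grp_cost s i' (block s1 i') = grp_cost s i' (block s' i')" if "i' < i" for i'
        using bl that by (auto intro!: admissible_cong grp_cost_cong)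
      have size: "nmem s1 (Suc 0) i = sz i" "bs (Suc i) = bs i + sz i"
        using readyD[OF r1] i by (simp_all add: bs_def)
      define s2 where "s2 = nput n_i 0 (Suc i) (nput n_base 0 (bs (Suc i)) (rput r_cost 0 (rmem s' r_cost 0 + rmem s1 r_grp 0) s1))"
      have base2: "nmem s2 n_base 0 = bs (Suc i)" by (simp add: s2_def)
      have bl2: "block s2 = block s1" by (simp add: block_def[abs_def] s2_def)
      have cost2: "rmem s2 r_cost 0 = rmem s' r_cost 0 + rmem s1 r_grp 0" by (simp add: s2_def)
      have "admissible i' (block s1 i') \<and> (\<forall>f. admissible i' f \<longrightarrow> grp_cost s i' (block s1 i') \<le> grp_cost s i' f)"
        if "i' < Suc i" for i'
      proof (cases "i' = i")
        case True
        have "rmem s1 r_grp 0 = grp_cost s i (block s1 i)" using s1 gc by simp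
        then show ?thesis using s1 True unfolding gc by metis
      next
        case False
        then have "i' < i" using that by simp
        then show ?thesis using J adm gcb by (simp add: J_def)
      qed
      moreover have "rmem s' r_cost 0 + rmem s1 r_grp 0 = (\<Sum>i'<Suc i. grp_cost s i' (block s1 i'))"
        using J s1 gcb gc by (simp add: J_def)
      ultimately have "J (Suc i) s2" unfolding J_def base2 bl2 cost2 by blast
      then show ?case
        by (intro run_time[OF run_Seq_RSet[OF ok_NSet]]) (simp_all add: s2_def same1 size)
    qed simp
  qed (use assms readyD[OF assms] in \<open>auto simp: frame_def J_def bs_def algebra_simps\<close>)
qed

end

section \<open>The whole program\<close>

text \<open>The first trial is saved unconditionally, since the initial value 0 of
  \<open>r_best\<close> is not a cost; the disjunction is again written by De Morgan. Entry
  \<open>k\<close> of the position table supplies \<open>k * d\<close>.\<close>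

definition c_save :: com where
  "c_save = If (Neg (Conj (Neg (NLess (V n_cnt) (NConst 1))) (Neg (RLess (RV r_cost) (RV r_best)))))
     (rset r_best (RV r_cost) ;;
      For n_q (V n_N) (NSet 2 (V n_q) (NGet n_asg (V n_q))) ;;
      For n_q (NGet n_pos e_k)
        (RSet 2 (V n_q) (RGet 1 (NAdd (NGet n_pos (NAdd (V n_N) (NConst 1))) (V n_q)))))
     Skip"

definition c_trial :: com where
  "c_trial = c_sampling ;; c_assign ;; c_save"

text \<open>This is \<open>2 / rate\<close>; its power \<open>k * m\<close> bounds the reciprocal of
  the success probability of a trial.\<close>

abbreviation "e_inv_prob \<equiv> RDiv (RMul (rnum 9216) (RMul (OfNat e_k) (OfNat (NAdd e_k (NConst 1)))))
  (RMul e_eps e_eps)"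

abbreviation "e_samples \<equiv> RDiv (rnum 40) e_eps"

text \<open>The added 1 keeps the sampling range nonempty even if all point-sets are empty.\<close>

abbreviation "e_resolution \<equiv>
  RAdd (RDiv (RMul (RMul (rnum 4608) (OfNat e_k)) (OfNat (V n_N))) (RMul e_eps e_eps)) (rnum 1)"

definition c_count :: com where
  "c_count = nset n_N (NConst 0) ;; For n_i e_n (nset n_N (NAdd (V n_N) e_size))"

definition c_prod :: com where
  "c_prod = rset r_prod (rnum 1) ;;
     For n_j e_k (For n_r (V n_m) (rset r_prod (RMul (RV r_prod) e_inv_prob)))"

text \<open>Multiplication by \<open>k\<close> is repeated addition; the tables below are built in
  the same way.\<close>

definition c_pow :: com where
  "c_pow = nset n_K (NConst 1) ;;
     For n_t e_k (nset n_tmp (NConst 0) ;; For n_j e_k (nset n_tmp (NAdd (V n_tmp) (V n_K))) ;;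
       nset n_K (V n_tmp))"

definition c_pos :: com where
  "c_pos = For n_q (NAdd (V n_N) e_k) (NSet n_pos (NAdd (V n_q) (NConst 1)) (NAdd e_pos_q e_d))"

definition c_off :: com where
  "c_off = For n_j e_k (NSet n_off (NAdd (V n_j) (NConst 1)) (NAdd (NGet n_off (V n_j)) (V n_N)))"

definition c_setup :: com where
  "c_setup = c_count ;; Ceil n_m e_samples ;; Ceil n_M e_resolution ;; c_prod ;;
     Ceil n_R (RV r_prod) ;; c_pow ;; c_pos ;; c_off"

definition kcmeans_program :: com where
  "kcmeans_program = c_setup ;; For n_cnt (V n_R) c_trial"

lemma writes_c_save [simp]: "nwrites c_save = {2, n_q}" "rwrites c_save = {2, r_best}"
  by (auto simp: c_save_def)

lemma writes_c_trial [simp]: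
  "nwrites c_trial = {2, n_j, n_r, n_v, n_sel, n_u, n_q, n_l, n_i, n_base, n_e, n_t, n_t', n_inj, n_carry, n_dig, n_asg}"
  "rwrites c_trial = {1, 2, r_tot, r_acc, r_dist, r_w, r_cum, r_cost, r_cur, r_grp, r_best}"
  by (auto simp: c_trial_def)

lemma writes_c_count [simp]: "nwrites c_count = {n_N, n_i}" "rwrites c_count = {}"
  by (auto simp: c_count_def)

lemma writes_c_prod [simp]: "nwrites c_prod = {n_j, n_r}" "rwrites c_prod = {r_prod}"
  by (auto simp: c_prod_def)

lemma writes_c_pow [simp]: "nwrites c_pow = {n_K, n_t, n_tmp, n_j}" "rwrites c_pow = {}"
  by (auto simp: c_pow_def)

lemma writes_c_pos [simp]: "nwrites c_pos = {n_q, n_pos}" "rwrites c_pos = {}"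
  by (auto simp: c_pos_def)

lemma writes_c_off [simp]: "nwrites c_off = {n_j, n_off}" "rwrites c_off = {}"
  by (auto simp: c_off_def)

lemma writes_c_setup [simp]:
  "nwrites c_setup = {n_N, n_i, n_m, n_M, n_j, n_r, n_R, n_K, n_t, n_tmp, n_q, n_pos, n_off}"
  "rwrites c_setup = {r_prod}"
  by (auto simp: c_setup_def)

section \<open>Computation of parameters and address tables\<close>

lemma ok_c_prod:
  assumes "nmem s 0 2 = k" "nmem s n_m 0 = m" "rmem s 0 0 = \<epsilon>"
  shows "ok c_prod s (80 * ((k + 1) * (m + 1)))
    (\<lambda>s'. rmem s' r_prod 0 = (9216 * (real k * real (k + 1)) / (\<epsilon> * \<epsilon>)) ^ (k * m))"
proof -
  let ?B = "9216 * (real k * real (k + 1)) / (\<epsilon> * \<epsilon>)"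
  let ?in = "For n_r (V n_m) (rset r_prod (RMul (RV r_prod) e_inv_prob))"
  show ?thesis
    unfolding c_prod_def
  proof (rule run_time, rule run_Seq_RSet, rule ok_For[where B = k and T = "(m + 1) * 60" and J = "\<lambda>j s'. rmem s' r_prod 0 = ?B ^ (j * m)"])
    fix j and s' :: state
    assume j: "rmem s' r_prod 0 = ?B ^ (j * m)"
      and fr: "frame (For n_j e_k ?in) (rput r_prod (nval (NConst 0) s) (rval (rnum 1) s) s) s'"
    have s': "nmem s' 0 2 = k" "nmem s' n_m 0 = m" "rmem s' 0 0 = \<epsilon>" using fr assms by (simp_all add: frame_def)
    show "ok ?in s' ((m + 1) * 60) (\<lambda>s''. rmem (nput n_j 0 (Suc j) s'') r_prod 0 = ?B ^ (Suc j * m))"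
    proof (rule run_time, rule ok_For[where B = m and T = 40 and J = "\<lambda>r s'. rmem s' r_prod 0 = ?B ^ (j * m + r)"])
      fix r and s'' :: state
      assume *: "rmem s'' r_prod 0 = ?B ^ (j * m + r)" and fr'': "frame ?in s' s''"
      have "nmem s'' 0 2 = k" "rmem s'' 0 0 = \<epsilon>" using fr'' s' by (simp_all add: frame_def)
      then show "ok (rset r_prod (RMul (RV r_prod) e_inv_prob)) s'' 40
         (\<lambda>s''. rmem (nput n_r 0 (Suc r) s'') r_prod 0 = ?B ^ (j * m + Suc r))"
        using * by (intro run_RSet) auto
    qed (use s' j in \<open>auto simp: frame_def add.commute\<close>)
  qed (use assms in \<open>auto simp: frame_def algebra_simps\<close>)
qed

lemma ok_c_pow:
  assumes "nmem s 0 2 = k"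
  shows "ok c_pow s (80 * ((k + 1) * (k + 1))) (\<lambda>s'. nmem s' n_K 0 = k ^ k)"
proof -
  let ?in = "For n_j e_k (nset n_tmp (NAdd (V n_tmp) (V n_K)))"
  let ?body = "nset n_tmp (NConst 0) ;; ?in ;; nset n_K (V n_tmp)"
  show ?thesis
    unfolding c_pow_def
  proof (rule run_time, rule run_Seq_NSet, rule ok_For[where B = k and T = "(k + 1) * 30 + 20" and J = "\<lambda>t s'. nmem s' n_K 0 = k ^ t"])
    fix t and s' :: state
    assume t: "nmem s' n_K 0 = k ^ t"
      and fr: "frame (For n_t e_k ?body) (nput n_K (nval (NConst 0) s) (nval (NConst 1) s) s) s'"
    have k': "nmem s' 0 2 = k" using fr assms by (simp add: frame_def)
    have inner: "ok ?in (nput n_tmp 0 0 s') ((k + 1) * (10 + 14 + ncost e_k)) (\<lambda>s''. nmem s'' n_tmp 0 = k * k ^ t)"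
    proof (rule ok_For[where J = "\<lambda>j s''. nmem s'' n_tmp 0 = j * k ^ t"])
      fix j s'' assume *: "nmem s'' n_tmp 0 = j * k ^ t" and fr'': "frame ?in (nput n_tmp 0 0 s') s''"
      have "nmem s'' n_K 0 = k ^ t" using fr'' t by (simp add: frame_def)
      then show "ok (nset n_tmp (NAdd (V n_tmp) (V n_K))) s'' 10
          (\<lambda>s''. nmem (nput n_j 0 (Suc j) s'') n_tmp 0 = Suc j * k ^ t)"
        using * by (intro run_NSet) auto
    qed (use k' in \<open>auto simp: frame_def\<close>)
    show "ok ?body s' ((k + 1) * 30 + 20) (\<lambda>s''. nmem (nput n_t 0 (Suc t) s'') n_K 0 = k ^ Suc t)"
    proof (rule run_time, rule run_Seq_NSet, rule run_Seq_ok)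
      show "ok ?in (nput n_tmp (nval (NConst 0) s') (nval (NConst 0) s') s') ((k + 1) * (10 + 14 + ncost e_k))
        (\<lambda>s''. nmem s'' n_tmp 0 = k * k ^ t)" using inner by simp
      fix s'' :: state assume "nmem s'' n_tmp 0 = k * k ^ t"
      then show "ok (nset n_K (V n_tmp)) s'' 10 (\<lambda>s''. nmem (nput n_t 0 (Suc t) s'') n_K 0 = k ^ Suc t)"
        by (intro run_NSet) auto
    qed simp
  qed (use assms in \<open>auto simp: frame_def algebra_simps\<close>)
qed

lemma ok_table:
  assumes "nval e s = B" "\<And>s'. frame (For a e (NSet t (NAdd (V a) (NConst 1)) (NAdd (NGet t (V a)) f))) s s' \<Longrightarrow> nval e s' = B \<and> nval f s' = w"
    and "a \<noteq> t" "nmem s t 0 = 0"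
  shows "ok (For a e (NSet t (NAdd (V a) (NConst 1)) (NAdd (NGet t (V a)) f))) s
    ((B + 1) * (30 + ncost e + ncost f)) (\<lambda>s'. \<forall>q\<le>B. nmem s' t q = q * w)"
proof (rule run_time, rule ok_For[where B = B and T = "14 + ncost f" and J = "\<lambda>i s'. \<forall>q\<le>i. nmem s' t q = q * w"])
  fix i and s' :: state
  assume *: "nmem s' a 0 = i" "\<forall>q\<le>i. nmem s' t q = q * w"
    and fr: "frame (For a e (NSet t (NAdd (V a) (NConst 1)) (NAdd (NGet t (V a)) f))) s s'"
  have "nval f s' = w" using assms(2)[OF fr] by simp
  then show "ok (NSet t (NAdd (V a) (NConst 1)) (NAdd (NGet t (V a)) f)) s' (14 + ncost f)
     (\<lambda>s''. \<forall>q\<le>Suc i. nmem (nput a 0 (Suc i) s'') t q = q * w)"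
    using * assms(3) by (intro run_NSet) (auto simp: le_Suc_eq)
qed (use assms in \<open>auto simp: algebra_simps\<close>)

context machine begin

lemma ok_c_count:
  assumes "nmem s 0 0 = n" "\<And>i. i < n \<Longrightarrow> nmem s (Suc 0) i = sz i"
  shows "ok c_count s (40 * (n + 1)) (\<lambda>s'. nmem s' n_N 0 = N)"
  unfolding c_count_def
proof (rule run_time, rule run_Seq_NSet, rule ok_For[where B = n and T = 10 and J = "\<lambda>i s'. nmem s' n_N 0 = bs i"])
  fix i s' assume i: "i < n" "nmem s' n_i 0 = i" "nmem s' n_N 0 = bs i"
    and fr: "frame (For n_i e_n (nset n_N (NAdd (V n_N) e_size))) (nput n_N (nval (NConst 0) s) (nval (NConst 0) s) s) s'"
  have "nmem s' (Suc 0) i = sz i" using fr assms i by (simp add: frame_def)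
  then show "ok (nset n_N (NAdd (V n_N) e_size)) s' 10 (\<lambda>s''. nmem (nput n_i 0 (Suc i) s'') n_N 0 = bs (Suc i))"
    using i by (intro run_NSet) (auto simp: bs_def)
qed (use assms in \<open>auto simp: frame_def bs_def\<close>)

lemma ok_c_setup:
  assumes inp: "nmem s 0 0 = n" "nmem s 0 (Suc 0) = d" "nmem s 0 2 = k" "\<And>i. i < n \<Longrightarrow> nmem s (Suc 0) i = sz i"
    and zero: "nmem s n_pos 0 = 0" "nmem s n_off 0 = 0" and eps: "rmem s 0 0 = \<epsilon>"
    and m: "m = nat \<lceil>40 / \<epsilon>\<rceil>" and M: "M = nat \<lceil>4608 * real k * real N / (\<epsilon> * \<epsilon>) + 1\<rceil>"
    and R: "R = nat \<lceil>(9216 * (real k * real (k + 1)) / (\<epsilon> * \<epsilon>)) ^ (k * m)\<rceil>"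
  shows "ok c_setup s (100 * ((n + 1) + (m + 1) + (M + 1) + (k + 1) * (m + 1) + (R + 1) + (k + 1) * (k + 1) + (N + k + 1))) ready"
proof -
  have pos: "ok c_pos s' ((N + k + 1) * 50) (\<lambda>s''. \<forall>q\<le>N + k. nmem s'' n_pos q = q * d)"
    if "nmem s' n_N 0 = N" "nmem s' 0 2 = k" "nmem s' 0 (Suc 0) = d" "nmem s' n_pos 0 = 0" for s'
    unfolding c_pos_def by (rule run_time, rule ok_table) (use that in \<open>auto simp: frame_def\<close>)
  have off: "ok c_off s' ((k + 1) * 50) (\<lambda>s''. \<forall>q\<le>k. nmem s'' n_off q = q * N)"
    if "nmem s' n_N 0 = N" "nmem s' 0 2 = k" "nmem s' n_off 0 = 0" for s'
    unfolding c_off_def by (rule run_time, rule ok_table) (use that in \<open>auto simp: frame_def\<close>)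
  have "ok c_setup s (40 * (n + 1) + ((m + 1) * 20 + ((M + 1) * 40 + (80 * ((k + 1) * (m + 1)) + ((R + 1) * 20 +
      (80 * ((k + 1) * (k + 1)) + ((N + k + 1) * 50 + (k + 1) * 50))))))) ready"
    unfolding c_setup_def
    by (rule run_Seq_ok, rule ok_c_count, use inp in simp, use inp in simp,
        rule run_Seq_ok, rule ok_Ceil[where x = "40 / \<epsilon>" and Q = "\<lambda>s'. nmem s' n_m 0 = m"],
        use eps in \<open>simp add: frame_def\<close>, use m in simp, use m in simp,
        rule run_Seq_ok, rule ok_Ceil[where x = "4608 * real k * real N / (\<epsilon> * \<epsilon>) + 1" and Q = "\<lambda>s'. nmem s' n_M 0 = M"],
        use inp eps in \<open>simp add: frame_def\<close>, use M in simp, use M in simp,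
        rule run_Seq_ok, rule ok_c_prod, use inp in \<open>simp add: frame_def\<close>, simp add: frame_def, use eps in \<open>simp add: frame_def\<close>,
        rule run_Seq_ok, rule ok_Ceil[where Q = "\<lambda>s'. nmem s' n_R 0 = R"],
        simp add: frame_def, use R in simp, use R in simp,
        rule run_Seq_ok, rule ok_c_pow, use inp in \<open>simp add: frame_def\<close>,
        rule run_Seq_ok, rule pos, simp add: frame_def, use inp in \<open>simp add: frame_def\<close>, use inp in \<open>simp add: frame_def\<close>, use zero in \<open>simp add: frame_def\<close>,
        rule ok_weaken, rule off, simp add: frame_def, use inp in \<open>simp add: frame_def\<close>, use zero in \<open>simp add: frame_def\<close>,
        simp, use inp in \<open>simp add: frame_def ready_def\<close>)
  then show ?thesis by (rule run_time) (simp add: algebra_simps)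
qed

end

text \<open>One step of amplification: with probability \<beta> a failed trial is still rescued
  later, so success has probability at least \<open>p + (1 - p) * \<beta>\<close>.\<close>

lemma run_affine:
  assumes run: "run c s T Q (\<lambda>s. if G s then 1 else 0) (ennreal p)" and \<beta>: "0 \<le> \<beta>" "\<beta> \<le> 1" and "0 \<le> p"
  shows "run c s T Q (\<lambda>s. if G s then 1 else ennreal \<beta>) (ennreal (\<beta> + (1 - \<beta>) * p))"
proof -
  obtain D where D: "exec c s D" "\<forall>(s', t)\<in>set_pmf D. t \<le> T \<and> Q s'"
    "ennreal p \<le> (\<integral>\<^sup>+ x. (if G (fst x) then 1 else 0) \<partial>measure_pmf D)"
    using run by (auto simp: run_def)
  have "ennreal (\<beta> + (1 - \<beta>) * p) = ennreal \<beta> + ennreal (1 - \<beta>) * ennreal p"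
    using \<beta> \<open>0 \<le> p\<close> by (simp add: ennreal_mult)
  also have "\<dots> \<le> ennreal \<beta> + ennreal (1 - \<beta>) * (\<integral>\<^sup>+ x. (if G (fst x) then 1 else 0) \<partial>measure_pmf D)"
    using D(3) by (intro add_left_mono mult_left_mono) auto
  also have "\<dots> = (\<integral>\<^sup>+ x. ennreal \<beta> + ennreal (1 - \<beta>) * (if G (fst x) then 1 else 0) \<partial>measure_pmf D)"
    by (subst nn_integral_add) (simp_all add: nn_integral_cmult)
  also have "\<dots> = (\<integral>\<^sup>+ x. (if G (fst x) then 1 else ennreal \<beta>) \<partial>measure_pmf D)"
    using \<beta> by (intro nn_integral_cong) (auto simp: ennreal_plus[symmetric] simp del: ennreal_plus)
  finally show ?thesis using D unfolding run_def by blast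
qed

lemma sum_lessThan_add: "(\<Sum>q<a + (b :: nat). h q) = (\<Sum>q<a. h q) + (\<Sum>t<b. h (a + t) :: real)"
  by (induction b) simp_all

context machine begin

lemma bs_Suc: "bs (Suc i) = bs i + sz i"
  by (simp add: bs_def)

lemma sum_blocks: "(\<Sum>i<b. \<Sum>t<sz i. h (bs i + t)) = (\<Sum>q<bs b. h q :: real)"
proof (induction b)
  case 0 show ?case by (simp add: bs_def)
qed (simp add: bs_Suc sum_lessThan_add)

lemma ex_block: "q < bs b \<Longrightarrow> \<exists>i<b. \<exists>t<sz i. q = bs i + t"
proof (induction b)
  case (Suc b)
  show ?case
  proof (cases "q < bs b")
    case False
    then have "q - bs b < sz b" "q = bs b + (q - bs b)" using Suc.prems by (auto simp: bs_Suc)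
    then show ?thesis by blast
  qed (use Suc in \<open>meson less_SucI\<close>)
qed (simp add: bs_def)

definition out :: "state \<Rightarrow> nat \<Rightarrow> nat \<Rightarrow> real" where
  "out s j = (\<lambda>l. if l < d then rmem s 2 (j * d + l) else 0)"

text \<open>Guaranteed whatever the random choices: the output is a solution, and
  \<open>r_best\<close> is its true cost up to the factor \<open>1 / n\<close>, so comparing trials
  by \<open>r_best\<close> is sound.\<close>

definition saved :: "state \<Rightarrow> bool" where
  "saved s \<longleftrightarrow> (\<forall>i<n. admissible i (\<lambda>t. nmem s 2 (bs i + t))) \<and>
     rmem s r_best 0 = (\<Sum>q<N. sqdist d (x q) (out s (nmem s 2 q)))"

lemma saved_cong:
  "nmem s' 2 = nmem s 2 \<Longrightarrow> rmem s' 2 = rmem s 2 \<Longrightarrow> rmem s' r_best = rmem s r_best \<Longrightarrow> saved s' = saved s"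
proof -
  assume *: "nmem s' 2 = nmem s 2" "rmem s' 2 = rmem s 2" "rmem s' r_best = rmem s r_best"
  then have "out s' = out s" by (simp add: out_def fun_eq_iff)
  with * show ?thesis by (simp add: saved_def)
qed

lemma sum_grp_cost:
  assumes "loaded s" "dist_ok (Suc k) s" and f: "\<And>q. q < N \<Longrightarrow> f q < k"
  shows "(\<Sum>i<n. grp_cost s i (\<lambda>t. f (bs i + t))) = (\<Sum>q<N. sqdist d (x q) (centers s (f q)))"
proof -
  have "grp_cost s i (\<lambda>t. f (bs i + t)) = (\<Sum>t<sz i. sqdist d (x (bs i + t)) (centers s (f (bs i + t))))" if "i < n" for i
    unfolding grp_cost_def
  proof (rule sum.cong)
    fix t assume "t \<in> {..<sz i}"
    then have q: "bs i + t < N" using bs_le[OF that] by simp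
    then show "rmem s r_dist (Suc (f (bs i + t)) * N + (bs i + t)) = sqdist d (x (bs i + t)) (centers s (f (bs i + t)))"
      using assms(1,2) f[OF q] unfolding dist_ok_def loaded_def centers_def by (metis Suc_less_eq)
  qed simp
  then show ?thesis using sum_blocks[of "\<lambda>q. sqdist d (x q) (centers s (f q))" n] by simp
qed

lemma ok_c_save:
  assumes "ready s" "loaded s" "dist_ok (Suc k) s" "nmem s n_cnt 0 = i" "i > 0 \<Longrightarrow> saved s"
    and adm: "\<And>i. i < n \<Longrightarrow> admissible i (block s i)"
    and cost: "rmem s r_cost 0 = (\<Sum>i<n. grp_cost s i (block s i))"
  shows "ok c_save s (100 * ((N + 1) + (k * d + 1)))
    (\<lambda>s'. saved s' \<and> rmem s' r_best 0 \<le> rmem s r_cost 0 \<and> (i > 0 \<longrightarrow> rmem s' r_best 0 \<le> rmem s r_best 0))"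
    (is "ok _ _ _ ?Q")
proof -
  let ?b = "Neg (Conj (Neg (NLess (V n_cnt) (NConst 1))) (Neg (RLess (RV r_cost) (RV r_best))))"
  let ?l1 = "For n_q (V n_N) (NSet 2 (V n_q) (NGet n_asg (V n_q)))"
  let ?l2 = "For n_q (NGet n_pos e_k)
        (RSet 2 (V n_q) (RGet 1 (NAdd (NGet n_pos (NAdd (V n_N) (NConst 1))) (V n_q))))"
  let ?s1 = "rput r_best 0 (rmem s r_cost 0) s"
  let ?T = "(N + 1) * (10 + 14 + ncost (V n_N)) + (k * d + 1) * (20 + 14 + ncost (NGet n_pos e_k))"
  have asg_less: "nmem s n_asg q < k" if "q < N" for q
    using ex_block[OF that] adm by (auto simp: admissible_def block_def)
  show ?thesis
    unfolding c_save_def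
  proof (rule run_time, rule ok_If[where ?T1.0 = "4 + ?T" and ?T2.0 = 1], goal_cases)
    case 1
    note b = this
    have l1: "ok ?l1 ?s1 ((N + 1) * (10 + 14 + ncost (V n_N))) (\<lambda>s'. \<forall>q<N. nmem s' 2 q = nmem s n_asg q)"
    proof (rule ok_For[where J = "\<lambda>i s'. \<forall>q<i. nmem s' 2 q = nmem s n_asg q"], goal_cases)
      case (3 i s')
      then show ?case by (intro run_NSet) (auto simp: less_Suc_eq frame_def)
    qed (use readyD[OF assms(1)] in \<open>auto simp: frame_def\<close>)
    have "ok (?l1 ;; ?l2) ?s1 ?T ?Q"
    proof (rule run_Seq_ok[OF l1], goal_cases)
      case (1 s2)
      note asg2 = 1(1) and fr2 = 1(2)
      have r2: "ready s2" by (rule ready_frame[OF _ fr2]) (use assms in auto)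
      have same2: "rmem s2 1 = rmem s 1" "rmem s2 r_best 0 = rmem s r_cost 0" using fr2 by (simp_all add: frame_def)
      show ?case
      proof (rule ok_For[where J = "\<lambda>i s'. \<forall>l<i. rmem s' 2 l = rmem s 1 ((N + 1) * d + l)"], goal_cases)
        case (3 i s')
        have "nmem s' n_pos (Suc N) = Suc N * d" "nmem s' n_N 0 = N"
          using 3(2) readyD[OF r2] k_pos readyD(10)[OF r2, of "Suc N"] by (simp_all add: frame_def)
        then show ?case
          using 3 same2 by (intro run_RSet) (auto simp: less_Suc_eq frame_def)
      next
        case (5 s3)
        note l3 = 5(1) and fr3 = 5(3)
        have asg3: "nmem s3 2 q = nmem s n_asg q" if "q < N" for q using fr3 asg2 that by (simp add: frame_def)
        have best3: "rmem s3 r_best 0 = rmem s r_cost 0" using fr3 same2 by (simp add: frame_def)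
        have out3: "out s3 j = centers s j" if "j < k" for j
        proof
          fix l
          have "j * d + l < k * d" if "l < d"
          proof -
            have "j * d + l < Suc j * d" using that by simp
            also have "\<dots> \<le> k * d" using \<open>j < k\<close> by (intro mult_right_mono) auto
            finally show ?thesis .
          qed
          then show "out s3 j l = centers s j l"
            using l3 by (auto simp: out_def centers_def pt_def algebra_simps)
        qed
        have "rmem s r_cost 0 = (\<Sum>i<n. grp_cost s i (\<lambda>t. nmem s n_asg (bs i + t)))"
          unfolding cost by (simp add: block_def[abs_def])
        also have "\<dots> = (\<Sum>q<N. sqdist d (x q) (centers s (nmem s n_asg q)))"
          by (rule sum_grp_cost[OF assms(2,3) asg_less])
        also have "\<dots> = (\<Sum>q<N. sqdist d (x q) (out s3 (nmem s3 2 q)))"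
          using asg3 out3 asg_less by (intro sum.cong) auto
        finally have c3: "rmem s r_cost 0 = (\<Sum>q<N. sqdist d (x q) (out s3 (nmem s3 2 q)))" .
        have "admissible i (\<lambda>t. nmem s3 2 (bs i + t))" if "i < n" for i
        proof -
          have "admissible i (\<lambda>t. nmem s3 2 (bs i + t)) \<longleftrightarrow> admissible i (block s i)"
            using asg3 bs_le[OF that] by (intro admissible_cong) (simp add: block_def)
          then show ?thesis using adm[OF that] by simp
        qed
        then have "saved s3" using best3 c3 by (simp add: saved_def)
        then show ?case using best3 b assms(4) by auto
      qed (use r2 readyD(10)[OF r2, of k] readyD(3)[OF r2] in \<open>auto simp: frame_def\<close>)
    qed
    then show ?case by (intro run_time[OF run_Seq_RSet[where T = ?T]]) simp_all
  next
    case 2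
    then show ?case using assms by (intro run_Skip) auto
  qed (simp add: algebra_simps)
qed

end

text \<open>The partition \<phi> occurs only in the analysis, and \<open>\<phi>_inj\<close> is its
  chromaticity; an optimal one is substituted at the end. The parameters now have the values that
  the setup computes.\<close>

locale good_machine = machine + clustered_points "bs n" d k x \<phi> \<epsilon> for \<phi> \<epsilon> +
  assumes \<phi>_inj: "\<And>i. i < n \<Longrightarrow> inj_on (\<lambda>t. \<phi> (bs i + t)) {..<sz i}"
    and m: "m = nat \<lceil>40 / \<epsilon>\<rceil>" and M: "M = nat \<lceil>4608 * real k * real (bs n) / (\<epsilon> * \<epsilon>) + 1\<rceil>"
    and R: "R = nat \<lceil>(9216 * (real k * real (k + 1)) / (\<epsilon> * \<epsilon>)) ^ (k * m)\<rceil>"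
begin

section \<open>Success of one trial and amplification\<close>

definition good :: "state \<Rightarrow> bool" where
  "good s \<longleftrightarrow> rmem s r_best 0 \<le> (1 + \<epsilon>) * OPT"

lemma good_nput [simp]: "good (nput a i v s) = good s"
  by (simp add: good_def)

definition success :: real where "success = (rate ^ m / 2) ^ k"

text \<open>The relabelled partition of \<open>covers_assignment\<close> is admissible on every
  point-set, so it competes with the computed assignment there.\<close>

lemma covers_cost:
  assumes "loaded s" "dist_ok (Suc k) s" "covers k (centers s)"
    and opt: "\<And>i f. i < n \<Longrightarrow> admissible i f \<Longrightarrow> grp_cost s i (block s' i) \<le> grp_cost s i f"
  shows "(\<Sum>i<n. grp_cost s i (block s' i)) \<le> (1 + \<epsilon>) * OPT"
proof -
  obtain \<psi> where \<psi>: "\<And>q. q < N \<Longrightarrow> \<psi> q < k"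
    "\<And>q q'. q < N \<Longrightarrow> q' < N \<Longrightarrow> \<psi> q = \<psi> q' \<Longrightarrow> \<phi> q = \<phi> q'"
    "(\<Sum>q<N. sqdist d (x q) (centers s (\<psi> q))) \<le> (1 + \<epsilon>) * OPT"
    using covers_assignment[OF assms(3)] by blast
  have "admissible i (\<lambda>t. \<psi> (bs i + t))" if i: "i < n" for i
    unfolding admissible_def
  proof
    have lt: "bs i + t < N" if "t < sz i" for t using bs_le[OF i] that by simp
    show "inj_on (\<lambda>t. \<psi> (bs i + t)) {..<sz i}"
      using \<phi>_inj[OF i] \<psi>(2) lt unfolding inj_on_def by simp
    show "\<forall>t<sz i. \<psi> (bs i + t) < k" using \<psi>(1) lt by blast
  qed
  then have "(\<Sum>i<n. grp_cost s i (block s' i)) \<le> (\<Sum>i<n. grp_cost s i (\<lambda>t. \<psi> (bs i + t)))"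
    using opt by (intro sum_mono) auto
  also have "\<dots> = (\<Sum>q<N. sqdist d (x q) (centers s (\<psi> q)))"
    by (rule sum_grp_cost[OF assms(1,2) \<psi>(1)])
  finally show ?thesis using \<psi>(3) by simp
qed

definition T_trial :: nat where
  "T_trial = 1000 * ((k + 1) * (m + 1) * (N + 1) * (d + 1)) +
     (1100 * ((n + 1) * ((k ^ k + 1) * ((k + 1) * (k + 1)))) + 100 * ((N + 1) + (k * d + 1)))"

text \<open>Only the sampling is random. Assignment and saving are deterministic, so centers that
  cover all clusters lead to a good result with certainty.\<close>

lemma run_c_trial:
  assumes "ready s" "loaded s" "nmem s n_cnt 0 = i" "i > 0 \<Longrightarrow> saved s"
  shows "run c_trial s T_trial
    (\<lambda>s'. loaded s' \<and> saved s' \<and> (i > 0 \<longrightarrow> rmem s' r_best 0 \<le> rmem s r_best 0))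
    (\<lambda>s'. if good s' then 1 else 0) (ennreal success)"
proof -
  have m': "real m \<ge> 40 / \<epsilon>" using m by linarith
  have "real M \<ge> 4608 * real k * real N / (\<epsilon> * \<epsilon>) + 1" using M by linarith
  then have M': "real M \<ge> 4608 * real k * real N / \<epsilon>\<^sup>2" by (simp add: power2_eq_square)
  note samp = run_c_sampling[OF clustered_points_axioms assms(1,2) m' M' refl, folded success_def]
  show ?thesis
    unfolding c_trial_def T_trial_def
  proof (rule run_Seq[OF samp], goal_cases)
    case (1 s1)
    then have l1: "loaded s1" and d1: "dist_ok (Suc k) s1" and fr1: "frame c_sampling s s1" by auto
    have r1: "ready s1" by (rule ready_frame[OF assms(1) fr1]) auto
    have cnt1: "nmem s1 n_cnt 0 = i" and best1: "rmem s1 r_best = rmem s r_best"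
      using fr1 assms(3) by (simp_all add: frame_def)
    have saved1: "saved s1 = saved s"
      by (rule saved_cong) (use fr1 in \<open>simp_all add: frame_def\<close>)
    let ?Q = "\<lambda>s'. loaded s' \<and> saved s' \<and> (i > 0 \<longrightarrow> rmem s' r_best 0 \<le> rmem s r_best 0)"
    let ?T = "1100 * ((n + 1) * ((k ^ k + 1) * ((k + 1) * (k + 1)))) + 100 * ((N + 1) + (k * d + 1))"
    have "ok (c_assign ;; c_save) s1 ?T (\<lambda>s'. ?Q s' \<and> (covers k (centers s1) \<longrightarrow> good s'))"
    proof (rule run_Seq_ok, rule ok_c_assign[OF r1], goal_cases)
      case (1 s2)
      note s2 = 1(1) and fr2 = 1(2)
      have r2: "ready s2" by (rule ready_frame[OF r1 fr2]) auto
      have p2: "pt s2 = pt s1" by (rule pt_frame[OF fr2]) auto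
      have same2: "rmem s2 r_dist = rmem s1 r_dist" "nmem s2 n_cnt 0 = i" "rmem s2 r_best = rmem s r_best"
        using fr2 cnt1 best1 by (simp_all add: frame_def)
      have "saved s2 = saved s1"
        by (rule saved_cong) (use fr2 in \<open>simp_all add: frame_def\<close>)
      then have saved2: "saved s2 = saved s" using saved1 by simp
      have gc: "grp_cost s2 i f = grp_cost s1 i f" for i f using same2 by (simp add: grp_cost_def)
      have l2: "loaded s2" and d2: "dist_ok (Suc k) s2"
        using l1 d1 by (simp_all add: loaded_def dist_ok_def p2 same2)
      note save = ok_c_save[OF r2 l2 d2 same2(2)]
      have cov: "rmem s2 r_cost 0 \<le> (1 + \<epsilon>) * OPT" if "covers k (centers s1)"
        using covers_cost[OF l1 d1 that, of s2] s2 by simp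
      show ?case
      proof (rule ok_weaken[OF save order_refl], goal_cases)
        case (4 s3)
        note s3 = 4(1) and fr3 = 4(2)
        have "pt s3 = pt s2" by (rule pt_frame[OF fr3]) auto
        then have "loaded s3" using l2 by (simp add: loaded_def)
        then show ?case using s3 cov same2 by (auto simp: good_def)
      qed (use assms saved2 s2 gc in auto)
    qed
    then have "run (c_assign ;; c_save) s1 ?T (\<lambda>s'. ?Q s' \<and> (covers k (centers s1) \<longrightarrow> good s'))
       (\<lambda>s'. if good s' then 1 else 0) (if covers k (centers s1) then 1 else 0)"
      by (rule ok_run) auto
    then show ?case
      by (rule run_weaken) auto
  qed
qed

text \<open>As 1/2 is at least \<open>(1 / 2) ^ m\<close>, a trial succeeds with probability at
  least \<open>(rate / 2) ^ (k * m)\<close>, a power whose reciprocal the machine can compute by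
  repeated multiplication.\<close>

lemma inv_prob_ge: "1 \<le> (9216 * (real k * real (k + 1)) / (\<epsilon> * \<epsilon>)) ^ (k * m) * success"
proof -
  define g where "g = rate"
  have g: "g > 0" using \<epsilon> k_pos by (simp add: g_def rate_def)
  have "m > 0" using m_pos .
  then have "2 \<le> (2::real) ^ m" using self_le_power[of "2::real" m] by simp
  then have "g ^ m / 2 ^ m \<le> g ^ m / 2" using g by (intro divide_left_mono) auto
  then have "(g / 2) ^ m \<le> g ^ m / 2" by (simp add: power_divide)
  then have "((g / 2) ^ m) ^ k \<le> (g ^ m / 2) ^ k" using g by (intro power_mono) auto
  then have le: "(g / 2) ^ (k * m) \<le> success"
    by (simp add: success_def g_def power_mult[symmetric] mult.commute)
  have B: "9216 * (real k * real (k + 1)) / (\<epsilon> * \<epsilon>) = 1 / (g / 2)"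
    using \<epsilon> k_pos by (simp add: g_def rate_def power2_eq_square)
  have "1 = (1 / (g / 2)) ^ (k * m) * (g / 2) ^ (k * m)"
    using g by (simp flip: power_mult_distrib)
  also have "\<dots> \<le> (1 / (g / 2)) ^ (k * m) * success"
    using le g by (intro mult_left_mono) auto
  finally show ?thesis unfolding B .
qed

lemma success_bounds: "0 \<le> success" "success \<le> 1"
proof -
  have "rate \<le> 1 / real (0 + 2)" using rate(2)[of 0] k_pos by simp
  then have "rate ^ m \<le> 1" using rate(1) by (intro power_le_one) auto
  then show "success \<le> 1" unfolding success_def using rate(1) by (intro power_le_one) auto
qed (simp add: success_def rate(1))

text \<open>With \<open>s\<close> for \<open>success\<close>: \<open>1 - s \<le> exp (- s)\<close>
  and \<open>R * s \<ge> 1\<close> leave \<open>exp (- 1)\<close>, and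
  \<open>exp 1 \<ge> 2\<close>.\<close>

lemma failure_le: "(1 - success) ^ R \<le> 1 / 2"
proof -
  have R1: "1 \<le> real R * success"
  proof -
    have "(9216 * (real k * real (k + 1)) / (\<epsilon> * \<epsilon>)) ^ (k * m) \<le> real R" using R by linarith
    then have "(9216 * (real k * real (k + 1)) / (\<epsilon> * \<epsilon>)) ^ (k * m) * success \<le> real R * success"
      using success_bounds by (intro mult_right_mono) auto
    then show ?thesis using inv_prob_ge by linarith
  qed
  have "(1 - success) ^ R \<le> exp (- success) ^ R"
    using success_bounds exp_ge_add_one_self[of "- success"] by (intro power_mono) auto
  also have "\<dots> = exp (- (real R * success))" by (simp add: exp_of_nat_mult[symmetric])
  also have "\<dots> \<le> exp (- 1)" using R1 by simp
  also have "\<dots> \<le> 1 / 2"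
    using exp_ge_add_one_self[of 1] by (simp add: exp_minus field_simps)
  finally show ?thesis .
qed

lemma R_pos: "0 < R"
proof -
  have "0 < (9216 * (real k * real (k + 1)) / (\<epsilon> * \<epsilon>)) ^ (k * m)" using \<epsilon> k_pos by simp
  then show ?thesis using R by simp
qed

lemma run_trials:
  assumes "ready s" "loaded s"
  shows "run (For n_cnt (V n_R) c_trial) s ((R + 1) * (T_trial + 14 + ncost (V n_R))) saved
    (\<lambda>s'. if good s' then 1 else 0) (ennreal (1 / 2))"
proof -
  define J where "J i s' \<longleftrightarrow> loaded s' \<and> (i > 0 \<longrightarrow> saved s')" for i :: nat and s'
  define \<beta> where "\<beta> i = 1 - (1 - success) ^ (R - i)" for i
  have \<beta>: "0 \<le> \<beta> i" "\<beta> i \<le> 1" for i using success_bounds by (auto simp: \<beta>_def power_le_one)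
  \<comment> \<open>Before the first trial \<open>r_best\<close> is not a cost, so
    \<open>good\<close> counts only for \<open>i > 0\<close>. \<open>\<beta> i\<close> is the
    probability guaranteed for the \<open>R - i\<close> remaining trials.\<close>
  define f where "f i s' = (if i > 0 \<and> good s' then 1 else ennreal (\<beta> i))" for i s'
  have "run (For n_cnt (V n_R) c_trial) s ((R + 1) * (T_trial + 14 + ncost (V n_R))) (\<lambda>s'. J R s' \<and> nmem s' n_cnt 0 = R) (f R) (ennreal (1 / 2))"
  proof (rule run_For[where J = J], goal_cases)
    case (3 i s')
    note i = 3(1,3) and J = 3(4)
    have r': "ready s'" by (rule ready_frame[OF assms(1) 3(2)]) auto
    let ?Q = "\<lambda>s''. loaded s'' \<and> saved s'' \<and> (i > 0 \<longrightarrow> rmem s'' r_best 0 \<le> rmem s' r_best 0)"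
    have trial: "run c_trial s' T_trial ?Q (\<lambda>s''. if good s'' then 1 else 0) (ennreal success)"
      by (rule run_c_trial[OF r' _ i(2)]) (use J in \<open>auto simp: J_def\<close>)
    have post: "J (Suc i) (nput n_cnt 0 (Suc i) s'')" if "loaded s''" "saved s''" for s''
    proof -
      have "saved (nput n_cnt 0 (Suc i) s'') = saved s''" by (rule saved_cong) simp_all
      then show ?thesis using that by (simp add: J_def loaded_def)
    qed
    have f_Suc: "f (Suc i) (nput n_cnt 0 (Suc i) s'') = (if good s'' then 1 else ennreal (\<beta> (Suc i)))" for s''
      by (simp add: f_def good_def)
    show ?case
    proof (cases "i > 0 \<and> good s'")
      case True
      have "run c_trial s' T_trial ?Q (\<lambda>s''. f (Suc i) (nput n_cnt 0 (Suc i) s'')) (f i s')"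
        using True by (intro ok_run[OF run_ok[OF trial]]) (auto simp: f_def good_def)
      then show ?thesis by (rule run_weaken) (auto simp: post)
    next
      case False
      have "R - i = Suc (R - Suc i)" using i by simp
      then have "\<beta> (Suc i) + (1 - \<beta> (Suc i)) * success = \<beta> i"
        by (simp add: \<beta>_def algebra_simps)
      then have "run c_trial s' T_trial ?Q
        (\<lambda>s''. if good s'' then 1 else ennreal (\<beta> (Suc i))) (ennreal (\<beta> i))"
        using run_affine[OF trial \<beta>[of "Suc i"] success_bounds(1)] by simp
      then show ?thesis by (rule run_weaken) (use False in \<open>auto simp: post f_Suc f_def\<close>)
    qed
  next
    case 5
    have "1 / 2 \<le> \<beta> 0" using failure_le by (simp add: \<beta>_def)
    then have "ennreal (1 / 2) \<le> ennreal (\<beta> 0)" by (rule ennreal_leI)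
    then show ?case unfolding f_def by simp
  qed (use assms in \<open>auto simp: frame_def readyD J_def loaded_def\<close>)
  then show ?thesis
    by (rule run_weaken) (use R_pos in \<open>auto simp: J_def f_def \<beta>_def\<close>)
qed

definition T_setup :: nat where
  "T_setup = 100 * ((n + 1) + (m + 1) + (M + 1) + (k + 1) * (m + 1) + (R + 1) + (k + 1) * (k + 1) + (N + k + 1))"

lemma run_kcmeans_program:
  assumes inp: "nmem s 0 0 = n" "nmem s 0 (Suc 0) = d" "nmem s 0 2 = k" "\<And>i. i < n \<Longrightarrow> nmem s (Suc 0) i = sz i"
    and zero: "nmem s n_pos 0 = 0" "nmem s n_off 0 = 0" and eps: "rmem s 0 0 = \<epsilon>"
    and "loaded s"
  shows "run kcmeans_program s (T_setup + (R + 1) * (T_trial + 16)) saved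
    (\<lambda>s'. if good s' then 1 else 0) (ennreal (1 / 2))"
  unfolding kcmeans_program_def
proof (rule run_Seq_ok)
  show "ok c_setup s T_setup ready"
    unfolding T_setup_def by (rule ok_c_setup[OF inp zero eps m M R])
  fix s' assume r: "ready s'" and fr: "frame c_setup s s'"
  have "pt s' = pt s" by (rule pt_frame[OF fr]) auto
  then have "loaded s'" using \<open>loaded s\<close> by (simp add: loaded_def)
  from run_trials[OF r this] show "run (For n_cnt (V n_R) c_trial) s' ((R + 1) * (T_trial + 16)) saved
    (\<lambda>s'. if good s' then 1 else 0) (ennreal (1 / 2))"
    by (rule run_time) simp
qed

end

section \<open>Instances\<close>

lemma length_concat_take:
  "i \<le> length G \<Longrightarrow> length (concat (take i G)) = (\<Sum>j<i. length (G ! j))"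
  by (induction i) (simp_all add: take_Suc_conv_app_nth)

lemma nth_concat:
  assumes "i < length G" "t < length (G ! i)"
  shows "concat G ! ((\<Sum>j<i. length (G ! j)) + t) = G ! i ! t"
proof -
  have "concat G = concat (take i G) @ G ! i @ concat (drop (Suc i) G)"
    using arg_cong[OF id_take_nth_drop[OF assms(1)], of concat] by simp
  then show ?thesis using assms length_concat_take[of i G] by (simp add: nth_append)
qed

lemma nth_concat_uniform:
  assumes "\<And>p. p \<in> set ps \<Longrightarrow> length p = d"
  shows "length (concat ps) = length ps * d"
    "q < length ps \<Longrightarrow> l < d \<Longrightarrow> concat ps ! (q * d + l) = ps ! q ! l"
proof -
  have len: "(\<Sum>j<i. length (ps ! j)) = i * d" if "i \<le> length ps" for i
    using that assms by (simp add: sum.cong)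
  then show "length (concat ps) = length ps * d" using length_concat_take[of "length ps" ps] by simp
  show "concat ps ! (q * d + l) = ps ! q ! l" if "q < length ps" "l < d"
    using nth_concat[of q ps l] len[of q] that assms by simp
qed

locale kcmeans =
  fixes k d :: nat and \<epsilon> :: real and G :: family
  assumes k2: "2 \<le> k" and d1: "1 \<le> d" and \<epsilon>: "0 < \<epsilon>" "\<epsilon> < 1" and inst: "kcmeans_instance k d G"
begin

definition n :: nat where "n = length G"

definition sz :: "nat \<Rightarrow> nat" where "sz i = length (G ! i)"

definition x :: "nat \<Rightarrow> nat \<Rightarrow> real" where "x q l = (if l < d then concat G ! q ! l else 0)"

definition m :: nat where "m = nat \<lceil>40 / \<epsilon>\<rceil>"

definition M :: nat where
  "M = nat \<lceil>4608 * real k * real (machine.bs sz n) / (\<epsilon> * \<epsilon>) + 1\<rceil>"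

definition R :: nat where
  "R = nat \<lceil>(9216 * (real k * real (k + 1)) / (\<epsilon> * \<epsilon>)) ^ (k * m)\<rceil>"

sublocale machine n d k m M R sz x
proof
  show "0 < m" using \<epsilon> by (simp add: m_def)
  have "0 \<le> 4608 * real k * real (machine.bs sz n) / (\<epsilon> * \<epsilon>)" by simp
  then show "0 < M" unfolding M_def by linarith
  show "sz i \<le> k" if "i < n" for i
    using inst that by (auto simp: kcmeans_instance_def sz_def n_def)
qed (rule k2)

lemma length_point: "p \<in> set (concat G) \<Longrightarrow> length p = d"
  using inst by (auto simp: kcmeans_instance_def)

lemma n_pos: "0 < n"
  using inst by (auto simp: kcmeans_instance_def n_def)

lemma bs_eq: "i \<le> n \<Longrightarrow> bs i = length (concat (take i G))"
  by (simp add: length_concat_take bs_def sz_def n_def)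

lemma N_eq: "N = length (concat G)"
  using bs_eq[of n] by (simp add: n_def)

lemma x_point: "i < n \<Longrightarrow> t < sz i \<Longrightarrow> l < d \<Longrightarrow> x (bs i + t) l = G ! i ! t ! l"
proof -
  have "bs i = (\<Sum>j<i. length (G ! j))" by (simp add: bs_def sz_def)
  then show "i < n \<Longrightarrow> t < sz i \<Longrightarrow> l < d \<Longrightarrow> x (bs i + t) l = G ! i ! t ! l"
    using nth_concat[of i G t] by (simp add: x_def sz_def n_def)
qed

text \<open>The origin needs no initialization: slot \<open>N\<close> starts right behind the input,
  where memory is 0, and centers are written to later slots only.\<close>

lemma loaded_input: "loaded (input_state k d \<epsilon> G)"
  unfolding loaded_def
proof (intro conjI allI impI)
  note uniform = nth_concat_uniform[of "concat G" d, OF length_point]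
  show "pt (input_state k d \<epsilon> G) q = x q" if "q < N" for q
  proof
    fix l
    have "q * d + l < N * d" if "l < d"
    proof -
      have "q * d + l < Suc q * d" using that by simp
      also have "\<dots> \<le> N * d" using \<open>q < N\<close> by (intro mult_right_mono) auto
      finally show ?thesis .
    qed
    then show "pt (input_state k d \<epsilon> G) q l = x q l"
      using uniform that unfolding N_eq
      by (auto simp: pt_def x_def input_state_def nth_default_def)
  qed
  show "pt (input_state k d \<epsilon> G) N = (\<lambda>_. 0)"
    using uniform(1) by (auto simp: pt_def input_state_def nth_default_def fun_eq_iff N_eq)
qed

section \<open>Chromatic partitions as colorings of point numbers\<close>

lemma occurrences_eq: "occurrences G = {(i, t). i < n \<and> t < sz i}"
  by (simp add: occurrences_def n_def sz_def)

lemma finite_occurrences: "finite (occurrences G)"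
proof -
  have "occurrences G = Sigma {..<n} (\<lambda>i. {..<sz i})" by (auto simp: occurrences_eq)
  then show ?thesis by simp
qed

lemma sum_occurrences: "(\<Sum>(i, t)\<in>occurrences G. h i t) = (\<Sum>i<n. \<Sum>t<sz i. h i t :: real)"
proof -
  have "occurrences G = Sigma {..<n} (\<lambda>i. {..<sz i})" by (auto simp: occurrences_eq)
  then show ?thesis by (simp add: sum.Sigma)
qed

lemma euclid_dist_eq:
  assumes "i < n" "t < sz i"
  shows "(euclid_dist d (G ! i ! t) p)\<^sup>2 = sqdist d (x (bs i + t)) (\<lambda>l. p ! l)"
  using assms by (simp add: euclid_dist_def L2_set_def sqdist_def sum_nonneg x_point)

lemma objective_eq:
  assumes U: "\<And>j. j < k \<Longrightarrow> U j = {(i, t) \<in> occurrences G. \<phi> (bs i + t) = j}"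
    and \<phi>: "\<And>i t. i < n \<Longrightarrow> t < sz i \<Longrightarrow> \<phi> (bs i + t) < k"
  shows "objective k d G c U = (\<Sum>q<N. sqdist d (x q) (\<lambda>l. c (\<phi> q) ! l)) / real n"
proof -
  let ?g = "\<lambda>(i, t). \<phi> (bs i + t)" and ?h = "\<lambda>(i, t). (euclid_dist d (G ! i ! t) (c (\<phi> (bs i + t))))\<^sup>2"
  have "(\<Sum>j<k. \<Sum>(i, t)\<in>U j. (euclid_dist d (G ! i ! t) (c j))\<^sup>2) =
      (\<Sum>j<k. \<Sum>p\<in>{p \<in> occurrences G. ?g p = j}. ?h p)"
    using U by (intro sum.cong) auto
  also have "\<dots> = (\<Sum>p\<in>occurrences G. ?h p)"
    using \<phi> by (intro sum.group finite_occurrences) (auto simp: occurrences_eq)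
  also have "\<dots> = (\<Sum>i<n. \<Sum>t<sz i. (euclid_dist d (G ! i ! t) (c (\<phi> (bs i + t))))\<^sup>2)"
    by (rule sum_occurrences)
  also have "\<dots> = (\<Sum>i<n. \<Sum>t<sz i. sqdist d (x (bs i + t)) (\<lambda>l. c (\<phi> (bs i + t)) ! l))"
    by (intro sum.cong) (auto simp: euclid_dist_eq)
  also have "\<dots> = (\<Sum>q<N. sqdist d (x q) (\<lambda>l. c (\<phi> q) ! l))"
    by (rule sum_blocks[of "\<lambda>q. sqdist d (x q) (\<lambda>l. c (\<phi> q) ! l)"])
  finally show ?thesis by (simp add: objective_def n_def)
qed

text \<open>Extensional functions, so that there are only finitely many and a best one
  exists.\<close>

definition colorings :: "(nat \<Rightarrow> nat) set" where
  "colorings = {\<phi> \<in> {..<N} \<rightarrow>\<^sub>E {..<k}. \<forall>i<n. inj_on (\<lambda>t. \<phi> (bs i + t)) {..<sz i}}"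

lemma finite_colorings: "finite colorings"
  unfolding colorings_def by (intro finite_subset[OF _ finite_PiE[of "{..<N}" "\<lambda>_. {..<k}"]]) auto

lemma coloring_less:
  assumes "\<phi> \<in> colorings" "i < n" "t < sz i"
  shows "\<phi> (bs i + t) < k"
proof -
  have "bs i + t < N" using bs_le[OF assms(2)] assms(3) by simp
  then show ?thesis using assms(1) by (simp add: colorings_def PiE_iff)
qed

lemma coloring_inj: "\<phi> \<in> colorings \<Longrightarrow> i < n \<Longrightarrow> inj_on (\<lambda>t. \<phi> (bs i + t)) {..<sz i}"
  by (simp add: colorings_def)

lemma block_unique:
  assumes "i < n" "t < sz i" "i' < n" "t' < sz i'" "bs i + t = bs i' + t'"
  shows "i = i' \<and> t = t'"
proof -
  have "bs i + t < bs i'" if "i < i'" "t < sz i" for i i' t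
  proof -
    have "bs i + t < bs (Suc i)" using that by (simp add: bs_Suc)
    also have "\<dots> \<le> bs i'" unfolding bs_def using that by (intro sum_mono2) auto
    finally show ?thesis .
  qed
  from this[of i i' t] this[of i' i t'] show ?thesis
    using assms by (cases i i' rule: linorder_cases) auto
qed

lemma ex_coloring:
  assumes "\<And>i t. i < n \<Longrightarrow> t < sz i \<Longrightarrow> g i t < k" "\<And>i. i < n \<Longrightarrow> inj_on (g i) {..<sz i}"
  obtains \<phi> where "\<phi> \<in> colorings" "\<And>i t. i < n \<Longrightarrow> t < sz i \<Longrightarrow> \<phi> (bs i + t) = g i t"
proof -
  define P where "P q j \<longleftrightarrow> (\<exists>i<n. \<exists>t<sz i. q = bs i + t \<and> j = g i t)" for q j
  define \<phi> where "\<phi> q = (if q < N then SOME j. P q j else undefined)" for q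
  have \<phi>: "\<phi> (bs i + t) = g i t" if "i < n" "t < sz i" for i t
  proof -
    have "bs i + t < N" using bs_le[OF that(1)] that(2) by simp
    moreover have "P (bs i + t) (g i t)" using that by (auto simp: P_def)
    ultimately have "P (bs i + t) (\<phi> (bs i + t))" using someI[of "P (bs i + t)"] by (simp add: \<phi>_def)
    then obtain i' t' where *: "i' < n" "t' < sz i'" "bs i + t = bs i' + t'" "\<phi> (bs i + t) = g i' t'"
      unfolding P_def by blast
    show ?thesis using block_unique[OF that *(1-3)] *(4) by simp
  qed
  have "\<phi> q < k" if q: "q < N" for q
  proof -
    obtain i t where "i < n" "t < sz i" "q = bs i + t" using ex_block[OF q] by blast
    then show ?thesis using \<phi> assms(1) by simp
  qed
  moreover have "inj_on (\<lambda>t. \<phi> (bs i + t)) {..<sz i}" if "i < n" for i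
    using assms(2)[OF that] \<phi>[OF that] by (simp add: inj_on_def)
  ultimately have "\<phi> \<in> colorings" by (auto simp: colorings_def PiE_def extensional_def \<phi>_def)
  then show ?thesis using \<phi> that by blast
qed

lemma coloring_of_partition:
  assumes "chromatic_partition k G U"
  obtains \<phi> where "\<phi> \<in> colorings" "\<And>j. j < k \<Longrightarrow> U j = {(i, t) \<in> occurrences G. \<phi> (bs i + t) = j}"
proof -
  have un: "(\<Union>j<k. U j) = occurrences G" and dis: "disjoint_family_on U {..<k}"
    and card: "\<And>j i. j < k \<Longrightarrow> i < n \<Longrightarrow> card {q \<in> U j. fst q = i} \<le> 1"
    using assms by (auto simp: chromatic_partition_def n_def)
  have "\<exists>j<k. (i, t) \<in> U j" if "i < n" "t < sz i" for i t
  proof -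
    have "(i, t) \<in> (\<Union>j<k. U j)" unfolding un using that by (simp add: occurrences_eq)
    then show ?thesis by blast
  qed
  note ex = this
  define g where "g i t = (SOME j. j < k \<and> (i, t) \<in> U j)" for i t
  have g: "g i t < k \<and> (i, t) \<in> U (g i t)" if "i < n" "t < sz i" for i t
    unfolding g_def using someI_ex[OF ex[OF that]] .
  have "inj_on (g i) {..<sz i}" if i: "i < n" for i
  proof (rule inj_onI)
    fix t t' assume t: "t \<in> {..<sz i}" "t' \<in> {..<sz i}" "g i t = g i t'"
    let ?A = "{q \<in> U (g i t). fst q = i}"
    have j: "g i t < k" using g[OF i] t by simp
    have "?A \<subseteq> occurrences G" using un j by blast
    \<comment> \<open>Needed because an infinite set has \<open>card\<close> 0, which would also
      satisfy the bound.\<close>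
    then have "finite ?A" using finite_occurrences finite_subset by blast
    then have "\<forall>p\<in>?A. \<forall>q\<in>?A. p = q" using card[OF j i] card_le_Suc0_iff_eq[of ?A] by simp
    moreover have "(i, t) \<in> ?A" "(i, t') \<in> ?A" using g[OF i, of t] g[OF i, of t'] t by auto
    ultimately show "t = t'" by blast
  qed
  then obtain \<phi> where \<phi>: "\<phi> \<in> colorings" "\<And>i t. i < n \<Longrightarrow> t < sz i \<Longrightarrow> \<phi> (bs i + t) = g i t"
    using ex_coloring[of g] g by blast
  have "U j = {(i, t) \<in> occurrences G. \<phi> (bs i + t) = j}" if j: "j < k" for j
  proof -
    have "(i, t) \<in> U j \<longleftrightarrow> (i, t) \<in> occurrences G \<and> \<phi> (bs i + t) = j" for i t
    proof
      assume *: "(i, t) \<in> U j"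
      then have occ: "(i, t) \<in> occurrences G" using un j by blast
      then have it: "i < n" "t < sz i" by (auto simp: occurrences_eq)
      have "j = g i t"
        using dis * g[OF it] j unfolding disjoint_family_on_def by (metis IntI empty_iff lessThan_iff)
      then show "(i, t) \<in> occurrences G \<and> \<phi> (bs i + t) = j" using occ \<phi>(2)[OF it] by simp
    next
      assume "(i, t) \<in> occurrences G \<and> \<phi> (bs i + t) = j"
      then show "(i, t) \<in> U j" using g \<phi>(2) by (auto simp: occurrences_eq)
    qed
    then show ?thesis by auto
  qed
  then show ?thesis using \<phi>(1) that by blast
qed

lemma partition_of_coloring:
  assumes U: "\<And>j. j < k \<Longrightarrow> U j = {(i, t) \<in> occurrences G. \<phi> (bs i + t) = j}"
    and \<phi>: "\<And>i t. i < n \<Longrightarrow> t < sz i \<Longrightarrow> \<phi> (bs i + t) < k"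
    and inj: "\<And>i. i < n \<Longrightarrow> inj_on (\<lambda>t. \<phi> (bs i + t)) {..<sz i}"
  shows "chromatic_partition k G U"
  unfolding chromatic_partition_def
proof (intro conjI allI impI)
  show "(\<Union>j<k. U j) = occurrences G" using U \<phi> by (auto simp: occurrences_eq)
  show "disjoint_family_on U {..<k}" using U by (auto simp: disjoint_family_on_def)
  fix j i assume j: "j < k" and "i < length G"
  then have i: "i < n" by (simp add: n_def)
  let ?A = "{q \<in> U j. fst q = i}"
  have "finite ?A" using U[OF j] by (intro finite_subset[OF _ finite_occurrences]) auto
  moreover have "\<forall>p\<in>?A. \<forall>q\<in>?A. p = q"
    using inj_onD[OF inj[OF i]] U[OF j] by (auto simp: occurrences_eq)
  ultimately show "card ?A \<le> 1" using card_le_Suc0_iff_eq[of ?A] by simp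
qed

lemma clustered_points_coloring: "\<phi> \<in> colorings \<Longrightarrow> clustered_points N k \<phi> \<epsilon>"
  using \<epsilon> by unfold_locales (auto simp: colorings_def)

text \<open>For a nonempty class the mean is the best center, and an empty class costs 0.\<close>

lemma coloring_cost_ge:
  assumes "\<phi> \<in> colorings"
  shows "clustered_points.OPT N d k x \<phi> \<le> (\<Sum>q<N. sqdist d (x q) (c (\<phi> q)))"
proof -
  interpret clustered_points N d k x \<phi> \<epsilon> using assms by (rule clustered_points_coloring)
  have "OPT \<le> (\<Sum>j<k. cost j (c j))"
    unfolding OPT_def
  proof (rule sum_mono)
    fix j
    show "cst j \<le> cost j (c j)"
      by (cases "cls j = {}") (simp_all add: cost_eq, simp add: cst_def cost_def)
  qed
  also have "\<dots> = (\<Sum>j<k. \<Sum>q\<in>cls j. sqdist d (x q) (c (\<phi> q)))"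
    by (intro sum.cong) (auto simp: cost_def cls_def)
  also have "\<dots> = (\<Sum>q<N. sqdist d (x q) (c (\<phi> q)))" by (rule sum_cls)
  finally show ?thesis .
qed

lemma identity_coloring: obtains \<phi> where "\<phi> \<in> colorings"
  using ex_coloring[of "\<lambda>_ t. t"] sz_le by (metis dual_order.strict_trans1 inj_on_id2)

text \<open>For a fixed coloring the means bound the cost of all choices of centers from below. What
  remains is a minimum over finitely many colorings, which is attained.\<close>

lemma optimal_coloring:
  obtains \<phi> where "\<phi> \<in> colorings" "clustered_points.OPT N d k x \<phi> / real n \<le> optimum k d G"
proof -
  obtain \<phi>0 where \<phi>0: "\<phi>0 \<in> colorings" using identity_coloring .
  let ?f = "clustered_points.OPT N d k x"
  have "Min (?f ` colorings) \<in> ?f ` colorings" using \<phi>0 finite_colorings by (intro Min_in) auto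
  then obtain \<phi> where \<phi>: "\<phi> \<in> colorings" "?f \<phi> = Min (?f ` colorings)" by auto
  have "?f \<phi> / real n \<le> optimum k d G"
    unfolding optimum_def
  proof (rule cInf_greatest)
    \<comment> \<open>A lower bound passes to the infimum only if some solution exists; any coloring
      provides one.\<close>
    let ?U = "\<lambda>j. {(i, t) \<in> occurrences G. \<phi>0 (bs i + t) = j}"
    have "chromatic_partition k G ?U"
      by (rule partition_of_coloring[OF refl coloring_less[OF \<phi>0] coloring_inj[OF \<phi>0]])
    then have "solution k d G (\<lambda>_. replicate d 0) ?U" by (simp add: solution_def)
    then show "{objective k d G m U |m U. solution k d G m U} \<noteq> {}" by blast
  next
    fix v assume "v \<in> {objective k d G m U |m U. solution k d G m U}"
    then obtain c U where v: "v = objective k d G c U" and U: "chromatic_partition k G U"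
      by (auto simp: solution_def)
    obtain \<phi>' where \<phi>': "\<phi>' \<in> colorings" "\<And>j. j < k \<Longrightarrow> U j = {(i, t) \<in> occurrences G. \<phi>' (bs i + t) = j}"
      using coloring_of_partition[OF U] by blast
    have "v = (\<Sum>q<N. sqdist d (x q) (\<lambda>l. c (\<phi>' q) ! l)) / real n"
      unfolding v by (rule objective_eq[OF \<phi>'(2) coloring_less[OF \<phi>'(1)]])
    moreover have "?f \<phi> \<le> ?f \<phi>'" unfolding \<phi>(2) using finite_colorings \<phi>'(1) by (intro Min_le) auto
    moreover have "?f \<phi>' \<le> (\<Sum>q<N. sqdist d (x q) (\<lambda>l. c (\<phi>' q) ! l))"
      by (rule coloring_cost_ge[OF \<phi>'(1), of "\<lambda>j l. c j ! l"])
    ultimately show "?f \<phi> / real n \<le> v" by (simp add: divide_right_mono)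
  qed
  then show ?thesis using \<phi>(1) that by blast
qed

end

section \<open>Quality of the output and running time\<close>

lemma sqdist_cong: "(\<And>l. l < d \<Longrightarrow> v l = v' l) \<Longrightarrow> sqdist d u v = sqdist d u v'"
  by (simp add: sqdist_def)

context kcmeans
begin

lemma N_le: "N \<le> n * k"
proof -
  have "N \<le> (\<Sum>i<n. k)" unfolding bs_def using sz_le by (intro sum_mono) auto
  then show ?thesis by simp
qed

lemma output_cost:
  assumes "saved s"
  shows "solution k d G (output_centers d s) (output_partition G s)"
    "objective k d G (output_centers d s) (output_partition G s) = rmem s r_best 0 / real n"
proof -
  let ?U = "output_partition G s" and ?\<phi> = "nmem s 2"
  have U: "?U j = {(i, t) \<in> occurrences G. ?\<phi> (bs i + t) = j}" for j
    by (auto simp: output_partition_def occurrences_eq bs_eq)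
  have less: "?\<phi> (bs i + t) < k" if "i < n" "t < sz i" for i t
    using assms that by (simp add: saved_def admissible_def)
  have inj: "inj_on (\<lambda>t. ?\<phi> (bs i + t)) {..<sz i}" if "i < n" for i
    using assms that by (simp add: saved_def admissible_def)
  show "solution k d G (output_centers d s) ?U"
    using partition_of_coloring[OF U less inj] by (simp add: solution_def output_centers_def)
  have "objective k d G (output_centers d s) ?U =
      (\<Sum>q<N. sqdist d (x q) (\<lambda>l. output_centers d s (?\<phi> q) ! l)) / real n"
    by (rule objective_eq[OF U less])
  also have "(\<Sum>q<N. sqdist d (x q) (\<lambda>l. output_centers d s (?\<phi> q) ! l)) = rmem s r_best 0"
    using assms unfolding saved_def
    by (simp add: output_centers_def out_def cong: sum.cong sqdist_cong)
  finally show "objective k d G (output_centers d s) ?U = rmem s r_best 0 / real n" .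
qed

definition time :: nat where
  "time = 100 * ((n + 1) + (m + 1) + (M + 1) + (k + 1) * (m + 1) + (R + 1) + (k + 1) * (k + 1) + (N + k + 1))
    + (R + 1) * (1000 * ((k + 1) * (m + 1) * (N + 1) * (d + 1)) +
     (1100 * ((n + 1) * ((k ^ k + 1) * ((k + 1) * (k + 1)))) + 100 * ((N + 1) + (k * d + 1))) + 16)"

lemma exec_kcmeans_program:
  "\<exists>D. exec kcmeans_program (input_state k d \<epsilon> G) D \<and>
     measure_pmf.prob D {(s, t). approx_solution \<epsilon> k d G (output_centers d s) (output_partition G s)} \<ge> 1 / 2 \<and>
     (\<forall>(s, t) \<in> set_pmf D. t \<le> time)"
proof -
  obtain \<phi> where \<phi>: "\<phi> \<in> colorings" and opt: "clustered_points.OPT N d k x \<phi> / real n \<le> optimum k d G"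
    using optimal_coloring .
  interpret clustered_points N d k x \<phi> \<epsilon> using \<phi> by (rule clustered_points_coloring)
  interpret good_machine n d k m M R sz x \<phi> \<epsilon>
    by unfold_locales (use coloring_inj[OF \<phi>] in \<open>auto simp: m_def M_def R_def\<close>)
  let ?s = "input_state k d \<epsilon> G"
  have "run kcmeans_program ?s (T_setup + (R + 1) * (T_trial + 16)) saved
    (\<lambda>s'. if good s' then 1 else 0) (ennreal (1 / 2))"
    by (rule run_kcmeans_program[OF _ _ _ _ _ _ _ loaded_input])
      (auto simp: input_state_def n_def sz_def nth_default_def)
  then obtain D where D: "exec kcmeans_program ?s D"
    "\<And>s t. (s, t) \<in> set_pmf D \<Longrightarrow> t \<le> T_setup + (R + 1) * (T_trial + 16) \<and> saved s"
    "ennreal (1 / 2) \<le> (\<integral>\<^sup>+ y. (if good (fst y) then 1 else 0) \<partial>measure_pmf D)"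
    by (auto simp: run_def)
  let ?A = "{(s, t). approx_solution \<epsilon> k d G (output_centers d s) (output_partition G s)}"
  have approx: "approx_solution \<epsilon> k d G (output_centers d s) (output_partition G s)" if "saved s" "good s" for s
  proof -
    have "rmem s r_best 0 / real n \<le> (1 + \<epsilon>) * OPT / real n"
      using that(2) by (intro divide_right_mono) (auto simp: good_def)
    also have "\<dots> = (1 + \<epsilon>) * (OPT / real n)" by simp
    also have "\<dots> \<le> (1 + \<epsilon>) * optimum k d G" using opt \<epsilon> by (intro mult_left_mono) auto
    finally show ?thesis unfolding approx_solution_def using output_cost[OF that(1)] by simp
  qed
  have "ennreal (1 / 2) \<le> (\<integral>\<^sup>+ y. indicator ?A y \<partial>measure_pmf D)"
  proof (rule order_trans[OF D(3)], rule nn_integral_mono_AE)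
    show "AE y in measure_pmf D. (if good (fst y) then 1 else 0) \<le> (indicator ?A y :: ennreal)"
      using D(2) approx by (auto simp: AE_measure_pmf_iff indicator_def)
  qed
  then have "ennreal (1 / 2) \<le> ennreal (measure_pmf.prob D ?A)"
    by (simp add: measure_pmf.emeasure_eq_measure)
  then have "1 / 2 \<le> measure_pmf.prob D ?A"
    by (rule ennreal_le_iff[THEN iffD1, rotated]) simp
  moreover have "T_setup + (R + 1) * (T_trial + 16) = time"
    by (simp add: T_setup_def T_trial_def time_def)
  ultimately show ?thesis using D by auto
qed

text \<open>With X = k / \<epsilon>, the trials contribute the exponent 41 X^2 (15 + 2 X) = 82 X^3 +
  615 X^2, the \<open>k ^ k\<close> assignments at most X^2, and the factor X^3 at most 3 X. The sum
  is the polynomial. The 41 comes from rounding up 40 / \<epsilon>.\<close>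

lemma time_le:
  "real time \<le> 2000000 * 2 powr poly [:0, 3, 616, 82:] (real k / \<epsilon>) * real n * real d"
proof -
  define X where "X = real k / \<epsilon>"
  define P where "P = 2 powr (41 * X\<^sup>2 * (15 + 2 * X))"
  define E where "E = 2 powr X\<^sup>2"
  define r where "r = real n"
  define e where "e = real d"
  have r: "1 \<le> r" and e: "1 \<le> e" using n_pos d1 by (simp_all add: r_def e_def)
  have kX: "real k \<le> X" unfolding X_def using \<epsilon> k2 by (simp add: field_simps)
  have X2: "2 \<le> X" using kX k2 by simp
  have eX: "1 / \<epsilon> \<le> X" unfolding X_def using \<epsilon> k2 by (simp add: field_simps)
  have X_powr: "X \<le> 2 powr X"
  proof -
    define z where "z = (X - 1) * ln 2"
    have "(X - 1) * (1 / 2) \<le> z"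
      unfolding z_def using X2 ln2_ge_two_thirds by (intro mult_left_mono) auto
    then have "X \<le> 2 * (1 + z)" by simp
    also have "\<dots> \<le> 2 * exp z" by (intro mult_left_mono exp_ge_add_one_self) auto
    also have "\<dots> = 2 powr X" by (simp add: z_def powr_def algebra_simps exp_diff)
    finally show ?thesis .
  qed
  have E1: "1 \<le> E" unfolding E_def using X2 by (simp add: ge_one_powr_ge_zero)
  have P1: "1 \<le> P" unfolding P_def using X2 by (simp add: ge_one_powr_ge_zero)
  have XX: "X \<le> X\<^sup>2" using X2 by (simp add: power2_eq_square)
  have XXX: "X\<^sup>2 \<le> X ^ 3" using X2 by (intro power_increasing) auto
  have m_le: "real m \<le> 41 * X"
  proof -
    have "0 \<le> 40 / \<epsilon>" using \<epsilon> by simp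
    then have "real m \<le> 40 / \<epsilon> + 1" unfolding m_def by linarith
    then show ?thesis using eX X2 by linarith
  qed
  have N_le': "real N \<le> r * X"
  proof -
    have "real N \<le> real (n * k)" using N_le of_nat_le_iff by blast
    also have "\<dots> \<le> r * X" using kX by (simp add: r_def mult_left_mono)
    finally show ?thesis .
  qed
  have rX: "1 \<le> r * X" using r X2 mult_mono[of 1 r 1 X] by simp
  have M_le: "real M \<le> 4610 * (r * X ^ 3)"
  proof -
    have "0 \<le> 4608 * real k * real N / (\<epsilon> * \<epsilon>)" using \<epsilon> by simp
    then have "real M \<le> 4608 * real k * real N / (\<epsilon> * \<epsilon>) + 2" unfolding M_def by linarith
    also have "4608 * real k * real N / (\<epsilon> * \<epsilon>) = 4608 * (X * (1 / \<epsilon>) * real N)" by (simp add: X_def)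
    also have "X * (1 / \<epsilon>) * real N \<le> X * X * (r * X)"
      using eX X2 N_le' \<epsilon> by (intro mult_mono) auto
    also have "X * X * (r * X) = r * X ^ 3" by (simp add: power3_eq_cube)
    finally have "real M \<le> 4608 * (r * X ^ 3) + 2" by simp
    moreover have "1 \<le> r * X ^ 3" using r X2 mult_mono[of 1 r 1 "X ^ 3"] by simp
    ultimately show ?thesis by linarith
  qed
  have k_pow: "real k ^ k \<le> E"
  proof -
    have "real k ^ k \<le> (2 ^ k) ^ k" using of_nat_less_two_power[of k, where ?'a = real] by (intro power_mono) auto
    also have "\<dots> = 2 powr (real k * real k)" by (simp add: powr_realpow[symmetric] powr_powr)
    also have "\<dots> \<le> E" unfolding E_def power2_eq_square using kX by (intro powr_mono mult_mono) auto
    finally show ?thesis .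
  qed
  have R_le: "real R + 1 \<le> 3 * P"
  proof -
    let ?B = "9216 * (real k * real (k + 1)) / (\<epsilon> * \<epsilon>)"
    have B0: "0 \<le> ?B" using \<epsilon> by simp
    have "?B \<le> 9216 * (real k * (2 * real k)) / (\<epsilon> * \<epsilon>)"
      using \<epsilon> k2 by (intro divide_right_mono mult_left_mono) auto
    also have "\<dots> = 18432 * X\<^sup>2" by (simp add: X_def power2_eq_square)
    \<comment> \<open>18432 is rounded up to 2^15, the source of the 15 in the exponent.\<close>
    also have "\<dots> \<le> 32768 * (2 powr X)\<^sup>2" using X_powr X2 by (intro mult_mono power_mono) auto
    also have "\<dots> = 2 powr (15 + 2 * X)" by (simp add: powr_add powr_power mult.commute)
    finally have "?B ^ (k * m) \<le> (2 powr (15 + 2 * X)) ^ (k * m)" using B0 by (intro power_mono)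
    also have "\<dots> = 2 powr (real (k * m) * (15 + 2 * X))" by (simp add: powr_power mult.commute)
    also have "\<dots> \<le> P"
    proof -
      have "real (k * m) \<le> X * (41 * X)" unfolding of_nat_mult using kX m_le by (intro mult_mono) auto
      also have "\<dots> = 41 * X\<^sup>2" by (simp add: power2_eq_square)
      finally show ?thesis unfolding P_def using X2 by (intro powr_mono mult_right_mono) auto
    qed
    finally have "?B ^ (k * m) \<le> P" .
    moreover have "0 \<le> ?B ^ (k * m)" using B0 by simp
    then have "real R \<le> ?B ^ (k * m) + 1" unfolding R_def by linarith
    ultimately show ?thesis using P1 by linarith
  qed
  \<comment> \<open>A common bound for the terms of one trial. With the factor \<open>P\<close> for
    the number of trials it also dominates the setup, so that only numerical constants have to be
    added.\<close>
  define Z where "Z = X ^ 3 * E * (r * e)"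
  have Z: "r * X ^ 3 \<le> Z" "X ^ 3 * (r * e) \<le> Z" "r * (X\<^sup>2 * E) \<le> Z" "X ^ 3 \<le> Z" "1 \<le> Z"
  proof -
    have re: "r \<le> r * e" "1 \<le> r * e" using r e mult_mono[of 1 r 1 e] by auto
    have X3: "1 \<le> X ^ 3" using X2 by simp
    have XE: "X ^ 3 \<le> X ^ 3 * E" using mult_left_mono[OF E1, of "X ^ 3"] X2 by simp
    show 2: "X ^ 3 * (r * e) \<le> Z" unfolding Z_def using XE re by (intro mult_right_mono) auto
    have "X ^ 3 * r \<le> X ^ 3 * (r * e)" using re X2 by (intro mult_left_mono) auto
    then show 1: "r * X ^ 3 \<le> Z" using 2 by (simp add: mult.commute)
    have "X\<^sup>2 * E * r \<le> X ^ 3 * E * (r * e)" using XXX E1 re r X2 by (intro mult_mono) auto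
    then show "r * (X\<^sup>2 * E) \<le> Z" by (simp add: Z_def mult_ac)
    have "X ^ 3 \<le> r * X ^ 3" using mult_right_mono[OF r, of "X ^ 3"] X2 by simp
    with 1 show "X ^ 3 \<le> Z" by linarith
    with X3 show "1 \<le> Z" by linarith
  qed
  have trial: "1000 * ((real k + 1) * (real m + 1) * (real N + 1) * (real d + 1)) +
     (1100 * ((real n + 1) * ((real k ^ k + 1) * ((real k + 1) * (real k + 1)))) + 100 * ((real N + 1) + (real k * real d + 1))) + 16
     \<le> 400000 * Z"
  proof -
    have k1: "real k + 1 \<le> 2 * X" using kX X2 by linarith
    have "(real k + 1) * (real m + 1) * (real N + 1) * (real d + 1) \<le> (2 * X) * (42 * X) * (2 * (r * X)) * (2 * e)"
      using k1 m_le N_le' rX X2 e r by (intro mult_mono) (auto simp: e_def)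
    also have "\<dots> = 336 * (X ^ 3 * (r * e))" by (simp add: power3_eq_cube)
    finally have 1: "(real k + 1) * (real m + 1) * (real N + 1) * (real d + 1) \<le> 336 * Z" using Z(2) by linarith
    have "(real n + 1) * ((real k ^ k + 1) * ((real k + 1) * (real k + 1))) \<le> (2 * r) * ((2 * E) * ((2 * X) * (2 * X)))"
      using k1 k_pow E1 r X2 by (intro mult_mono) (auto simp: r_def)
    also have "\<dots> = 16 * (r * (X\<^sup>2 * E))" by (simp add: power2_eq_square)
    finally have 2: "(real n + 1) * ((real k ^ k + 1) * ((real k + 1) * (real k + 1))) \<le> 16 * Z" using Z(3) by linarith
    have "X \<le> X ^ 3" using XX XXX by linarith
    then have "r * X \<le> r * X ^ 3" using r by (intro mult_left_mono) auto
    then have 3: "real N \<le> Z" using N_le' Z(1) by linarith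
    have "real k * real d \<le> X ^ 3 * (r * e)"
      using kX \<open>X \<le> X ^ 3\<close> r e X2 mult_mono[of 1 r e e] by (intro mult_mono) (auto simp: e_def)
    then have 4: "real k * real d \<le> Z" using Z(2) by linarith
    have "1000 * a1 + (1100 * a2 + 100 * ((a3 + 1) + (a4 + 1))) + 16 \<le> 400000 * Z"
      if "a1 \<le> 336 * Z" "a2 \<le> 16 * Z" "a3 \<le> Z" "a4 \<le> Z" for a1 a2 a3 a4
      using that Z(5) by simp
    from this[OF 1 2 3 4] show ?thesis .
  qed
  have preparation: "100 * ((real n + 1) + (real m + 1) + (real M + 1) + (real k + 1) * (real m + 1) + (real R + 1) + (real k + 1) * (real k + 1) + (real N + real k + 1))
     \<le> 800000 * (Z * P)"
  proof -
    have X3: "X \<le> X ^ 3" "1 \<le> X ^ 3" using XX XXX X2 by linarith+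
    have "r \<le> r * X ^ 3" using mult_left_mono[OF X3(2), of r] r by simp
    then have 1: "real n \<le> Z" using Z(1) unfolding r_def by linarith
    have 2: "real m \<le> 41 * Z" "real k \<le> Z" using m_le kX X3 Z(4) by linarith+
    have "(real k + 1) * (real m + 1) \<le> (2 * X) * (42 * X)" using kX m_le X2 by (intro mult_mono) auto
    also have "\<dots> = 84 * X\<^sup>2" by (simp add: power2_eq_square)
    finally have 3: "(real k + 1) * (real m + 1) \<le> 84 * Z" using XXX Z(4) by linarith
    have "(real k + 1) * (real k + 1) \<le> (2 * X) * (2 * X)" using kX X2 by (intro mult_mono) auto
    also have "\<dots> = 4 * X\<^sup>2" by (simp add: power2_eq_square)
    finally have 4: "(real k + 1) * (real k + 1) \<le> 4 * Z" using XXX Z(4) by linarith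
    have "r * X \<le> r * X ^ 3" using r X3 by (intro mult_left_mono) auto
    then have 5: "real N \<le> Z" using N_le' Z(1) by linarith
    have ZP: "Z \<le> Z * P" "P \<le> Z * P"
      using mult_left_mono[OF P1, of Z] mult_right_mono[OF Z(5), of P] Z(5) P1 by simp_all
    have "100 * ((real n + 1) + (real m + 1) + (real M + 1) + a3 + (real R + 1) + a4 + (real N + real k + 1)) \<le> 800000 * w"
      if "a3 \<le> 84 * Z" "a4 \<le> 4 * Z" "Z \<le> w" "P \<le> w" for a3 a4 w
      using that 1 2 5 M_le Z(1,5) R_le by simp
    from this[OF 3 4 ZP] show ?thesis .
  qed
  have "real time \<le> 800000 * (Z * P) + (3 * P) * (400000 * Z)"
    unfolding time_def of_nat_add of_nat_mult of_nat_power of_nat_numeral of_nat_1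
    by (rule add_mono[OF preparation mult_mono[OF R_le trial]]) (use P1 in auto)
  \<comment> \<open>800000 for the setup plus 3 times 400000 for the trials.\<close>
  also have "\<dots> = 2000000 * (X ^ 3 * E * P) * (r * e)" by (simp add: Z_def algebra_simps)
  also have "\<dots> \<le> 2000000 * (2 powr (3 * X) * E * P) * (r * e)"
  proof -
    have "X ^ 3 \<le> (2 powr X) ^ 3" using X_powr X2 by (intro power_mono) auto
    also have "\<dots> = 2 powr (3 * X)" by (simp add: powr_power mult.commute)
    finally show ?thesis using r e E1 P1 by (intro mult_left_mono mult_right_mono) auto
  qed
  also have "2 powr (3 * X) * E * P = 2 powr poly [:0, 3, 616, 82:] X"
    unfolding E_def P_def powr_add[symmetric] by (simp add: algebra_simps power2_eq_square)
  finally show ?thesis by (simp add: X_def r_def e_def mult.assoc)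
qed

end

theorem theorem5:
  "\<exists>(P :: com) (p :: real poly) (C :: real) (c :: real). c > 0 \<and>
     (\<forall>(k :: nat) (d :: nat) (\<epsilon> :: real) (G :: family).
        k \<ge> 2 \<and> d \<ge> 1 \<and> 0 < \<epsilon> \<and> \<epsilon> < 1 \<and> kcmeans_instance k d G \<longrightarrow>
        (\<exists>D. exec P (input_state k d \<epsilon> G) D \<and>
           measure_pmf.prob D {(s, t).
             approx_solution \<epsilon> k d G (output_centers d s) (output_partition G s)} \<ge> c \<and>
           (length G \<ge> 2 \<longrightarrow> (\<forall>(s, t) \<in> set_pmf D.
              real t \<le> C * 2 powr (poly p (real k / \<epsilon>)) * real (length G)
                       * log 2 (real (length G)) ^ (k + 1) * real d))))"
proof (rule exI[of _ kcmeans_program], rule exI[of _ "[:0, 3, 616, 82:]"], rule exI[of _ 2000000],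
    rule exI[of _ "1 / 2"], intro conjI allI impI)
  show "(1 / 2 :: real) > 0" by simp
  fix k d :: nat and \<epsilon> :: real and G :: family
  assume "k \<ge> 2 \<and> d \<ge> 1 \<and> 0 < \<epsilon> \<and> \<epsilon> < 1 \<and> kcmeans_instance k d G"
  then interpret kcmeans k d \<epsilon> G by unfold_locales auto
  let ?p = "[:0, 3, 616, 82:] :: real poly"
  obtain D where D: "exec kcmeans_program (input_state k d \<epsilon> G) D"
    "measure_pmf.prob D {(s, t). approx_solution \<epsilon> k d G (output_centers d s) (output_partition G s)} \<ge> 1 / 2"
    "\<And>s t. (s, t) \<in> set_pmf D \<Longrightarrow> t \<le> time"
    using exec_kcmeans_program by blast
  have "real t \<le> 2000000 * 2 powr (poly ?p (real k / \<epsilon>)) * real (length G) * log 2 (real (length G)) ^ (k + 1) * real d"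
    if "length G \<ge> 2" "(s, t) \<in> set_pmf D" for s t
  proof -
    have "real t \<le> real time" using D(3) that(2) by simp
    also have "\<dots> \<le> 2000000 * 2 powr (poly ?p (real k / \<epsilon>)) * real (length G) * 1 * real d"
      using time_le by (simp add: n_def)
    also have "\<dots> \<le> 2000000 * 2 powr (poly ?p (real k / \<epsilon>)) * real (length G) * log 2 (real (length G)) ^ (k + 1) * real d"
    proof (intro mult_right_mono mult_left_mono)
      \<comment> \<open>The bound obtained is linear in \<open>n\<close>; for
        \<open>n \<ge> 2\<close> the logarithmic factor is at least 1, so it can be
        inserted.\<close>
      have "1 \<le> log 2 (real (length G))" using that(1) by (subst le_log_iff) auto
      then show "1 \<le> log 2 (real (length G)) ^ (k + 1)" by (rule one_le_power)
    qed auto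
    finally show ?thesis .
  qed
  with D show "\<exists>D. exec kcmeans_program (input_state k d \<epsilon> G) D \<and>
      measure_pmf.prob D {(s, t). approx_solution \<epsilon> k d G (output_centers d s) (output_partition G s)} \<ge> 1 / 2 \<and>
      (length G \<ge> 2 \<longrightarrow> (\<forall>(s, t) \<in> set_pmf D.
        real t \<le> 2000000 * 2 powr (poly ?p (real k / \<epsilon>)) * real (length G)
           * log 2 (real (length G)) ^ (k + 1) * real d))"
    by blast
qed

end
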